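(* Let $\mathcal{P}=(P,d\mu,d\sigma)$ be an $n$-dimensional system with $n\ge2$. The map $[0,\infty]\to\mathcal{M}^{\frac{n}{n-1}}(P)$ given by $T\mapsto u^{\mathrm{can}}_T$ for $T\in[0,\infty)$ and $\infty\mapsto 1_P$ (the constant function $1$) is continuous with respect to the $L^p(P,d\mu)$-topology for every $p\in[1,\frac{n}{n-1})$, and the functions $T\mapsto F_{\mathcal{P}}(T,u^{\mathrm{can}}_T)$, $T\mapsto U_{\mathcal{P}}(u^{\mathrm{can}}_T)$, $T\mapsto S_{\mathcal{P}}(u^{\mathrm{can}}_T)$ are continuous on $[0,\infty)$. Furthermore \[ \lim_{T\to\infty}F_{\mathcal{P}}(T,u^{\mathrm{can}}_T)=\lim_{T\to\infty}U_{\mathcal{P}}(u^{\mathrm{can}}_T)=U_{\mathcal{P}}(1_P),\qquad \lim_{T\to\infty}T\,S_{\mathcal{P}}(u^{\mathrm{can}}_T)=0. \]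
   Context: An $n$-dimensional system is a triple $\mathcal{P}=(P,d\mu,d\sigma)$ where $P$ is a simple polytope in an $n$-dimensional real affine space $V$ (a compact subset with non-empty interior that is a finite intersection of closed half spaces, such that every vertex is the intersection of exactly $n$ facets), $d\mu$ is the restriction to $P$ of a translation-invariant measure on $V$ that is positive and finite on bounded non-empty open sets (i.e. a positive multiple of Lebesgue measure), and $d\sigma$ is a measure on the boundary $\partial P$ whose restriction to each facet is a positive multiple of the Lebesgue measure of the affine hyperplane spanned by that facet. For $p\ge1$, $\mathcal{M}^p(P)$ is the set of lower semicontinuous functions $u:P\to(0,\infty]$ that are log-convex ($u((1-t)x+ty)\le u(x)^{1-t}u(y)^t$ for $x,y\in P$, $t\in[0,1]$) and satisfy $\int_P u\,d\mu=\int_P d\mu$ and $\int_P u^p\,d\mu<\infty$. For $u\in\mathcal{M}^1(P)$: entropy $S_{\mathcal{P}}(u):=-\frac{1}{\int_Pd\mu}\int_P u\log u\,d\mu\in[-\infty,0]$; internal $\mu$-energy $U_{\mathcal{P}}(u):=\frac{1}{\int_Pd\mu}\int_{\partial P}u\,d\sigma\in(0,\infty]$; and for $T\in\mathbb{R}$, free $\mu$-energy $F_{\mathcal{P}}(T,u):=U_{\mathcal{P}}(u)-TS_{\mathcal{P}}(u)$ if $S_{\mathcal{P}}(u)>-\infty$, and $F_{\mathcal{P}}(T,u):=+\infty$ if $S_{\mathcal{P}}(u)=-\infty$. The $\mu$-canonical distribution of temperature $T>0$ is the unique minimizer $u^{\mathrm{can}}_T$ of $F_{\mathcal{P}}(T,\cdot)$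 on $\mathcal{M}^1(P)$; for $T=0$, $u^{\mathrm{can}}_0$ is the unique minimizer of $U_{\mathcal{P}}$ on $\mathcal{M}^1(P)$ which has maximal entropy $S_{\mathcal{P}}$ among all minimizers of $U_{\mathcal{P}}$ (both exist, are unique, and lie in $\mathcal{M}^{\frac{n}{n-1}}(P)$). *)

theory Defs
  imports "HOL-Analysis.Analysis"
begin

definition simple_polytope :: "'a::euclidean_space set \<Rightarrow> bool" where
  "simple_polytope P \<longleftrightarrow> compact P \<and> interior P \<noteq> {} \<and> polyhedron P \<and>
     (\<forall>v. v extreme_point_of P \<longrightarrow> card {F. F facet_of P \<and> v \<in> F} = DIM('a))"

text \<open>Parametrisation of the affine hulls of the facets by injective affine maps
  from an (n-1)-dimensional Euclidean space 'b; the push-forward of Lebesgue measure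
  along such a map is a positive multiple of the Lebesgue measure of the hyperplane.\<close>
definition facet_params :: "'a::euclidean_space set \<Rightarrow> ('a set \<Rightarrow> 'b::euclidean_space \<Rightarrow> 'a) \<Rightarrow> bool" where
  "facet_params P g \<longleftrightarrow> (\<forall>F. F facet_of P \<longrightarrow>
     (\<exists>A b. linear A \<and> inj A \<and> g F = (\<lambda>y. A y + b)) \<and> range (g F) = affine hull F)"

text \<open>n-dimensional system: P simple polytope, d\<mu> = cmu * Lebesgue, d\<sigma> restricted to a
  facet F is csig F times the push-forward of Lebesgue measure along g F.\<close>
definition is_system :: "'a::euclidean_space set \<Rightarrow> real \<Rightarrow> ('a set \<Rightarrow> real) \<Rightarrow> ('a set \<Rightarrow> 'b::euclidean_space \<Rightarrow> 'a) \<Rightarrow> bool" where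
  "is_system P cmu csig g \<longleftrightarrow> simple_polytope P \<and> DIM('b) + 1 = DIM('a) \<and> cmu > 0 \<and>
     (\<forall>F. F facet_of P \<longrightarrow> csig F > 0) \<and> facet_params P g"

definition mu_int :: "'a::euclidean_space set \<Rightarrow> real \<Rightarrow> ('a \<Rightarrow> ennreal) \<Rightarrow> ennreal" where
  "mu_int P cmu f = ennreal cmu * (\<integral>\<^sup>+ x. f x * indicator P x \<partial>lborel)"

definition vol :: "'a::euclidean_space set \<Rightarrow> real \<Rightarrow> real" where
  "vol P cmu = cmu * measure lborel P"

definition sigma_int :: "'a::euclidean_space set \<Rightarrow> ('a set \<Rightarrow> real) \<Rightarrow> ('a set \<Rightarrow> 'b::euclidean_space \<Rightarrow> 'a)
    \<Rightarrow> ('a \<Rightarrow> ennreal) \<Rightarrow> ennreal" where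
  "sigma_int P csig g f = (\<Sum>F\<in>{F. F facet_of P}.
      ennreal (csig F) * (\<integral>\<^sup>+ y. indicator F (g F y) * f (g F y) \<partial>lborel))"

text \<open>x^p for x in (0,\<infinity>], p > 0, with \<infinity>^p = \<infinity>.\<close>
definition epow :: "ennreal \<Rightarrow> real \<Rightarrow> ennreal" where
  "epow x p = (if x = \<infinity> then \<infinity> else ennreal (enn2real x powr p))"

definition lsc_on :: "'a::topological_space set \<Rightarrow> ('a \<Rightarrow> ennreal) \<Rightarrow> bool" where
  "lsc_on P u \<longleftrightarrow> (\<forall>x\<in>P. \<forall>a. a < u x \<longrightarrow> (\<forall>\<^sub>F y in at x within P. a < u y))"

text \<open>log-convexity u((1-t)x+ty) \<le> u(x)^(1-t) u(y)^t, with the convention that the right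
  hand side is \<infinity> if u x or u y is \<infinity> and t \<in> (0,1) (cases t = 0,1 are trivial).\<close>
definition log_convex_on :: "'a::real_vector set \<Rightarrow> ('a \<Rightarrow> ennreal) \<Rightarrow> bool" where
  "log_convex_on P u \<longleftrightarrow> (\<forall>x\<in>P. \<forall>y\<in>P. \<forall>t::real. 0 < t \<and> t < 1 \<longrightarrow> u x \<noteq> \<infinity> \<longrightarrow> u y \<noteq> \<infinity> \<longrightarrow>
      u ((1 - t) *\<^sub>R x + t *\<^sub>R y) \<le> ennreal (enn2real (u x) powr (1 - t) * enn2real (u y) powr t))"

definition Mp :: "'a::euclidean_space set \<Rightarrow> real \<Rightarrow> real \<Rightarrow> ('a \<Rightarrow> ennreal) set" where
  "Mp P cmu p = {u. lsc_on P u \<and> (\<forall>x\<in>P. u x > 0) \<and> log_convex_on P u \<and>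
      mu_int P cmu u = mu_int P cmu (\<lambda>_. 1) \<and> mu_int P cmu (\<lambda>x. epow (u x) p) < \<infinity>}"

definition xlogx :: "ennreal \<Rightarrow> ereal" where
  "xlogx x = (if x = \<infinity> then \<infinity> else ereal (enn2real x * ln (enn2real x)))"

text \<open>Entropy S(u) = -(1/\<integral>d\<mu>) \<integral>_P u log u d\<mu>, in [-\<infinity>, 0] for u \<in> \<M>^1.\<close>
definition entropy_S :: "'a::euclidean_space set \<Rightarrow> real \<Rightarrow> ('a \<Rightarrow> ennreal) \<Rightarrow> ereal" where
  "entropy_S P cmu u = - (ereal (1 / vol P cmu) *
      (enn2ereal (mu_int P cmu (\<lambda>x. e2ennreal (max 0 (xlogx (u x)))))
       - enn2ereal (mu_int P cmu (\<lambda>x. e2ennreal (max 0 (- xlogx (u x)))))))"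

definition energy_U :: "'a::euclidean_space set \<Rightarrow> real \<Rightarrow> ('a set \<Rightarrow> real) \<Rightarrow> ('a set \<Rightarrow> 'b::euclidean_space \<Rightarrow> 'a)
    \<Rightarrow> ('a \<Rightarrow> ennreal) \<Rightarrow> ereal" where
  "energy_U P cmu csig g u = ereal (1 / vol P cmu) * enn2ereal (sigma_int P csig g u)"

definition free_F :: "'a::euclidean_space set \<Rightarrow> real \<Rightarrow> ('a set \<Rightarrow> real) \<Rightarrow> ('a set \<Rightarrow> 'b::euclidean_space \<Rightarrow> 'a)
    \<Rightarrow> real \<Rightarrow> ('a \<Rightarrow> ennreal) \<Rightarrow> ereal" where
  "free_F P cmu csig g T u = (if entropy_S P cmu u = - \<infinity> then \<infinity>
      else energy_U P cmu csig g u - ereal T * entropy_S P cmu u)"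

definition is_canonical :: "'a::euclidean_space set \<Rightarrow> real \<Rightarrow> ('a set \<Rightarrow> real) \<Rightarrow> ('a set \<Rightarrow> 'b::euclidean_space \<Rightarrow> 'a)
    \<Rightarrow> real \<Rightarrow> ('a \<Rightarrow> ennreal) \<Rightarrow> bool" where
  "is_canonical P cmu csig g T u \<longleftrightarrow> u \<in> Mp P cmu 1 \<and>
     (if T > 0 then (\<forall>v\<in>Mp P cmu 1. free_F P cmu csig g T u \<le> free_F P cmu csig g T v)
      else (\<forall>v\<in>Mp P cmu 1. energy_U P cmu csig g u \<le> energy_U P cmu csig g v) \<and>
           (\<forall>v\<in>Mp P cmu 1. (\<forall>w\<in>Mp P cmu 1. energy_U P cmu csig g v \<le> energy_U P cmu csig g w)
               \<longrightarrow> entropy_S P cmu v \<le> entropy_S P cmu u))"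

definition Lp_dist :: "'a::euclidean_space set \<Rightarrow> real \<Rightarrow> real \<Rightarrow> ('a \<Rightarrow> ennreal) \<Rightarrow> ('a \<Rightarrow> ennreal) \<Rightarrow> ennreal" where
  "Lp_dist P cmu p u v = mu_int P cmu (\<lambda>x. if u x = \<infinity> \<or> v x = \<infinity> then \<infinity>
      else ennreal (\<bar>enn2real (u x) - enn2real (v x)\<bar> powr p))"

end

theory Submission
  imports Defs "HOL-Real_Asymp.Real_Asymp"
begin

text \<open>
  The set of admissible functions is convex, the energy is affine on it and the entropy
  is uniformly concave with respect to the \<open>L\<^sup>1\<close> distance. Comparing the minimizers at two temperatures
  \<open>T < T'\<close> with their midpoint bounds their \<open>L\<^sup>1\<close> distance by the entropy difference, which is monotone
  in the temperature, so no compactness argument is needed.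

  Continuity of the entropy at \<open>T = 0\<close> needs a limit object: the set of densities is closed in \<open>L\<^sup>1\<close> and
  the energy is lower semicontinuous on it. Both come from the averages
  (\<open>dil s u x\<close> below) \<open>A\<^sub>s u x = avg\<^bsub>z\<in>P\<^esub> u ((1-s) x + s z)\<close>, which depend \<open>L\<^sup>1\<close>-continuously on \<open>u\<close>, satisfy
  \<open>A\<^sub>s u \<le> (1-s) u + s\<close> on \<open>P\<close> up to the boundary, and for which \<open>(A\<^sub>s u - s) / (1-s)\<close> increases
  to \<open>u\<close> as \<open>s\<close> decreases to \<open>0\<close>.

  Integrability with exponent \<open>n/(n-1)\<close> follows from the Loomis--Whitney inequality: on each line parallel
  to a coordinate axis a convex function is bounded by its values at the two boundary points of \<open>P\<close>.
  The \<open>L\<^sup>p\<close> statements follow by interpolation between \<open>L\<^sup>1\<close> and \<open>L\<^bsup>n/(n-1)\<^esup>\<close>.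
\<close>

section \<open>The Loomis--Whitney inequality\<close>

text \<open>The energy lives on the boundary of \<open>P\<close>, a null set about which convergence
  in the mean says nothing, so every limit argument must recover boundary values from inside. The
  averages can do so because the copy of \<open>P\<close> at a boundary point still has positive
  measure. Their modulus of continuity \<open>K s\<close> blows up as \<open>s\<close> tends to 0;
  limits are therefore taken in the sequence first, at fixed \<open>s\<close>, and in
  \<open>s\<close> afterwards.

  At \<open>T > 0\<close> minimality bounds distances through \<open>|T' - T|\<close> alone, and
  continuity of the entropy follows. At 0 the entropy has weight 0 in the free energy, so a midpoint
  test says nothing about it. The entropies at decreasing temperatures converge by monotonicity,
  which makes the minimizers Cauchy; their limit minimizes the energy, and the maximal-entropy
  clause then bounds its entropy by that of \<open>ucan 0\<close>.

  The exponent n/(n-1) enters twice: any exponent above 1 makes \<open>u ln u\<close> integrable, so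
  entropy and energy become real numbers, and the uniform bound controls the tails in the
  interpolation.\<close>

lemma am_gm_power_ennreal:
  fixes x :: "'i \<Rightarrow> ennreal"
  assumes "finite K" "K \<noteq> {}"
  shows "(\<Prod>i\<in>K. x i) \<le> (ennreal (1 / card K) * (\<Sum>i\<in>K. x i)) ^ card K"
proof (cases "\<exists>i\<in>K. x i = \<infinity>")
  case True
  then have "(\<Sum>i\<in>K. x i) = \<infinity>" using assms by auto
  moreover have "card K > 0" using assms by (simp add: card_gt_0_iff)
  ultimately show ?thesis by (simp add: ennreal_mult_top)
next
  case False
  define r where "r i = enn2real (x i)" for i
  have xr: "x i = ennreal (r i)" if "i \<in> K" for i
    using False that by (auto simp: r_def less_top)
  have k: "card K > 0" using assms by (simp add: card_gt_0_iff)
  have r0: "r i \<ge> 0" for i by (simp add: r_def)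
  have p0: "(\<Prod>i\<in>K. r i) \<ge> 0" by (simp add: prod_nonneg r0)
  have "(\<Prod>i\<in>K. r i) = ((\<Prod>i\<in>K. r i) powr (1 / card K)) ^ card K"
    using p0 k by (cases "(\<Prod>i\<in>K. r i) = 0") (auto simp: powr_power)
  also have "\<dots> \<le> (\<Sum>i\<in>K. r i / card K) ^ card K"
    by (rule power_mono[OF arith_geom_mean]) (use assms r0 in auto)
  also have "(\<Sum>i\<in>K. r i / card K) = 1 / card K * (\<Sum>i\<in>K. r i)"
    by (simp add: sum_divide_distrib)
  finally have "ennreal (\<Prod>i\<in>K. r i) \<le> ennreal ((1 / card K * (\<Sum>i\<in>K. r i)) ^ card K)"
    by (rule ennreal_leI)
  also have "\<dots> = (ennreal (1 / card K) * (\<Sum>i\<in>K. ennreal (r i))) ^ card K"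
    by (subst sum_ennreal) (simp_all add: sum_nonneg r0 ennreal_power flip: ennreal_mult)
  finally show ?thesis using xr r0 by (simp flip: prod_ennreal)
qed

lemma ennreal_power_le_cancel:
  fixes a b :: ennreal
  assumes "a ^ k \<le> b ^ k" "k > 0"
  shows "a \<le> b"
proof (cases b)
  case (real s)
  show ?thesis
  proof (cases a)
    case (real r)
    then show ?thesis using assms \<open>b = ennreal s\<close> \<open>0 \<le> s\<close>
      by (simp add: ennreal_power)
  next
    case top
    then show ?thesis using assms \<open>b = ennreal s\<close> \<open>0 \<le> s\<close>
      by (simp add: ennreal_power top_unique)
  qed
qed simp

text \<open>Hoelder's inequality with equal exponents, freed of roots by taking powers. Dividing
  each \<open>A i\<close> by its integral and applying AM-GM to the normalized factors bounds
  \<open>h\<close> by a multiple of a mean of functions of integral 1.\<close>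

lemma Hoelder_power:
  fixes A :: "'i \<Rightarrow> 'a \<Rightarrow> ennreal"
  assumes K: "finite K" "K \<noteq> {}"
    and [measurable]: "\<And>i. i \<in> K \<Longrightarrow> A i \<in> borel_measurable M" "h \<in> borel_measurable M"
    and le: "\<And>x. x \<in> space M \<Longrightarrow> h x ^ card K \<le> c * (\<Prod>i\<in>K. A i x)"
  shows "(\<integral>\<^sup>+x. h x \<partial>M) ^ card K \<le> c * (\<Prod>i\<in>K. \<integral>\<^sup>+x. A i x \<partial>M)"
proof -
  define I where "I i = (\<integral>\<^sup>+x. A i x \<partial>M)" for i
  have k: "card K > 0" using K by (simp add: card_gt_0_iff)
  \<comment> \<open>The normalization divides by the integrals, so vanishing factors and an infinite
    right-hand side are split off. Once no factor vanishes, a single infinite one makes the whole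
    product infinite.\<close>
  consider (zero) "c = 0" | (zero2) i where "i \<in> K" "I i = 0"
    | (inf) "c * (\<Prod>i\<in>K. I i) = \<infinity>"
    | (fin) "c \<noteq> 0" "c < \<infinity>" "\<And>i. i \<in> K \<Longrightarrow> 0 < I i \<and> I i < \<infinity>"
  proof -
    have "c * (\<Prod>i\<in>K. I i) = \<infinity>" if "c \<noteq> 0" "\<And>i. i \<in> K \<Longrightarrow> I i \<noteq> 0"
      "c = \<infinity> \<or> (\<exists>i\<in>K. I i = \<infinity>)"
    proof -
      have "(\<Prod>i\<in>K. I i) \<noteq> 0" using K that by simp
      moreover have "(\<Prod>i\<in>K. I i) = \<infinity>" if i: "i \<in> K" "I i = \<infinity>" for i
      proof -
        have "(\<Prod>j\<in>K. I j) = I i * (\<Prod>j\<in>K - {i}. I j)"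
          using K i by (simp add: prod.remove)
        moreover have "(\<Prod>j\<in>K - {i}. I j) \<noteq> 0" using K \<open>\<And>i. i \<in> K \<Longrightarrow> I i \<noteq> 0\<close> by simp
        ultimately show ?thesis using i by (simp add: ennreal_top_mult)
      qed
      ultimately show ?thesis using that by (auto simp: ennreal_mult_eq_top_iff)
    qed
    moreover have "x < \<infinity> \<longleftrightarrow> x \<noteq> \<infinity>" "0 < x \<longleftrightarrow> x \<noteq> 0" for x :: ennreal
      by (auto simp: less_top zero_less_iff_neq_zero)
    ultimately show ?thesis using that by blast
  qed
  then show ?thesis
  proof cases
    case zero
    then have "h x = 0" if "x \<in> space M" for x using le[OF that] k by simp
    then have "(\<integral>\<^sup>+x. h x \<partial>M) = (\<integral>\<^sup>+x. 0 \<partial>M)" by (intro nn_integral_cong) auto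
    then show ?thesis using k by (simp add: zero_power)
  next
    case zero2
    then have "AE x in M. A i x = 0" unfolding I_def by (simp add: nn_integral_0_iff_AE)
    moreover have "h x = 0" if "x \<in> space M" "A i x = 0" for x
    proof -
      have "(\<Prod>i\<in>K. A i x) = 0" using K zero2(1) that by auto
      then have "h x ^ card K \<le> 0" using le[OF that(1)] by (simp only: mult_zero_right)
      then show ?thesis by simp
    qed
    ultimately have "AE x in M. h x = 0" by (auto elim: AE_mp)
    then have "(\<integral>\<^sup>+x. h x \<partial>M) = 0" by (simp add: nn_integral_0_iff_AE)
    then show ?thesis using k by (simp add: zero_power)
  next
    case inf
    then show ?thesis unfolding I_def by simp
  next
    case fin
    \<comment> \<open>\<open>R\<close> is the root of the asserted bound, so the goal becomes that
      the integral of \<open>h\<close> is at most \<open>R\<close>.\<close>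
    define R where "R = root (card K) (enn2real (c * (\<Prod>i\<in>K. I i)))"
    have cI: "c * (\<Prod>i\<in>K. I i) < \<infinity>"
    proof -
      have "(\<Prod>i\<in>K. I i) \<noteq> top"
        unfolding ennreal_prod_eq_top using fin(3) by (auto simp: less_top)
      then show ?thesis using fin(2) by (auto simp: ennreal_mult_less_top less_top)
    qed
    have R0: "R \<ge> 0" using k by (simp add: R_def)
    have Rk: "ennreal R ^ card K = c * (\<Prod>i\<in>K. I i)"
      using cI k by (simp add: ennreal_power R0 R_def less_top)
    have "h x \<le> ennreal R * (ennreal (1 / card K) * (\<Sum>i\<in>K. A i x / I i))" if x: "x \<in> space M" for x
    proof (rule ennreal_power_le_cancel[OF _ k])
      have "h x ^ card K \<le> c * (\<Prod>i\<in>K. A i x)" by (rule le[OF x])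
      also have "(\<Prod>i\<in>K. A i x) = (\<Prod>i\<in>K. I i * (A i x / I i))"
      proof (rule prod.cong[OF refl])
        fix i assume "i \<in> K"
        then have "A i x * I i / I i = A i x" using fin(3)[of i] by (intro mult_divide_eq_ennreal) auto
        then show "A i x = I i * (A i x / I i)" by (simp add: ennreal_times_divide mult.commute)
      qed
      also have "c * \<dots> = ennreal R ^ card K * (\<Prod>i\<in>K. A i x / I i)"
        by (simp add: Rk prod.distrib mult.assoc)
      also have "\<dots> \<le> ennreal R ^ card K * (ennreal (1 / card K) * (\<Sum>i\<in>K. A i x / I i)) ^ card K"
        by (intro mult_left_mono am_gm_power_ennreal K) auto
      finally show "h x ^ card K \<le> (ennreal R * (ennreal (1 / card K) * (\<Sum>i\<in>K. A i x / I i))) ^ card K"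
        by (simp add: power_mult_distrib)
    qed
    then have "(\<integral>\<^sup>+x. h x \<partial>M) \<le> (\<integral>\<^sup>+x. ennreal R * (ennreal (1 / card K) * (\<Sum>i\<in>K. A i x / I i)) \<partial>M)"
      by (intro nn_integral_mono) auto
    also have "\<dots> = ennreal R * (ennreal (1 / card K) * (\<Sum>i\<in>K. I i / I i))"
      by (simp add: nn_integral_cmult nn_integral_sum nn_integral_divide I_def)
    also have "(\<Sum>i\<in>K. I i / I i) = (\<Sum>i\<in>K. 1)"
      by (rule sum.cong) (use fin(3) in \<open>force intro!: ennreal_divide_self simp: less_top\<close>)+
    also have "ennreal (1 / card K) * (\<Sum>i\<in>K. 1) = 1"
      using k by (simp add: ennreal_of_nat_eq_real_of_nat flip: ennreal_mult)
    finally have "(\<integral>\<^sup>+x. h x \<partial>M) \<le> ennreal R" by simp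
    then have "(\<integral>\<^sup>+x. h x \<partial>M) ^ card K \<le> ennreal R ^ card K" by (rule power_mono) simp
    then show ?thesis by (simp add: Rk I_def)
  qed
qed

abbreviation lborelM :: "'i set \<Rightarrow> ('i \<Rightarrow> real) measure" where
  "lborelM J \<equiv> Pi\<^sub>M J (\<lambda>_. lborel)"

text \<open>Variables are integrated out one at a time. For \<open>i\<close> in \<open>J\<close> the
  function \<open>A i\<close> is constant in coordinate \<open>i\<close>, and the unit interval
  makes that coordinate contribute a factor 1. Indices outside \<open>J\<close> carry no
  independence condition; they keep the statement stable under induction, and for
  \<open>J = I\<close> their product is empty, which is the classical inequality.\<close>

lemma Loomis_Whitney_PiM:
  fixes A :: "'i \<Rightarrow> ('i \<Rightarrow> real) \<Rightarrow> ennreal"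
  assumes I: "finite I" "card I = Suc k" "k > 0" and J: "J \<subseteq> I"
    and "\<And>i. i \<in> I \<Longrightarrow> A i \<in> borel_measurable (lborelM J)"
    and "h \<in> borel_measurable (lborelM J)"
    and "\<And>i x t. i \<in> J \<Longrightarrow> A i (x(i := t)) = A i x"
    and "\<And>x. x \<in> space (lborelM J) \<Longrightarrow> h x ^ k \<le> (\<Prod>i\<in>I. A i x)"
  shows "(\<integral>\<^sup>+x. h x \<partial>lborelM J) ^ k
    \<le> (\<Prod>i\<in>J. \<integral>\<^sup>+x. A i x * indicator {0..1} (x i) \<partial>lborelM J)
      * (\<Prod>i\<in>I - J. \<integral>\<^sup>+x. A i x \<partial>lborelM J)"
proof -
  interpret product_sigma_finite "\<lambda>_::'i. lborel :: real measure" ..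
  have "finite J" using I J by (simp add: finite_subset)
  then show ?thesis using J assms(5-8)
  proof (induction J arbitrary: A h rule: finite_induct)
    case empty
    then show ?case by (simp add: nn_integral_empty space_PiM)
  next
    case (insert j J)
    note [measurable] = insert.prems(2,3)
    have fJ: "finite J" and jJ: "j \<notin> J" and jI: "j \<in> I" using insert by auto
    \<comment> \<open>Along coordinate \<open>j\<close> the function \<open>A j\<close> is constant;
      its value at 0 becomes the constant \<open>c\<close> of \<open>Hoelder_power\<close>. The
      other \<open>k\<close> functions are integrated over the slice, and \<open>k\<close> is
      exactly the exponent available.\<close>
    define A' where "A' i x = (if i = j then A j (x(j := 0)) else \<integral>\<^sup>+t. A i (x(j := t)) \<partial>lborel)" for i x
    have add[measurable]: "(\<lambda>x. (fst x)(j := snd x)) \<in> lborelM J \<Otimes>\<^sub>M lborel \<rightarrow>\<^sub>M lborelM (insert j J)"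
      using measurable_add_dim[of j J "\<lambda>_. lborel :: real measure"] by (simp add: split_beta')
    have add0[measurable]: "(\<lambda>x. x(j := t)) \<in> lborelM J \<rightarrow>\<^sub>M lborelM (insert j J)" for t
      by (rule measurable_fun_upd[where J=J]) auto
    have addt[measurable]: "(\<lambda>t. x(j := t)) \<in> lborel \<rightarrow>\<^sub>M lborelM (insert j J)"
      if "x \<in> space (lborelM J)" for x
      using measurable_Pair2[OF add that] by simp
    have A'm: "A' i \<in> borel_measurable (lborelM J)" if i: "i \<in> I" for i

    proof -
      have [measurable]: "A i \<in> borel_measurable (lborelM (insert j J))" using i insert.prems by auto
      have "(\<lambda>x. \<integral>\<^sup>+t. A i (x(j := t)) \<partial>lborel) \<in> borel_measurable (lborelM J)"
        by (rule lborel.borel_measurable_nn_integral) (use measurable_compose[OF add \<open>A i \<in> _\<close>] in \<open>simp add: split_beta'\<close>)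
      moreover have "(\<lambda>x. A j (x(j := 0))) \<in> borel_measurable (lborelM J)"
        by (rule measurable_compose[OF add0]) (use jI insert.prems in auto)
      ultimately show ?thesis by (cases "i = j") (simp_all add: A'_def[abs_def])
    qed
    have slice: "(\<integral>\<^sup>+x. f x \<partial>lborelM (insert j J))
      = (\<integral>\<^sup>+x. \<integral>\<^sup>+t. f (x(j := t)) \<partial>lborel \<partial>lborelM J)"
      if "f \<in> borel_measurable (lborelM (insert j J))" for f :: "('i \<Rightarrow> real) \<Rightarrow> ennreal"
      by (rule product_nn_integral_insert[OF fJ jJ that])
    have cI: "card (I - {j}) = k" using I jI by simp
    have Ij: "finite (I - {j})" "I - {j} \<noteq> {}" using cI I by (simp, metis card.empty less_irrefl)
    define h' where "h' x = (\<integral>\<^sup>+t. h (x(j := t)) \<partial>lborel)" for x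
    have h'm: "h' \<in> borel_measurable (lborelM J)"
      unfolding h'_def
      by (rule lborel.borel_measurable_nn_integral) (use measurable_compose[OF add insert.prems(3)] in \<open>simp add: split_beta'\<close>)
    have h'le: "h' x ^ k \<le> (\<Prod>i\<in>I. A' i x)" if x: "x \<in> space (lborelM J)" for x
    proof -
      have sp: "x(j := t) \<in> space (lborelM (insert j J))" for t
        using measurable_space[OF add0 x] by simp
      have "h' x ^ card (I - {j}) \<le> A j (x(j := 0)) * (\<Prod>i\<in>I - {j}. \<integral>\<^sup>+t. A i (x(j := t)) \<partial>lborel)"
        unfolding h'_def
      proof (rule Hoelder_power)
        fix t :: real
        have "h (x(j := t)) ^ k \<le> (\<Prod>i\<in>I. A i (x(j := t)))" by (rule insert.prems(5)[OF sp])
        also have "\<dots> = A j (x(j := t)) * (\<Prod>i\<in>I - {j}. A i (x(j := t)))"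
          using I jI by (simp add: prod.remove)
        also have "A j (x(j := t)) = A j (x(j := 0))"
          using insert.prems(4)[of j "x(j := 0)" t] by (simp only: fun_upd_upd insertI1 simp_thms)
        finally show "h (x(j := t)) ^ card (I - {j}) \<le> A j (x(j := 0)) * (\<Prod>i\<in>I - {j}. A i (x(j := t)))"
          unfolding cI .
      qed (use I Ij addt[OF x] in \<open>auto intro!: measurable_compose[OF addt[OF x]] insert.prems simp del: fun_upd_apply\<close>)
      also have "\<dots> = (\<Prod>i\<in>I. A' i x)"
        using I jI by (simp add: prod.remove[of I j] A'_def)
      finally show ?thesis by (simp add: cI)
    qed
    have IH: "(\<integral>\<^sup>+x. h' x \<partial>lborelM J) ^ k
      \<le> (\<Prod>i\<in>J. \<integral>\<^sup>+x. A' i x * indicator {0..1} (x i) \<partial>lborelM J)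
        * (\<Prod>i\<in>I - J. \<integral>\<^sup>+x. A' i x \<partial>lborelM J)"
    proof (rule insert.IH[OF _ A'm h'm _ h'le])
      show "J \<subseteq> I" using insert by simp
      fix i x t assume "i \<in> J"
      then have ij: "i \<noteq> j" and *: "\<And>x t. A i (x(i := t)) = A i x"
        using jJ by blast (rule insert.prems(4), use \<open>i \<in> J\<close> in blast)
      show "A' i (x(i := t)) = A' i x"
        unfolding A'_def fun_upd_twist[OF ij] * using ij by simp
    qed auto
    have im: "(\<lambda>x. A i x * indicator {0..1} (x i)) \<in> borel_measurable (lborelM (insert j J))"
      if "i \<in> insert j J" for i
    proof (rule borel_measurable_times_ennreal)
      show "A i \<in> borel_measurable (lborelM (insert j J))" using that insert.prems by auto
      show "(\<lambda>x. indicator {0..1} (x i)) \<in> borel_measurable (lborelM (insert j J))"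
        by (rule measurable_compose[OF measurable_component_singleton[OF that, of "\<lambda>_. lborel"]]) simp
    qed
    have 1: "(\<integral>\<^sup>+x. A' i x * indicator {0..1} (x i) \<partial>lborelM J)
        = (\<integral>\<^sup>+x. A i x * indicator {0..1} (x i) \<partial>lborelM (insert j J))" if i: "i \<in> J" for i
    proof -
      have ij: "i \<noteq> j" using i jJ by blast
      have Ai: "A i \<in> borel_measurable (lborelM (insert j J))"
        using i insert.prems(1) by (intro insert.prems(2)) blast
      have "(\<integral>\<^sup>+t. A i (x(j := t)) * indicator {0..1} ((x(j := t)) i) \<partial>lborel) = A' i x * indicator {0..1} (x i)"
        if x: "x \<in> space (lborelM J)" for x
        unfolding fun_upd_other[OF ij] A'_def
        by (subst nn_integral_multc[OF measurable_compose[OF addt[OF x] Ai]]) (simp add: ij)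
      note eq = this
      show ?thesis
        unfolding slice[OF im[OF insertI2[OF i]]] by (rule nn_integral_cong, rule sym, rule eq)
    qed
    have 2: "(\<integral>\<^sup>+x. A' j x \<partial>lborelM J)
        = (\<integral>\<^sup>+x. A j x * indicator {0..1} (x j) \<partial>lborelM (insert j J))"
    proof -
      have *: "A j (x(j := t)) = A j (x(j := 0))" for x t
        using insert.prems(4)[of j "x(j := 0)" t] by (simp only: fun_upd_upd insertI1 simp_thms)
      have "(\<integral>\<^sup>+t. A j (x(j := t)) * indicator {0..1} ((x(j := t)) j) \<partial>lborel) = A' j x" for x
      proof -
        have "(\<integral>\<^sup>+t. A j (x(j := t)) * indicator {0..1} ((x(j := t)) j) \<partial>lborel)
            = (\<integral>\<^sup>+t. A j (x(j := 0)) * indicator {0..1::real} t \<partial>lborel)"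
          unfolding fun_upd_same by (intro nn_integral_cong arg_cong2[where f="(*)"] *) simp
        then show ?thesis by (simp add: A'_def nn_integral_cmult)
      qed
      note eq = this
      show ?thesis
        unfolding slice[OF im[OF insertI1]] by (rule nn_integral_cong, rule sym, rule eq)
    qed
    have 3: "(\<integral>\<^sup>+x. A' i x \<partial>lborelM J)
        = (\<integral>\<^sup>+x. A i x \<partial>lborelM (insert j J))" if i: "i \<in> I - insert j J" for i
    proof -
      have "A i \<in> borel_measurable (lborelM (insert j J))" and "i \<noteq> j"
        using i insert.prems(2) by blast+
      then show ?thesis by (simp add: slice A'_def[abs_def])
    qed
    \<comment> \<open>Index \<open>j\<close> moves from the second product to the first: by fact
      \<open>2\<close> its factor in the induction hypothesis already equals the one with the unit
      interval.\<close>
    have IJ: "I - J = insert j (I - insert j J)" using jJ jI by auto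
    have "(\<Prod>i\<in>I - J. \<integral>\<^sup>+x. A' i x \<partial>lborelM J)
      = (\<integral>\<^sup>+x. A j x * indicator {0..1} (x j) \<partial>lborelM (insert j J))
       * (\<Prod>i\<in>I - insert j J. \<integral>\<^sup>+x. A i x \<partial>lborelM (insert j J))"
    proof -
      have eq: "(\<Prod>i\<in>I - insert j J. \<integral>\<^sup>+x. A' i x \<partial>lborelM J)
          = (\<Prod>i\<in>I - insert j J. \<integral>\<^sup>+x. A i x \<partial>lborelM (insert j J))"
        by (intro prod.cong refl 3)
      have nin: "finite (I - insert j J)" "j \<notin> I - insert j J" using I by auto
      show ?thesis unfolding IJ prod.insert[OF nin] 2 eq ..
    qed
    moreover have "(\<integral>\<^sup>+x. h x \<partial>lborelM (insert j J)) = (\<integral>\<^sup>+x. h' x \<partial>lborelM J)"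
      unfolding h'_def by (rule slice[OF insert.prems(3)])
    moreover have "(\<Prod>i\<in>J. \<integral>\<^sup>+x. A' i x * indicator {0..1} (x i) \<partial>lborelM J)
      = (\<Prod>i\<in>J. \<integral>\<^sup>+x. A i x * indicator {0..1} (x i) \<partial>lborelM (insert j J))"
      by (intro prod.cong refl 1)
    ultimately show ?case using IH unfolding prod.insert[OF fJ jJ] by (simp only: mult_ac)
  qed
qed

text \<open>The slab of unit thickness turns the integral of a function invariant in direction
  \<open>i\<close> into an integral over the projection along \<open>i\<close>. Coordinates reduce
  the claim to the product measure.\<close>

lemma Loomis_Whitney:
  fixes f :: "'a::euclidean_space \<Rightarrow> 'a \<Rightarrow> ennreal" and h :: "'a \<Rightarrow> ennreal"
  assumes dim: "DIM('a) = Suc k" "k > 0"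
    and f: "\<And>i. i \<in> Basis \<Longrightarrow> f i \<in> borel_measurable borel"
    and h: "h \<in> borel_measurable borel"
    and indep: "\<And>i x t. i \<in> Basis \<Longrightarrow> f i (x + t *\<^sub>R i) = f i x"
    and le: "\<And>x. h x ^ k \<le> (\<Prod>i\<in>Basis. f i x)"
  shows "(\<integral>\<^sup>+x. h x \<partial>lborel) ^ k \<le> (\<Prod>i\<in>Basis. \<integral>\<^sup>+x. f i x * indicator {0..1} (x \<bullet> i) \<partial>lborel)"
proof -
  let ?\<Phi> = "\<lambda>\<xi>. \<Sum>b\<in>Basis. \<xi> b *\<^sub>R b :: 'a"
  let ?M = "\<Pi>\<^sub>M b\<in>(Basis::'a set). (lborel :: real measure)"
  have meas: "?\<Phi> \<in> ?M \<rightarrow>\<^sub>M borel"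
    by (intro borel_measurable_sum borel_measurable_scaleR borel_measurable_const)
      (auto intro: measurable_component_singleton[of _ _ "\<lambda>_. lborel :: real measure", simplified])
  have int: "(\<integral>\<^sup>+x. F x \<partial>lborel) = (\<integral>\<^sup>+\<xi>. F (?\<Phi> \<xi>) \<partial>?M)"
    if "F \<in> borel_measurable borel" for F :: "'a \<Rightarrow> ennreal"
    by (subst lborel_eq) (use that meas in \<open>simp add: nn_integral_distr\<close>)
  have upd: "f i (?\<Phi> (\<xi>(i := t))) = f i (?\<Phi> \<xi>)" if i: "i \<in> Basis" for i \<xi> t
  proof -
    have "?\<Phi> (\<xi>(i := t)) = ?\<Phi> \<xi> + (t - \<xi> i) *\<^sub>R i"
      using i by (simp add: sum.remove[of Basis i] algebra_simps)
    then show ?thesis by (simp only: indep[OF i])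
  qed
  have "(\<integral>\<^sup>+\<xi>. h (?\<Phi> \<xi>) \<partial>?M) ^ k
    \<le> (\<Prod>i\<in>Basis. \<integral>\<^sup>+\<xi>. f i (?\<Phi> \<xi>) * indicator {0..1} (\<xi> i) \<partial>?M)
      * (\<Prod>i\<in>Basis - Basis. \<integral>\<^sup>+\<xi>. f i (?\<Phi> \<xi>) \<partial>?M)"
    by (rule Loomis_Whitney_PiM[where A="\<lambda>i \<xi>. f i (?\<Phi> \<xi>)"])
      (use dim upd le f h meas in \<open>auto intro: measurable_compose simp del: fun_upd_apply\<close>)
  moreover have "(\<integral>\<^sup>+\<xi>. f i (?\<Phi> \<xi>) * indicator {0..1} (\<xi> i) \<partial>?M)
      = (\<integral>\<^sup>+x. f i x * indicator {0..1} (x \<bullet> i) \<partial>lborel)" if i: "i \<in> Basis" for i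
  proof (subst int)
    note [measurable] = f[OF i]
    show "(\<lambda>x. f i x * indicator {0..1} (x \<bullet> i)) \<in> borel_measurable borel" by measurable
  qed (use i in \<open>simp add: inner_sum_left inner_Basis if_distrib sum.delta cong: if_cong\<close>)
  ultimately show ?thesis by (simp add: int[OF h])
qed

section \<open>Slicing of Lebesgue measure along a line\<close>

text \<open>Weil's argument: for translation invariant measures \<open>\<nu>\<close>, \<open>\<lambda>\<close> the double integral of
  \<open>f x * h (x + y)\<close> can be evaluated in two ways.\<close>
lemma translation_invariant_integral:
  fixes \<nu> :: "'a::euclidean_space measure"
  assumes "sigma_finite_measure \<nu>" and [measurable_cong]: "sets \<nu> = sets borel"
    and inv: "\<And>f a. f \<in> borel_measurable borel \<Longrightarrow> (\<integral>\<^sup>+x. f (x + a) \<partial>\<nu>) = (\<integral>\<^sup>+x. f x \<partial>\<nu>)"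
    and [measurable]: "f \<in> borel_measurable borel" "h \<in> borel_measurable borel"
  shows "(\<integral>\<^sup>+x. f x \<partial>\<nu>) * (\<integral>\<^sup>+x. h x \<partial>lborel) = (\<integral>\<^sup>+x. h x \<partial>\<nu>) * (\<integral>\<^sup>+x. f (- x) \<partial>lborel)"
proof -
  interpret sigma_finite_measure \<nu> by fact
  interpret pair_sigma_finite \<nu> "lborel :: 'a measure" ..
  have lb: "(\<integral>\<^sup>+x. k (x + a) \<partial>lborel) = (\<integral>\<^sup>+x. k x \<partial>lborel)" if [measurable]: "k \<in> borel_measurable borel"
    for k :: "'a \<Rightarrow> ennreal" and a
    by (subst (2) lborel_distr_plus[of a, symmetric]) (simp add: nn_integral_distr add.commute)
  have "(\<integral>\<^sup>+x. f x \<partial>\<nu>) * (\<integral>\<^sup>+x. h x \<partial>lborel) = (\<integral>\<^sup>+x. \<integral>\<^sup>+y. f x * h (y + x) \<partial>lborel \<partial>\<nu>)"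
    by (simp add: nn_integral_cmult nn_integral_multc lb)
  also have "\<dots> = (\<integral>\<^sup>+y. \<integral>\<^sup>+x. f x * h (y + x) \<partial>\<nu> \<partial>lborel)"
    by (rule Fubini'[symmetric]) measurable
  also have "\<dots> = (\<integral>\<^sup>+y. \<integral>\<^sup>+x. f (x - y) * h x \<partial>\<nu> \<partial>lborel)"
  proof (rule nn_integral_cong)
    fix y
    show "(\<integral>\<^sup>+x. f x * h (y + x) \<partial>\<nu>) = (\<integral>\<^sup>+x. f (x - y) * h x \<partial>\<nu>)"
      using inv[of "\<lambda>x. f (x - y) * h x" y] by (simp add: add.commute)
  qed
  also have "\<dots> = (\<integral>\<^sup>+x. \<integral>\<^sup>+y. f (x - y) * h x \<partial>lborel \<partial>\<nu>)"
    by (rule Fubini') measurable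
  also have "\<dots> = (\<integral>\<^sup>+x. h x * (\<integral>\<^sup>+y. f (- y) \<partial>lborel) \<partial>\<nu>)"
  proof (rule nn_integral_cong)
    fix x
    have "(\<integral>\<^sup>+y. f (x - y) * h x \<partial>lborel) = (\<integral>\<^sup>+y. f (x - y) \<partial>lborel) * h x"
      by (rule nn_integral_multc) measurable
    also have "(\<integral>\<^sup>+y. f (x - y) \<partial>lborel) = (\<integral>\<^sup>+y. f (- y) \<partial>lborel)"
      using lb[of "\<lambda>y. f (x - y)" x] by simp
    finally show "(\<integral>\<^sup>+y. f (x - y) * h x \<partial>lborel) = h x * (\<integral>\<^sup>+y. f (- y) \<partial>lborel)"
      by (simp add: mult.commute)
  qed
  also have "\<dots> = (\<integral>\<^sup>+x. h x \<partial>\<nu>) * (\<integral>\<^sup>+x. f (- x) \<partial>lborel)"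
    by (rule nn_integral_multc) measurable
  finally show ?thesis .
qed

lemma emeasure_lborel_open_pos:
  fixes S :: "'a::euclidean_space set"
  assumes "open S" "S \<noteq> {}"
  shows "emeasure lborel S > 0"
proof (rule ccontr)
  assume "\<not> emeasure lborel S > 0"
  then have "S \<in> null_sets lborel" using assms by (intro null_setsI) auto
  then have "negligible S" by (simp add: negligible_iff_null_sets null_sets_completionI)
  then show False using open_not_negligible assms by blast
qed

text \<open>The image of Lebesgue measure under \<open>(y, t) -> A y + b + t e\<close> is
  translation invariant and finite on balls, hence proportional to Lebesgue measure by
  \<open>translation_invariant_integral\<close>. The constant is a Jacobian determinant that never
  has to be computed.\<close>

lemma affine_slicing_integral:
  fixes A :: "'b::euclidean_space \<Rightarrow> 'a::euclidean_space"
  assumes dim: "DIM('b) + 1 = DIM('a)" and A: "linear A" "inj A" and e: "e \<notin> range A"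
  obtains c where "0 < c" "\<And>h. h \<in> borel_measurable borel \<Longrightarrow>
    (\<integral>\<^sup>+x. h x \<partial>lborel) = ennreal c * (\<integral>\<^sup>+y. \<integral>\<^sup>+t. h (A y + b + t *\<^sub>R e) \<partial>lborel \<partial>lborel)"
proof -
  define L where "L p = A (fst p) + snd p *\<^sub>R e" for p :: "'b \<times> real"
  define \<Phi> where "\<Phi> p = L p + b" for p
  have linL: "linear L"
    unfolding L_def using A(1) by (intro linear_compose_add linear_compose[unfolded o_def, of fst A])
      (auto simp: linear_fst intro!: linearI simp: scaleR_add_left)
  have injL: "inj L"
  proof (subst linear_injective_0[OF linL], safe)
    fix y t assume "L (y, t) = 0"
    then have *: "A y + t *\<^sub>R e = 0" by (simp add: L_def)
    have "t = 0"
    proof (rule ccontr)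
      assume "t \<noteq> 0"
      have "A ((- 1 / t) *\<^sub>R y) = (- 1 / t) *\<^sub>R A y" by (rule linear_scale[OF A(1)])
      also have "A y = - (t *\<^sub>R e)" using * by (simp add: eq_neg_iff_add_eq_0)
      finally have "A ((- 1 / t) *\<^sub>R y) = e" using \<open>t \<noteq> 0\<close> by simp
      then show False using e by (metis rangeI)
    qed
    moreover have "y = 0" using * \<open>t = 0\<close> A linear_injective_0 by auto
    ultimately show "(y, t) = 0" by (simp add: zero_prod_def)
  qed
  have surjL: "surj L"
  proof -
    have "dim (range L) = DIM('a)"
      using dim dim_image_eq[OF linL, of UNIV] injL by (simp add: inj_on_subset)
    then show ?thesis
      using linL by (metis dim_eq_full linear_subspace_image span_eq_iff subspace_UNIV)
  qed
  have cont: "continuous_on UNIV \<Phi>" unfolding \<Phi>_def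
    by (intro continuous_intros linear_continuous_on linear_conv_bounded_linear[THEN iffD1] linL)
  then have [measurable]: "\<Phi> \<in> borel_measurable borel" by (rule borel_measurable_continuous_onI)
  obtain G where linG: "linear G" and GL: "\<And>p. G (L p) = p" and LG: "\<And>x. L (G x) = x"
  proof -
    obtain G where "linear G" "G \<circ> L = id" using linear_injective_left_inverse[OF linL injL] by blast
    moreover have "L (G x) = x" for x
    proof -
      obtain p where "x = L p" using surjL by blast
      then show ?thesis using \<open>G \<circ> L = id\<close> by (metis comp_apply id_apply)
    qed
    ultimately show ?thesis using that by (metis comp_apply id_apply)
  qed
  define \<nu> where "\<nu> = distr (lborel :: ('b \<times> real) measure) borel \<Phi>"
  have sets\<nu>: "sets \<nu> = sets borel" by (simp add: \<nu>_def)
  have int\<nu>: "(\<integral>\<^sup>+x. h x \<partial>\<nu>) = (\<integral>\<^sup>+p. h (\<Phi> p) \<partial>lborel)" if "h \<in> borel_measurable borel" for h :: "'a \<Rightarrow> ennreal"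
    using that by (simp add: \<nu>_def nn_integral_distr)
  have bdd: "bounded (\<Phi> -` ball 0 r)" for r
  proof -
    have "\<Phi> -` ball 0 r \<subseteq> (\<lambda>x. G (x - b)) ` ball 0 r"
      by (auto simp: \<Phi>_def GL intro!: image_eqI[where x="\<Phi> _"])
    moreover have "bounded ((\<lambda>x. G (x - b)) ` ball 0 r)"
    proof -
      have "bounded ((\<lambda>x. x - b) ` ball 0 r)"
        using bounded_translation[of "ball 0 r" "-b"] by simp
      then have "bounded (G ` (\<lambda>x. x - b) ` ball 0 r)"
        using bounded_linear_image linG linear_conv_bounded_linear by blast
      then show ?thesis by (simp add: image_image)
    qed
    ultimately show ?thesis by (rule bounded_subset[rotated])
  qed
  have fin: "emeasure \<nu> (ball 0 r) < \<infinity>" for r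
  proof -
    have "emeasure \<nu> (ball 0 r) = emeasure lborel (\<Phi> -` ball 0 r)"
      unfolding \<nu>_def by (subst emeasure_distr) auto
    then show ?thesis using emeasure_bounded_finite[OF bdd] by simp
  qed
  have sf: "sigma_finite_measure \<nu>"
  proof (rule sigma_finite_measure.intro, intro exI[of _ "range (\<lambda>n::nat. ball 0 (real n))"] conjI ballI)
    have "\<exists>n. x \<in> ball 0 (real n)" for x :: 'a using reals_Archimedean2[of "norm x"] by auto
    then show "\<Union> (range (\<lambda>n. ball 0 (real n))) = space \<nu>" by (auto simp: \<nu>_def)
  qed (use fin in \<open>auto simp: sets\<nu> less_top\<close>)
  have inv: "(\<integral>\<^sup>+x. f (x + a) \<partial>\<nu>) = (\<integral>\<^sup>+x. f x \<partial>\<nu>)" if [measurable]: "f \<in> borel_measurable borel"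
    for f :: "'a \<Rightarrow> ennreal" and a
  proof -
    have "(\<integral>\<^sup>+p. f (\<Phi> p + a) \<partial>lborel) = (\<integral>\<^sup>+p. f (\<Phi> (G a + p)) \<partial>lborel)"
      by (simp add: \<Phi>_def linear_add[OF linL] LG add_ac)
    also have "\<dots> = (\<integral>\<^sup>+p. f (\<Phi> p) \<partial>lborel)"
      by (subst (2) lborel_distr_plus[of "G a", symmetric]) (simp add: nn_integral_distr)
    finally show ?thesis by (simp add: int\<nu>)
  qed
  \<comment> \<open>The unit ball calibrates the constant: both measures give it positive finite
    mass, and by symmetry the reflection in Weil's identity disappears.\<close>
  define f where "f = (indicator (ball 0 1) :: 'a \<Rightarrow> ennreal)"
  have [measurable]: "f \<in> borel_measurable borel" unfolding f_def by (intro borel_measurable_indicator) auto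
  have f\<nu>: "(\<integral>\<^sup>+x. f x \<partial>\<nu>) = emeasure \<nu> (ball 0 1)" by (simp add: f_def sets\<nu>)
  have "emeasure \<nu> (ball 0 1) \<noteq> 0"
  proof -
    have "open (\<Phi> -` ball 0 1)" using cont open_vimage by blast
    moreover have "\<Phi> (G (- b)) = 0" by (simp add: \<Phi>_def LG)
    then have "\<Phi> -` ball 0 1 \<noteq> {}" by (metis centre_in_ball empty_iff vimageI zero_less_one)
    ultimately have "emeasure lborel (\<Phi> -` ball 0 1) \<noteq> 0"
      using emeasure_lborel_open_pos by fastforce
    then show ?thesis unfolding \<nu>_def by (subst emeasure_distr) auto
  qed
  then obtain p where p: "p > 0" "emeasure \<nu> (ball 0 1) = ennreal p"
    using fin[of 1] by (cases "emeasure \<nu> (ball 0 1)") (auto simp: less_le)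
  have "(\<lambda>x::'a. f (- x)) = f" by (auto simp: f_def indicator_def)
  then have fm: "(\<integral>\<^sup>+x. f (- x) \<partial>lborel) = emeasure lborel (ball (0::'a) 1)" by (simp add: f_def)
  obtain q where q: "q > 0" "emeasure lborel (ball (0::'a) 1) = ennreal q"
    using emeasure_lborel_ball_finite[of "0::'a" 1] emeasure_lborel_open_pos[of "ball (0::'a) 1"]
    by (cases "emeasure lborel (ball (0::'a) 1)") (auto simp: less_le)
  show ?thesis
  proof
    show "0 < q / p" using p q by simp
    fix h :: "'a \<Rightarrow> ennreal" assume [measurable]: "h \<in> borel_measurable borel"
    have "ennreal p * (\<integral>\<^sup>+x. h x \<partial>lborel) = (\<integral>\<^sup>+x. h x \<partial>\<nu>) * ennreal q"
      using translation_invariant_integral[OF sf sets\<nu> inv, of f h] by (simp add: f\<nu> p q fm)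
    then have "ennreal (1 / p) * (ennreal p * (\<integral>\<^sup>+x. h x \<partial>lborel)) = ennreal (1 / p) * (ennreal q * (\<integral>\<^sup>+x. h x \<partial>\<nu>))"
      by (simp add: mult.commute)
    then have "(\<integral>\<^sup>+x. h x \<partial>lborel) = ennreal (q / p) * (\<integral>\<^sup>+x. h x \<partial>\<nu>)"
      using p q by (simp add: mult.assoc[symmetric] ennreal_mult[symmetric])
    also have "(\<integral>\<^sup>+x. h x \<partial>\<nu>) = (\<integral>\<^sup>+p. h (\<Phi> p) \<partial>(lborel \<Otimes>\<^sub>M lborel))"
      by (simp add: int\<nu> lborel_prod)
    also have "\<dots> = (\<integral>\<^sup>+y. \<integral>\<^sup>+t. h (\<Phi> (y, t)) \<partial>lborel \<partial>lborel)"
      by (subst lborel.nn_integral_fst[symmetric]) (auto simp: lborel_prod)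
    finally show "(\<integral>\<^sup>+x. h x \<partial>lborel) = ennreal (q / p) * (\<integral>\<^sup>+y. \<integral>\<^sup>+t. h (A y + b + t *\<^sub>R e) \<partial>lborel \<partial>lborel)"
      by (simp add: \<Phi>_def L_def add_ac)
  qed
qed

section \<open>Bounding a convex function by its boundary values\<close>

text \<open>With nonempty interior the affine hull is the whole space, and in a minimal family of
  half spaces every bounding hyperplane cuts out a facet. Facets thereby become equations that can
  be tested along rays.\<close>

lemma polyhedron_facet_halfspaces:
  fixes P :: "'a::euclidean_space set"
  assumes "polyhedron P" "interior P \<noteq> {}"
  obtains H :: "'a set set" and a b where "finite H" "P = {x. \<forall>h\<in>H. a h \<bullet> x \<le> b h}"
    "\<And>h. h \<in> H \<Longrightarrow> (P \<inter> {x. a h \<bullet> x = b h}) facet_of P"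
proof -
  have aff: "affine hull P = UNIV"
    using assms(2) affine_hull_nonempty_interior by blast
  obtain H where H: "finite H" "P = affine hull P \<inter> \<Inter>H"
    "\<forall>h\<in>H. \<exists>a b. a \<noteq> 0 \<and> h = {x. a \<bullet> x \<le> b}"
    "\<forall>F'. F' \<subset> H \<longrightarrow> P \<subset> affine hull P \<inter> \<Inter>F'"
    using assms(1)[unfolded polyhedron_Int_affine_minimal] by (elim exE conjE) (rule that)
  have "\<forall>h. \<exists>a b. h \<in> H \<longrightarrow> a \<noteq> 0 \<and> h = {x. a \<bullet> x \<le> b}" using H(3) by blast
  then obtain a b where ab: "\<And>h. h \<in> H \<Longrightarrow> a h \<noteq> 0 \<and> h = {x. a h \<bullet> x \<le> b h}"
    unfolding choice_iff by blast
  show ?thesis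
  proof
    show "P = {x. \<forall>h\<in>H. a h \<bullet> x \<le> b h}"
      using H(2) ab unfolding aff by blast
    fix h assume "h \<in> H"
    then show "(P \<inter> {x. a h \<bullet> x = b h}) facet_of P"
      using facet_of_polyhedron_explicit[OF H(1,2) ab, of "P \<inter> {x. a h \<bullet> x = b h}"] H(4)[rule_format] by auto
  qed fact
qed

text \<open>The exit time is the least \<open>\<tau> h\<close> among the constraints increasing
  along \<open>e\<close>. Boundedness guarantees that there is such a constraint, and the minimizing
  one is active at the exit point.\<close>

lemma ray_exits_polytope:
  fixes P :: "'a::euclidean_space set"
  assumes H: "finite H" "P = {x. \<forall>h\<in>H. a h \<bullet> x \<le> b h}" and "bounded P" "x \<in> P" "e \<noteq> 0"
  obtains t h where "t \<ge> 0" "h \<in> H" "x + t *\<^sub>R e \<in> P" "a h \<bullet> e > 0" "a h \<bullet> (x + t *\<^sub>R e) = b h"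
proof -
  define H' where "H' = {h \<in> H. a h \<bullet> e > 0}"
  define \<tau> where "\<tau> h = (b h - a h \<bullet> x) / (a h \<bullet> e)" for h
  have x: "a h \<bullet> x \<le> b h" if "h \<in> H" for h using assms that by auto
  have "H' \<noteq> {}"
  proof
    assume "H' = {}"
    then have le: "a h \<bullet> e \<le> 0" if "h \<in> H" for h using that \<open>H' = {}\<close> by (auto simp: H'_def not_less)
    have "x + t *\<^sub>R e \<in> P" if "t \<ge> 0" for t
    proof -
      have "a h \<bullet> x + t * (a h \<bullet> e) \<le> b h" if "h \<in> H" for h
        using mult_nonneg_nonpos[OF \<open>t \<ge> 0\<close> le[OF that]] x[OF that] by linarith
      then show ?thesis by (simp add: H(2) inner_add_right)
    qed
    moreover obtain B where B: "\<And>y. y \<in> P \<Longrightarrow> norm y \<le> B" using \<open>bounded P\<close> bounded_iff by blast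
    moreover have "B \<ge> 0" using B[OF \<open>x \<in> P\<close>] norm_ge_zero[of x] by linarith
    \<comment> \<open>A displacement of length \<open>norm x + B + 1\<close> starting at
      \<open>x\<close> must leave the ball of radius \<open>B\<close>.\<close>
    ultimately have "norm (x + ((norm x + B + 1) / norm e) *\<^sub>R e) \<le> B" by simp
    moreover have "norm (((norm x + B + 1) / norm e) *\<^sub>R e) = norm x + B + 1"
      using \<open>e \<noteq> 0\<close> \<open>B \<ge> 0\<close> by simp
    ultimately show False
      using norm_triangle_ineq4[of "x + ((norm x + B + 1) / norm e) *\<^sub>R e" x] by simp
  qed
  have fin: "finite H'" using H by (simp add: H'_def)
  obtain h where h: "h \<in> H'" "\<tau> h = Min (\<tau> ` H')"
  proof -
    have "Min (\<tau> ` H') \<in> \<tau> ` H'" using fin \<open>H' \<noteq> {}\<close> by (intro Min_in) auto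
    then show ?thesis using that by fastforce
  qed
  have h': "h \<in> H" "a h \<bullet> e > 0" using h by (auto simp: H'_def)
  show ?thesis
  proof
    show t0: "\<tau> h \<ge> 0" using x[OF h'(1)] h' by (simp add: \<tau>_def)
    show "x + \<tau> h *\<^sub>R e \<in> P"
      unfolding H(2)
    proof safe
      fix k assume k: "k \<in> H"
      show "a k \<bullet> (x + \<tau> h *\<^sub>R e) \<le> b k"
      proof (cases "a k \<bullet> e > 0")
        case True
        then have "\<tau> h \<le> \<tau> k" using h(2) fin k by (auto simp: H'_def intro!: Min_le)
        then have "\<tau> h * (a k \<bullet> e) \<le> b k - a k \<bullet> x"
          using True by (simp add: \<tau>_def[of k] le_divide_eq)
        then show ?thesis by (simp add: inner_add_right)
      next
        case False
        then have "\<tau> h * (a k \<bullet> e) \<le> 0" using t0 by (simp add: mult_nonneg_nonpos)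
        then show ?thesis using x[OF k] by (simp add: inner_add_right)
      qed
    qed
    show "a h \<bullet> (x + \<tau> h *\<^sub>R e) = b h" using h' by (simp add: inner_add_right \<tau>_def)
  qed (use h' in auto)
qed

text \<open>The argument of \<open>v\<close> is the projection of \<open>x\<close> along
  \<open>e\<close> onto the hyperplane. Each line parallel to \<open>e\<close> meets the hyperplane
  once and the slab in unit length, so the inner integral of the slicing formula is just
  \<open>v (G y)\<close>.\<close>

lemma facet_projection_integral:
  fixes G :: "'b::euclidean_space \<Rightarrow> 'a::euclidean_space"
  assumes dim: "DIM('b) + 1 = DIM('a)" and A: "linear A" "inj A" and G: "G = (\<lambda>y. A y + p)"
    and hyp: "\<And>y. a \<bullet> G y = b" and e: "e \<in> Basis" "a \<bullet> e \<noteq> 0"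
  obtains c where "\<And>v. v \<in> borel_measurable borel \<Longrightarrow>
    (\<integral>\<^sup>+x. v (x - ((a \<bullet> x - b) / (a \<bullet> e)) *\<^sub>R e) * indicator {0..1} (x \<bullet> e) \<partial>lborel)
      = ennreal c * (\<integral>\<^sup>+y. v (G y) \<partial>lborel)"
proof -
  have "e \<notin> range A"
  proof
    assume "e \<in> range A"
    then obtain y where y: "e = A y" by blast
    have "a \<bullet> A y = a \<bullet> G y - a \<bullet> G 0" using A(1) by (simp add: G inner_add_right linear_0)
    then show False using e y by (simp add: hyp)
  qed
  then obtain c where c: "\<And>h. h \<in> borel_measurable borel \<Longrightarrow>
    (\<integral>\<^sup>+x. h x \<partial>lborel) = ennreal c * (\<integral>\<^sup>+y. \<integral>\<^sup>+t. h (A y + p + t *\<^sub>R e) \<partial>lborel \<partial>lborel)"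
    using affine_slicing_integral[OF dim A, of e p] by blast
  have ee: "e \<bullet> e = 1" using e by simp
  show ?thesis
  proof
    fix v :: "'a \<Rightarrow> ennreal" assume [measurable]: "v \<in> borel_measurable borel"
    let ?h = "\<lambda>x. v (x - ((a \<bullet> x - b) / (a \<bullet> e)) *\<^sub>R e) * indicator {0..1} (x \<bullet> e)"
    have "(\<integral>\<^sup>+t. ?h (A y + p + t *\<^sub>R e) \<partial>lborel) = v (G y)" for y
    proof -
      have 1: "?h (A y + p + t *\<^sub>R e) = v (G y) * indicator {- (G y \<bullet> e)..1 - G y \<bullet> e} t" for t
      proof -
        have "a \<bullet> (A y + p + t *\<^sub>R e) - b = t * (a \<bullet> e)"
          using hyp[of y] by (simp add: G inner_add_right)
        moreover have "(A y + p + t *\<^sub>R e) \<bullet> e = G y \<bullet> e + t" by (simp add: G inner_add_left ee)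
        ultimately show ?thesis using e by (simp add: G indicator_def) linarith
      qed
      show ?thesis unfolding 1 by (subst nn_integral_cmult_indicator) auto
    qed
    then show "(\<integral>\<^sup>+x. ?h x \<partial>lborel) = ennreal c * (\<integral>\<^sup>+y. v (G y) \<partial>lborel)"
      by (subst c) simp_all
  qed
qed

section \<open>From boundary values to integrability with exponent n/(n-1)\<close>

lemma epow_measurable [measurable]: "(\<lambda>x. epow x p) \<in> borel_measurable borel"
  unfolding epow_def by measurable

text \<open>For \<open>n = k + 1\<close> the exponent is n/(n-1). Its k-th power is an honest
  integer power, the form in which \<open>Loomis_Whitney\<close> can be applied.\<close>

lemma epow_power:
  assumes "k > 0"
  shows "epow x (real (Suc k) / k) ^ k = x ^ Suc k"
proof (cases x)
  case (real r)
  show ?thesis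
  proof (cases "r = 0")
    case False
    then have "(r powr (real (Suc k) / real k)) ^ k = r powr (real (Suc k))"
      using real assms by (simp add: powr_power)
    also have "\<dots> = r ^ Suc k" using False real by (subst powr_realpow) auto
    finally show ?thesis using real by (simp add: epow_def ennreal_power del: power_Suc)
  qed (use real assms in \<open>simp add: epow_def\<close>)
qed (use assms in \<open>simp add: epow_def\<close>)

definition convex_ennreal_on :: "'a::real_vector set \<Rightarrow> ('a \<Rightarrow> ennreal) \<Rightarrow> bool" where
  "convex_ennreal_on P u \<longleftrightarrow> (\<forall>x\<in>P. \<forall>y\<in>P. \<forall>t. 0 < t \<and> t < 1 \<longrightarrow>
     u ((1 - t) *\<^sub>R x + t *\<^sub>R y) \<le> ennreal (1 - t) * u x + ennreal t * u y)"

lemma convex_ennreal_on_le: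
  assumes "convex_ennreal_on P u" "x - s *\<^sub>R e \<in> P" "x + t *\<^sub>R e \<in> P" "s \<ge> 0" "t \<ge> 0"
    "u (x - s *\<^sub>R e) \<le> K" "u (x + t *\<^sub>R e) \<le> K"
  shows "u x \<le> K"
proof (cases "s = 0 \<or> t = 0")
  case False
  define \<tau> where "\<tau> = s / (s + t)"
  have \<tau>: "0 < \<tau>" "\<tau> < 1" "1 - \<tau> = t / (s + t)" using False assms by (auto simp: \<tau>_def field_simps)
  have "(1 - \<tau>) *\<^sub>R (x - s *\<^sub>R e) + \<tau> *\<^sub>R (x + t *\<^sub>R e) = x + (\<tau> * t - (1 - \<tau>) * s) *\<^sub>R e"
    by (simp add: algebra_simps)
  also have "\<tau> * t - (1 - \<tau>) * s = 0" unfolding \<tau>(3) by (simp add: \<tau>_def)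
  finally have "u x \<le> ennreal (1 - \<tau>) * u (x - s *\<^sub>R e) + ennreal \<tau> * u (x + t *\<^sub>R e)"
    using assms(1)[unfolded convex_ennreal_on_def, rule_format, OF assms(2,3), of \<tau>] \<tau>(1,2) by simp
  also have "\<dots> \<le> ennreal (1 - \<tau>) * K + ennreal \<tau> * K"
    by (intro add_mono mult_left_mono assms) auto
  also have "\<dots> = K" using \<tau>(1,2) by (simp flip: distrib_right ennreal_plus)
  finally show ?thesis .
qed (use assms in auto)

text \<open>The line through \<open>x\<close> parallel to an axis \<open>e\<close> leaves
  \<open>P\<close> at two facet points, and convexity bounds \<open>u x\<close> by the values there,
  hence by the sum \<open>f e x\<close> of \<open>u\<close> over the projections of \<open>x\<close>
  onto facets. This sum is invariant along \<open>e\<close>. Multiplying over all axes bounds the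
  n-th power of \<open>u\<close> by the product of the \<open>f e\<close>, and Loomis-Whitney
  reduces the claim to integrals of \<open>f e\<close>, which are boundary integrals.\<close>

lemma boundary_integral_bound:
  fixes P :: "'a::euclidean_space set" and g :: "'a set \<Rightarrow> 'b::euclidean_space \<Rightarrow> 'a"
  assumes sys: "is_system P cmu csig g" and k: "DIM('a) = Suc k" "k > 0"
  obtains C where "C \<ge> 0" "\<And>u. convex_ennreal_on P u \<Longrightarrow> (\<lambda>x. u x * indicator P x) \<in> borel_measurable borel \<Longrightarrow>
    (\<integral>\<^sup>+x\<in>P. epow (u x) (real (Suc k) / k) \<partial>lborel) ^ k
      \<le> ennreal C * sigma_int P csig g u ^ Suc k"
proof -
  have P: "compact P" "interior P \<noteq> {}" "polyhedron P" and dim: "DIM('b) + 1 = DIM('a)"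
    and cs: "\<And>F. F facet_of P \<Longrightarrow> csig F > 0" and fp: "facet_params P g"
    using sys by (auto simp: is_system_def simple_polytope_def)
  obtain H :: "'a set set" and a b where H: "finite H" "P = {x. \<forall>h\<in>H. a h \<bullet> x \<le> b h}"
    and fac: "\<And>h. h \<in> H \<Longrightarrow> (P \<inter> {x. a h \<bullet> x = b h}) facet_of P"
    by (rule polyhedron_facet_halfspaces[OF P(3,2)]) (rule that, assumption+)
  define F where "F h = P \<inter> {x. a h \<bullet> x = b h}" for h
  have fF: "F h facet_of P" if "h \<in> H" for h using fac that by (simp add: F_def)
  have fin: "finite {F. F facet_of P}" using finite_polyhedron_facets P(3) by blast
  define pr where "pr h e x = x - ((a h \<bullet> x - b h) / (a h \<bullet> e)) *\<^sub>R e" for h e x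
  have prm[measurable]: "pr h e \<in> borel_measurable borel" for h e
    unfolding pr_def[abs_def] by measurable
  have Fcl[measurable]: "F h \<in> sets borel" for h
  proof -
    have "closed (F h)" unfolding F_def
      using P(1) by (intro closed_Int compact_imp_closed closed_hyperplane)
    then show ?thesis by (rule borel_closed)
  qed
  have "\<exists>c. \<forall>v \<in> borel_measurable borel.
      (\<integral>\<^sup>+x. v (pr h e x) * indicator {0..1} (x \<bullet> e) \<partial>lborel) = ennreal c * (\<integral>\<^sup>+y. v (g (F h) y) \<partial>lborel)"
    if h: "h \<in> H" and e: "e \<in> Basis" "a h \<bullet> e \<noteq> 0" for h e
  proof -
    obtain A p where A: "linear A" "inj A" "g (F h) = (\<lambda>y. A y + p)" and rg: "range (g (F h)) = affine hull F h"
      using fp[unfolded facet_params_def, rule_format, OF fF[OF h]] by blast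
    have "affine hull F h \<subseteq> {x. a h \<bullet> x = b h}"
      by (rule hull_minimal) (auto simp: F_def affine_hyperplane)
    then have hyp: "a h \<bullet> g (F h) y = b h" for y using rg by blast
    obtain c where "\<And>v. v \<in> borel_measurable borel \<Longrightarrow>
        (\<integral>\<^sup>+x. v (pr h e x) * indicator {0..1} (x \<bullet> e) \<partial>lborel) = ennreal c * (\<integral>\<^sup>+y. v (g (F h) y) \<partial>lborel)"
      unfolding pr_def by (rule facet_projection_integral[OF dim A hyp e]) blast
    then show ?thesis by blast
  qed
  note ex = this
  define c where "c h e = (SOME c. \<forall>v \<in> borel_measurable borel.
      (\<integral>\<^sup>+x. v (pr h e x) * indicator {0..1} (x \<bullet> e) \<partial>lborel) = ennreal c * (\<integral>\<^sup>+y. v (g (F h) y) \<partial>lborel))" for h e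
  have c: "(\<integral>\<^sup>+x. v (pr h e x) * indicator {0..1} (x \<bullet> e) \<partial>lborel) = ennreal (c h e) * (\<integral>\<^sup>+y. v (g (F h) y) \<partial>lborel)"
    if "h \<in> H" "e \<in> Basis" "a h \<bullet> e \<noteq> 0" "v \<in> borel_measurable borel" for h e v
    using someI_ex[OF ex[OF that(1-3)]] that(4) unfolding c_def by blast
  \<comment> \<open>Projection along \<open>e\<close> makes sense only for facets transverse to
    \<open>e\<close>; the exit facets of a line in direction \<open>e\<close> are among
    them.\<close>
  define He where "He e = {h \<in> H. a h \<bullet> e \<noteq> 0}" for e
  have He: "finite (He e)" for e using H by (simp add: He_def)
  \<comment> \<open>Dividing by \<open>csig\<close> turns the parameter integral over a facet into
    its share of \<open>sigma_int\<close>. Nothing is recorded about the sign of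
    \<open>c h e\<close>, hence the absolute value.\<close>
  define K where "K e = (\<Sum>h\<in>He e. \<bar>c h e\<bar> / csig (F h))" for e
  have K0: "K e \<ge> 0" for e unfolding K_def
    by (intro sum_nonneg divide_nonneg_nonneg) (auto simp: He_def intro: less_imp_le[OF cs[OF fF]])
  show ?thesis
  proof
    show "0 \<le> (\<Prod>e\<in>Basis. K e)" by (intro prod_nonneg K0)
    fix u :: "'a \<Rightarrow> ennreal"
    assume conv: "convex_ennreal_on P u" and um[measurable]: "(\<lambda>x. u x * indicator P x) \<in> borel_measurable borel"
    \<comment> \<open>The cutoff removes projections landing on the hyperplane of a facet but
      outside the facet itself, where nothing is known about \<open>u\<close>.\<close>
    define v where "v h x = u x * indicator (F h) x" for h x
    have vm[measurable]: "v h \<in> borel_measurable borel" for h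
    proof -
      have "v h = (\<lambda>x. (u x * indicator P x) * indicator (F h) x)"
        by (auto simp: v_def F_def fun_eq_iff split: split_indicator)
      then show ?thesis by simp
    qed
    define f where "f e x = (\<Sum>h\<in>He e. v h (pr h e x))" for e x
    have prinv: "pr h e (x + t *\<^sub>R e) = pr h e x" if "h \<in> He e" for h e x t
    proof -
      have "(a h \<bullet> (x + t *\<^sub>R e) - b h) / (a h \<bullet> e) = (a h \<bullet> x - b h) / (a h \<bullet> e) + t"
        using that by (simp add: He_def inner_add_right field_simps)
      then show ?thesis by (simp add: pr_def scaleR_add_left)
    qed
    have prF: "pr h e x = x" if "a h \<bullet> x = b h" for h e x using that by (simp add: pr_def)
    have hit: "u (x + t *\<^sub>R e) \<le> f e x" if "h \<in> He e" "x + t *\<^sub>R e \<in> P" "a h \<bullet> (x + t *\<^sub>R e) = b h" for h e x t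
    proof -
      have "pr h e x = x + t *\<^sub>R e" using prinv[OF that(1), of x t] prF[OF that(3)] by simp
      then have "u (x + t *\<^sub>R e) = v h (pr h e x)" using that by (simp add: v_def F_def)
      also have "\<dots> \<le> f e x" unfolding f_def by (rule member_le_sum) (use that He in auto)
      finally show ?thesis .
    qed
    have uf: "u x \<le> f e x" if x: "x \<in> P" and e: "e \<in> Basis" for x e
    proof -
      have bP: "bounded P" using P(1) compact_imp_bounded by blast
      have e0: "e \<noteq> 0" "- e \<noteq> 0" using e by auto
      obtain t h where 1: "t \<ge> 0" "h \<in> H" "x + t *\<^sub>R e \<in> P" "a h \<bullet> e > 0" "a h \<bullet> (x + t *\<^sub>R e) = b h"
        using ray_exits_polytope[OF H bP x e0(1)] .
      obtain s h' where 2: "s \<ge> 0" "h' \<in> H" "x + s *\<^sub>R (- e) \<in> P" "a h' \<bullet> (- e) > 0" "a h' \<bullet> (x + s *\<^sub>R (- e)) = b h'"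
        using ray_exits_polytope[OF H bP x e0(2)] .
      show ?thesis
      proof (rule convex_ennreal_on_le[OF conv, of x s e t])
        show "u (x + t *\<^sub>R e) \<le> f e x" using hit[of h e x t] 1 by (simp add: He_def)
        show "u (x - s *\<^sub>R e) \<le> f e x" using hit[of h' e x "- s"] 2 by (simp add: He_def)
      qed (use 1 2 in auto)
    qed
    have fint: "(\<integral>\<^sup>+x. f e x * indicator {0..1} (x \<bullet> e) \<partial>lborel) \<le> ennreal (K e) * sigma_int P csig g u"
      if e: "e \<in> Basis" for e
    proof -
      have "(\<integral>\<^sup>+x. f e x * indicator {0..1} (x \<bullet> e) \<partial>lborel)
          = (\<Sum>h\<in>He e. \<integral>\<^sup>+x. v h (pr h e x) * indicator {0..1} (x \<bullet> e) \<partial>lborel)"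
        unfolding f_def sum_distrib_right by (rule nn_integral_sum) measurable
      also have "\<dots> = (\<Sum>h\<in>He e. ennreal (c h e) * (\<integral>\<^sup>+y. v h (g (F h) y) \<partial>lborel))"
        by (intro sum.cong refl c) (use e in \<open>auto simp: He_def\<close>)
      also have "\<dots> \<le> (\<Sum>h\<in>He e. ennreal (\<bar>c h e\<bar> / csig (F h)) * sigma_int P csig g u)"
      proof (rule sum_mono)
        fix h assume "h \<in> He e"
        then have h: "F h facet_of P" "csig (F h) > 0" using fF cs by (auto simp: He_def)
        have "ennreal (csig (F h)) * (\<integral>\<^sup>+y. v h (g (F h) y) \<partial>lborel) \<le> sigma_int P csig g u"
          unfolding sigma_int_def v_def
          using member_le_sum[of "F h" "{F. F facet_of P}" "\<lambda>F. ennreal (csig F) * (\<integral>\<^sup>+ y. indicator F (g F y) * u (g F y) \<partial>lborel)"] h fin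
          by (simp add: mult.commute)
        then have "ennreal (\<bar>c h e\<bar> / csig (F h)) * (ennreal (csig (F h)) * (\<integral>\<^sup>+y. v h (g (F h) y) \<partial>lborel))
          \<le> ennreal (\<bar>c h e\<bar> / csig (F h)) * sigma_int P csig g u" by (rule mult_left_mono) simp
        moreover have "ennreal (\<bar>c h e\<bar> / csig (F h)) * ennreal (csig (F h)) = ennreal \<bar>c h e\<bar>"
          using h by (simp add: ennreal_mult[symmetric])
        moreover have "ennreal (c h e) * (\<integral>\<^sup>+y. v h (g (F h) y) \<partial>lborel) \<le> ennreal \<bar>c h e\<bar> * (\<integral>\<^sup>+y. v h (g (F h) y) \<partial>lborel)"
          by (intro mult_right_mono ennreal_leI) auto
        ultimately show "ennreal (c h e) * (\<integral>\<^sup>+y. v h (g (F h) y) \<partial>lborel) \<le> ennreal (\<bar>c h e\<bar> / csig (F h)) * sigma_int P csig g u"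
          by (simp add: mult.assoc[symmetric])
      qed
      also have "\<dots> = ennreal (K e) * sigma_int P csig g u"
        unfolding K_def by (subst sum_ennreal[symmetric])
          (auto simp: sum_distrib_right He_def intro!: divide_nonneg_nonneg intro: less_imp_le[OF cs[OF fF]])
      finally show ?thesis .
    qed
    have "(\<integral>\<^sup>+x\<in>P. epow (u x) (real (Suc k) / k) \<partial>lborel) ^ k
      \<le> (\<Prod>e\<in>Basis. \<integral>\<^sup>+x. f e x * indicator {0..1} (x \<bullet> e) \<partial>lborel)"
    proof (rule Loomis_Whitney[OF k])
      fix e :: 'a assume "e \<in> Basis"
      show "f e \<in> borel_measurable borel" unfolding f_def[abs_def] by measurable
      show "f e (x + t *\<^sub>R e) = f e x" for x t unfolding f_def by (intro sum.cong refl) (simp add: prinv)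
    next
      have "(\<lambda>x. epow (u x) (real (Suc k) / k) * indicator P x)
        = (\<lambda>x. epow (u x * indicator P x) (real (Suc k) / real k) * indicator P x)"
        by (auto simp: fun_eq_iff split: split_indicator)
      moreover have "P \<in> sets borel" using P(1) compact_imp_closed borel_closed by blast
      ultimately show "(\<lambda>x. epow (u x) (real (Suc k) / k) * indicator P x) \<in> borel_measurable borel" by simp
    next
      fix x
      show "(epow (u x) (real (Suc k) / k) * indicator P x) ^ k \<le> (\<Prod>e\<in>Basis. f e x)"
      proof (cases "x \<in> P")
        case True
        then have "(epow (u x) (real (Suc k) / k) * indicator P x) ^ k = (\<Prod>e\<in>(Basis::'a set). u x)"
          using epow_power[OF k(2)] k by simp
        also have "\<dots> \<le> (\<Prod>e\<in>Basis. f e x)" by (intro prod_mono_ennreal) (auto simp: uf[OF True])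
        finally show ?thesis .
      qed (use k in \<open>simp add: zero_power\<close>)
    qed
    also have "\<dots> \<le> (\<Prod>e\<in>Basis. ennreal (K e) * sigma_int P csig g u)"
      by (intro prod_mono_ennreal) (auto simp: fint)
    also have "\<dots> = ennreal (\<Prod>e\<in>Basis. K e) * sigma_int P csig g u ^ Suc k"
      by (simp add: prod.distrib K0 prod_ennreal k del: power_Suc)
    finally show "(\<integral>\<^sup>+x\<in>P. epow (u x) (real (Suc k) / k) \<partial>lborel) ^ k
      \<le> ennreal (\<Prod>e\<in>Basis. K e) * sigma_int P csig g u ^ Suc k" .
  qed
qed

section \<open>Lower semicontinuity and log-convexity\<close>

lemma liminf_add_ennreal:
  fixes u v :: "nat \<Rightarrow> ennreal"
  shows "liminf u + liminf v \<le> liminf (\<lambda>n. u n + v n)"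
proof -
  have "liminf u + liminf v = (SUP n. (INF m\<in>{n..}. u m) + (INF m\<in>{n..}. v m))"
    unfolding liminf_SUP_INF
    by (rule ennreal_SUP_add[symmetric]) (auto simp: incseq_def intro!: INF_superset_mono)
  also have "\<dots> \<le> liminf (\<lambda>n. u n + v n)"
    unfolding liminf_SUP_INF
    by (intro SUP_mono bexI[of _ "_::nat"] INF_greatest add_mono INF_lower) auto
  finally show ?thesis .
qed

lemma liminf_cmult_ennreal_le:
  fixes u :: "nat \<Rightarrow> ennreal"
  shows "c * liminf u \<le> liminf (\<lambda>n. c * u n)"
  unfolding liminf_SUP_INF SUP_mult_left_ennreal
  by (intro SUP_mono bexI[of _ "_::nat"] INF_greatest mult_left_mono INF_lower) auto

text \<open>Two additive inequalities stand in for an absolute difference, so that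
  \<open>a = top\<close> is covered as well: the errors are eventually finite.\<close>

lemma tendsto_ennreal_sandwich:
  fixes a :: ennreal and X \<epsilon> :: "nat \<Rightarrow> ennreal"
  assumes \<epsilon>: "\<epsilon> \<longlonglongrightarrow> 0" and up: "\<And>n. X n \<le> a + \<epsilon> n" and low: "\<And>n. a \<le> X n + \<epsilon> n"
  shows "X \<longlonglongrightarrow> a"
proof (rule tendsto_sandwich)
  show "\<forall>\<^sub>F n in sequentially. a - \<epsilon> n \<le> X n"
  proof -
    have "\<forall>\<^sub>F n in sequentially. \<epsilon> n < top" by (rule order_tendstoD[OF \<epsilon>]) simp
    then show ?thesis
      by eventually_elim (use low in \<open>auto simp: ennreal_minus_le_iff add.commute\<close>)
  qed
  show "\<forall>\<^sub>F n in sequentially. X n \<le> a + \<epsilon> n" using up by simp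
  show "(\<lambda>n. a - \<epsilon> n) \<longlonglongrightarrow> a" using tendsto_diff_ennreal_general[OF tendsto_const \<epsilon>, of a] by simp
  show "(\<lambda>n. a + \<epsilon> n) \<longlonglongrightarrow> a" using tendsto_add[OF tendsto_const \<epsilon>, of a] by simp
qed

lemma lsc_on_seqD:
  assumes "lsc_on P u" "x \<in> P" "\<And>n. X n \<in> P" "X \<longlonglongrightarrow> x"
  shows "u x \<le> liminf (\<lambda>n. u (X n))"
  unfolding le_Liminf_iff
proof safe
  fix a assume a: "a < u x"
  then have "\<forall>\<^sub>F y in at x within P. a < u y" using assms(1,2) by (simp add: lsc_on_def)
  then obtain S where S: "open S" "x \<in> S" "\<And>y. y \<in> S \<Longrightarrow> y \<noteq> x \<Longrightarrow> y \<in> P \<Longrightarrow> a < u y"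
    by (auto simp: eventually_at_topological)
  then have "\<forall>\<^sub>F n in sequentially. X n \<in> S" using assms(4) by (simp add: topological_tendstoD)
  then show "\<forall>\<^sub>F n in sequentially. a < u (X n)"
  proof eventually_elim
    case (elim n)
    \<comment> \<open>\<open>lsc_on\<close> speaks of punctured neighbourhoods, hence the separate
      case \<open>X n = x\<close>.\<close>
    then show ?case using S(3)[of "X n"] a assms(3)[of n] by (cases "X n = x") auto
  qed
qed

lemma lsc_on_seqI:
  fixes u :: "'a::first_countable_topology \<Rightarrow> ennreal"
  assumes "\<And>x X. x \<in> P \<Longrightarrow> (\<And>n. X n \<in> P) \<Longrightarrow> X \<longlonglongrightarrow> x \<Longrightarrow> u x \<le> liminf (\<lambda>n. u (X n))"
  shows "lsc_on P u"
  unfolding lsc_on_def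
proof safe
  fix x a assume xa: "x \<in> P" "a < u x"
  show "\<forall>\<^sub>F y in at x within P. a < u y"
  proof (rule sequentially_imp_eventually_within, safe)
    fix X assume "\<forall>n. X n \<in> P \<and> X n \<noteq> x" "X \<longlonglongrightarrow> x"
    then have "u x \<le> liminf (\<lambda>n. u (X n))" using xa assms[of x X] by simp
    then show "\<forall>\<^sub>F n in sequentially. a < u (X n)" using xa by (simp add: le_Liminf_iff)
  qed
qed

lemma lsc_on_add:
  fixes u v :: "'a::first_countable_topology \<Rightarrow> ennreal"
  assumes "lsc_on P u" "lsc_on P v"
  shows "lsc_on P (\<lambda>x. u x + v x)"
proof (rule lsc_on_seqI)
  fix x X assume *: "x \<in> P" "\<And>n. X n \<in> P" "X \<longlonglongrightarrow> x"
  have "u x + v x \<le> liminf (\<lambda>n. u (X n)) + liminf (\<lambda>n. v (X n))"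
    by (intro add_mono lsc_on_seqD[OF assms(1)] lsc_on_seqD[OF assms(2)] *)
  also have "\<dots> \<le> liminf (\<lambda>n. u (X n) + v (X n))" by (rule liminf_add_ennreal)
  finally show "u x + v x \<le> liminf (\<lambda>n. u (X n) + v (X n))" .
qed

lemma lsc_on_cmult:
  fixes u :: "'a::first_countable_topology \<Rightarrow> ennreal"
  assumes "lsc_on P u"
  shows "lsc_on P (\<lambda>x. c * u x)"
proof (rule lsc_on_seqI)
  fix x X assume *: "x \<in> P" "\<And>n. X n \<in> P" "X \<longlonglongrightarrow> x"
  have "c * u x \<le> c * liminf (\<lambda>n. u (X n))"
    by (intro mult_left_mono lsc_on_seqD[OF assms] *) auto
  also have "\<dots> \<le> liminf (\<lambda>n. c * u (X n))" by (rule liminf_cmult_ennreal_le)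
  finally show "c * u x \<le> liminf (\<lambda>n. c * u (X n))" .
qed

lemma lsc_on_SUP:
  assumes "\<And>i. i \<in> I \<Longrightarrow> lsc_on P (u i)"
  shows "lsc_on P (\<lambda>x. SUP i\<in>I. u i x)"
  unfolding lsc_on_def
proof safe
  fix x a assume "x \<in> P" "a < (SUP i\<in>I. u i x)"
  then obtain i where "i \<in> I" "a < u i x" by (auto simp: less_SUP_iff)
  then have "\<forall>\<^sub>F y in at x within P. a < u i y" using assms \<open>x \<in> P\<close> by (simp add: lsc_on_def)
  then show "\<forall>\<^sub>F y in at x within P. a < (SUP i\<in>I. u i y)"
    by eventually_elim (use \<open>i \<in> I\<close> in \<open>auto simp: less_SUP_iff\<close>)
qed

lemma lsc_on_measurable:
  fixes u :: "'a::topological_space \<Rightarrow> ennreal"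
  assumes "lsc_on P u" "closed P"
  shows "(\<lambda>x. u x * indicator P x) \<in> borel_measurable borel"
proof (rule borel_measurableI_greater)
  fix a :: ennreal
  have "\<exists>S. open S \<and> x \<in> S \<and> (\<forall>y\<in>S \<inter> P. a < u y)" if "x \<in> P" "a < u x" for x
  proof -
    have "\<forall>\<^sub>F y in at x within P. a < u y" using assms that by (simp add: lsc_on_def)
    then obtain S where S: "open S" "x \<in> S" "\<And>y. y \<in> S \<Longrightarrow> y \<noteq> x \<Longrightarrow> y \<in> P \<Longrightarrow> a < u y"
      by (auto simp: eventually_at_topological)
    then show ?thesis using that by (intro exI[of _ S]) auto
  qed
  note nbhd = this
  define T where "T = \<Union>{S. open S \<and> (\<forall>y\<in>S \<inter> P. a < u y)}"
  have "{x \<in> P. a < u x} = P \<inter> T"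
  proof (rule set_eqI, rule iffI)
    fix x assume x: "x \<in> {x \<in> P. a < u x}"
    then obtain S where "open S \<and> x \<in> S \<and> (\<forall>y\<in>S \<inter> P. a < u y)" using nbhd by auto
    then show "x \<in> P \<inter> T" using x unfolding T_def by auto
  qed (auto simp: T_def)
  moreover have "open T" unfolding T_def by (rule open_Union) simp
  moreover have "{x \<in> space borel. a < u x * indicator P x} = {x \<in> P. a < u x}"
    by (auto split: split_indicator_asm simp: indicator_def)
  ultimately show "{x \<in> space borel. a < u x * indicator P x} \<in> sets borel"
    using assms(2) by (auto intro!: sets.Int)
qed

text \<open>By the weighted AM-GM inequality \<open>X\<^bsup>1-t\<^esup> Y\<^bsup>t\<^esup>\<close> is the infimum over \<open>\<alpha> > 0\<close> of
  \<open>(1-t) \<alpha>\<^bsup>t\<^esup> X + t \<alpha>\<^bsup>t-1\<^esup> Y\<close>, so log-convexity amounts to a family of inequalities that are linear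
  in \<open>u\<close> and hence stable under sums, averages and limits.\<close>
definition lin_log_convex_on :: "'a::real_vector set \<Rightarrow> ('a \<Rightarrow> ennreal) \<Rightarrow> bool" where
  "lin_log_convex_on P u \<longleftrightarrow> (\<forall>x\<in>P. \<forall>y\<in>P. \<forall>t \<alpha>. 0 < t \<longrightarrow> t < 1 \<longrightarrow> 0 < \<alpha> \<longrightarrow>
     u ((1 - t) *\<^sub>R x + t *\<^sub>R y) \<le> ennreal ((1 - t) * \<alpha> powr t) * u x + ennreal (t * \<alpha> powr (t - 1)) * u y)"

lemma lin_log_convex_onD:
  assumes "lin_log_convex_on P u" "x \<in> P" "y \<in> P" "0 < t" "t < 1" "0 < \<alpha>"
  shows "u ((1 - t) *\<^sub>R x + t *\<^sub>R y) \<le> ennreal ((1 - t) * \<alpha> powr t) * u x + ennreal (t * \<alpha> powr (t - 1)) * u y"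
  using assms unfolding lin_log_convex_on_def by blast

text \<open>One direction is Young's inequality, the other the choice of the optimal
  \<open>\<alpha>\<close>, a quotient of two values of \<open>u\<close> that positivity makes
  admissible.\<close>

lemma log_convex_on_iff_lin:
  assumes pos: "\<And>x. x \<in> P \<Longrightarrow> u x > 0"
  shows "log_convex_on P u \<longleftrightarrow> lin_log_convex_on P u"
proof
  assume L: "log_convex_on P u"
  show "lin_log_convex_on P u"
    unfolding lin_log_convex_on_def
  proof (intro ballI allI impI)
    fix x y t \<alpha> assume *: "x \<in> P" "y \<in> P" "0 < t" "t < (1::real)" "0 < (\<alpha>::real)"
    show "u ((1 - t) *\<^sub>R x + t *\<^sub>R y) \<le> ennreal ((1 - t) * \<alpha> powr t) * u x + ennreal (t * \<alpha> powr (t - 1)) * u y"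
    proof (cases "u x = \<infinity> \<or> u y = \<infinity>")
      case True
      \<comment> \<open>Both coefficients are strictly positive, so an infinite value makes the
        right-hand side infinite, in accordance with the convention in
        \<open>log_convex_on\<close>.\<close>
      then have "ennreal ((1 - t) * \<alpha> powr t) * u x + ennreal (t * \<alpha> powr (t - 1)) * u y = \<infinity>"
      proof -
        have "0 < (1 - t) * \<alpha> powr t" "0 < t * \<alpha> powr (t - 1)" using * by auto
        then show ?thesis using True *
          by (elim disjE) (simp_all add: ennreal_mult_top del: zero_less_mult_iff)
      qed
      then show ?thesis by (simp only: top_greatest infinity_ennreal_def)
    next
      case False
      define X Y where "X = enn2real (u x)" and "Y = enn2real (u y)"
      have X: "u x = ennreal X" "X > 0" and Y: "u y = ennreal Y" "Y > 0"
        using False pos[of x] pos[of y] * by (auto simp: X_def Y_def less_top enn2real_positive_iff)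
      have "u ((1 - t) *\<^sub>R x + t *\<^sub>R y) \<le> ennreal (X powr (1 - t) * Y powr t)"
        using L * False unfolding log_convex_on_def X_def Y_def by blast
      \<comment> \<open>The two scalings cancel in the geometric mean, since their exponents t(1-t)
        and (t-1)t add up to 0.\<close>
      also have "\<dots> = ennreal ((\<alpha> powr t * X) powr (1 - t) * (\<alpha> powr (t - 1) * Y) powr t)"
      proof -
        have "(\<alpha> powr t * X) powr (1 - t) * (\<alpha> powr (t - 1) * Y) powr t
          = (\<alpha> powr (t * (1 - t)) * \<alpha> powr ((t - 1) * t)) * (X powr (1 - t) * Y powr t)"
          using X Y * by (simp add: powr_mult powr_powr mult_ac)
        also have "\<alpha> powr (t * (1 - t)) * \<alpha> powr ((t - 1) * t) = 1"
          using * by (simp add: powr_add[symmetric] algebra_simps)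
        finally show ?thesis by simp
      qed
      also have "\<dots> \<le> ennreal ((1 - t) * (\<alpha> powr t * X) + t * (\<alpha> powr (t - 1) * Y))"
        by (intro ennreal_leI Youngs_inequality_0) (use * X Y in auto)
      also have "\<dots> = ennreal ((1 - t) * \<alpha> powr t) * u x + ennreal (t * \<alpha> powr (t - 1)) * u y"
        using * X Y by (simp add: ennreal_mult[symmetric] ennreal_plus[symmetric] mult.assoc del: ennreal_plus)
      finally show ?thesis .
    qed
  qed
next
  assume L: "lin_log_convex_on P u"
  show "log_convex_on P u"
    unfolding log_convex_on_def
  proof (intro ballI allI impI)
    fix x y and t :: real assume *: "x \<in> P" "y \<in> P" "0 < t \<and> t < 1" "u x \<noteq> \<infinity>" "u y \<noteq> \<infinity>"
    define X Y where "X = enn2real (u x)" and "Y = enn2real (u y)"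
    have X: "u x = ennreal X" "X > 0" and Y: "u y = ennreal Y" "Y > 0"
      using pos[of x] pos[of y] * by (auto simp: X_def Y_def less_top enn2real_positive_iff)
    \<comment> \<open>At \<open>\<alpha> = Y / X\<close> both scaled values equal
      \<open>X powr (1 - t) * Y powr t\<close>, so arithmetic and geometric mean coincide.\<close>
    have "u ((1 - t) *\<^sub>R x + t *\<^sub>R y) \<le> ennreal ((1 - t) * (Y / X) powr t) * u x + ennreal (t * (Y / X) powr (t - 1)) * u y"
      by (rule lin_log_convex_onD[OF L]) (use * X Y in auto)
    also have "\<dots> = ennreal ((1 - t) * (Y / X) powr t * X + t * (Y / X) powr (t - 1) * Y)"
      using * X Y by (simp add: ennreal_mult[symmetric] ennreal_plus[symmetric] del: ennreal_plus)
    also have "(1 - t) * (Y / X) powr t * X + t * (Y / X) powr (t - 1) * Y = X powr (1 - t) * Y powr t"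
    proof -
      have "(Y / X) powr t * X = X powr (1 - t) * Y powr t"
        using X Y by (simp add: powr_divide powr_diff)
      moreover have "(Y / X) powr (t - 1) * Y = X powr (1 - t) * Y powr t"
        using X Y by (simp add: powr_divide powr_diff)
      ultimately show ?thesis by (simp add: mult.assoc) (simp add: algebra_simps)
    qed
    finally show "u ((1 - t) *\<^sub>R x + t *\<^sub>R y) \<le> ennreal (enn2real (u x) powr (1 - t) * enn2real (u y) powr t)"
      by (simp add: X_def Y_def)
  qed
qed

lemma lin_log_convex_on_imp_convex:
  assumes "lin_log_convex_on P u"
  shows "convex_ennreal_on P u"
  unfolding convex_ennreal_on_def
proof (intro ballI allI impI)
  fix x y t assume "x \<in> P" "y \<in> P" "0 < t \<and> t < (1::real)"
  then show "u ((1 - t) *\<^sub>R x + t *\<^sub>R y) \<le> ennreal (1 - t) * u x + ennreal t * u y"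
    using lin_log_convex_onD[OF assms, of x y t 1] by simp
qed

lemma nn_integral_lborel_affine:
  fixes a :: "'a::euclidean_space"
  assumes [measurable]: "f \<in> borel_measurable borel" and s: "s > 0"
  shows "(\<integral>\<^sup>+z. f (a + s *\<^sub>R z) \<partial>lborel) = ennreal (1 / s ^ DIM('a)) * (\<integral>\<^sup>+y. f y \<partial>lborel)"
proof -
  have "(\<integral>\<^sup>+y. f y \<partial>lborel) = ennreal (s ^ DIM('a)) * (\<integral>\<^sup>+z. f (a + s *\<^sub>R z) \<partial>lborel)"
    using s by (subst lborel_affine[of s a]) (auto simp: nn_integral_density nn_integral_distr nn_integral_cmult ennreal_power)
  then have "ennreal (1 / s ^ DIM('a)) * (\<integral>\<^sup>+y. f y \<partial>lborel)
     = (ennreal (1 / s ^ DIM('a)) * ennreal (s ^ DIM('a))) * (\<integral>\<^sup>+z. f (a + s *\<^sub>R z) \<partial>lborel)"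
    by (simp add: mult.assoc)
  also have "ennreal (1 / s ^ DIM('a)) * ennreal (s ^ DIM('a)) = 1"
    using s by (simp add: ennreal_mult[symmetric])
  finally show ?thesis by simp
qed

text \<open>An absolute difference is needed because subtraction on \<open>ennreal\<close> is
  truncated at 0. The infinite cases follow the convention of \<open>Lp_dist\<close>.\<close>

definition ediff :: "ennreal \<Rightarrow> ennreal \<Rightarrow> ennreal" where
  "ediff a b = (if a = \<infinity> \<or> b = \<infinity> then \<infinity> else ennreal \<bar>enn2real a - enn2real b\<bar>)"

lemma ediff_commute: "ediff a b = ediff b a"
  by (auto simp: ediff_def abs_minus_commute)

lemma le_add_ediff: "a \<le> b + ediff a b"
proof (cases "a = \<infinity> \<or> b = \<infinity>")
  case False
  then obtain r s where "a = ennreal r" "b = ennreal s" "r \<ge> 0" "s \<ge> 0"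
    by (cases a; cases b) auto
  then show ?thesis by (auto simp: ediff_def ennreal_plus[symmetric] simp del: ennreal_plus intro!: ennreal_leI)
qed (auto simp: ediff_def)

lemma ediff_measurable [measurable]:
  assumes [measurable]: "f \<in> borel_measurable M" "h \<in> borel_measurable M"
  shows "(\<lambda>x. ediff (f x) (h x)) \<in> borel_measurable M"
  unfolding ediff_def by measurable

section \<open>Averages over homothetic copies of a convex body\<close>

text \<open>This is \<open>Mp P cmu 1\<close> with \<open>cmu\<close> cancelled and log-convexity in
  linear form (see \<open>Mp_1_iff\<close>), so that all conditions behave well under averages and
  limits.\<close>

definition densities :: "'a::euclidean_space set \<Rightarrow> ('a \<Rightarrow> ennreal) set" where
  "densities P = {u. lsc_on P u \<and> (\<forall>x\<in>P. u x > 0) \<and> lin_log_convex_on P u \<and>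
     (\<integral>\<^sup>+x\<in>P. u x \<partial>lborel) = emeasure lborel P}"

locale convex_body =
  fixes P :: "'a::euclidean_space set"
  assumes compact_P: "compact P" and convex_P: "convex P" and interior_P: "interior P \<noteq> {}"
begin

abbreviation "Q \<equiv> interior P"
text \<open>Averages use the interior: it has the same mass as \<open>P\<close>, the frontier of a
  convex set being negligible, and its openness is what \<open>dil_lsc\<close> rests on.\<close>

abbreviation "\<U> \<equiv> uniform_measure lborel (interior P)"
abbreviation cut :: "('a \<Rightarrow> ennreal) \<Rightarrow> 'a \<Rightarrow> ennreal" where "cut u \<equiv> (\<lambda>x. u x * indicator P x)"

lemma P_borel [measurable]: "P \<in> sets borel"
  using compact_P compact_imp_closed borel_closed by blast

lemma Q_borel [measurable]: "Q \<in> sets borel"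
  by (simp add: borel_open)

lemma AE_indicator_Q: "AE x in lborel. (indicator P x :: ennreal) = indicator Q x"
proof -
  have "negligible (frontier P)" by (rule negligible_convex_frontier[OF convex_P])
  moreover have "frontier P \<in> sets lborel" by (simp add: borel_closed)
  ultimately have "frontier P \<in> null_sets lborel"
    by (simp add: negligible_iff_null_sets null_sets_completion_iff)
  then have "AE x in lborel. x \<notin> frontier P" by (rule AE_not_in)
  then show ?thesis
  proof eventually_elim
    case (elim x)
    then have "x \<in> P \<longleftrightarrow> x \<in> Q"
      using compact_P compact_imp_closed interior_subset by (auto simp: frontier_def)
    then show ?case by (simp add: indicator_def)
  qed
qed

lemma nn_integral_Q: "(\<integral>\<^sup>+x. f x * indicator Q x \<partial>lborel) = (\<integral>\<^sup>+x. f x * indicator P x \<partial>lborel)"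
  using AE_indicator_Q by (intro nn_integral_cong_AE) auto

lemma emeasure_Q: "emeasure lborel Q = emeasure lborel P"
  using nn_integral_Q[of "\<lambda>_. 1"] by simp

lemma emeasure_P_pos: "0 < emeasure lborel P"
  using emeasure_lborel_open_pos[OF open_interior interior_P] by (simp add: emeasure_Q)

lemma emeasure_P_finite: "emeasure lborel P < \<infinity>"
  using emeasure_bounded_finite compact_P compact_imp_bounded by blast

lemma prob_space_U: "emeasure \<U> (space \<U>) = 1"
  using emeasure_P_pos emeasure_P_finite
  by (subst emeasure_uniform_measure) (auto simp: emeasure_Q ennreal_divide_self less_top)

lemma nn_integral_U:
  assumes "f \<in> borel_measurable borel"
  shows "(\<integral>\<^sup>+x. f x \<partial>\<U>) = (\<integral>\<^sup>+x. f x * indicator P x \<partial>lborel) / emeasure lborel P"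
  using assms by (subst nn_integral_uniform_measure) (auto simp: emeasure_Q nn_integral_Q)

lemma AE_U: "AE z in \<U>. z \<in> Q"
  by (rule AE_uniform_measureI) auto

text \<open>The mean of \<open>f\<close> over the homothetic copy of \<open>P\<close> with centre
  \<open>x\<close> and ratio \<open>s\<close>. For \<open>s > 0\<close> the copy has positive
  measure, so even at a boundary point the value depends only on the almost-everywhere class of
  \<open>f\<close>.\<close>

definition dil :: "real \<Rightarrow> ('a \<Rightarrow> ennreal) \<Rightarrow> 'a \<Rightarrow> ennreal" where
  "dil s f x = (\<integral>\<^sup>+z. f ((1 - s) *\<^sub>R x + s *\<^sub>R z) \<partial>\<U>)"

text \<open>The reciprocal of the volume of a copy of \<open>P\<close> of ratio \<open>s\<close>:
  the price of bounding an average by a full integral.\<close>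

definition K :: "real \<Rightarrow> ennreal" where
  "K s = ennreal (1 / s ^ DIM('a)) / emeasure lborel P"

lemma K_finite: "K s < \<infinity>"
  using emeasure_P_pos by (auto simp: K_def ennreal_divide_eq_top_iff less_top[symmetric])

lemma K_integral:
  fixes h :: "'a \<Rightarrow> ennreal"
  assumes [measurable]: "h \<in> borel_measurable borel" and "s > 0"
  shows "(\<integral>\<^sup>+z. h (a + s *\<^sub>R z) \<partial>lborel) / emeasure lborel P = K s * (\<integral>\<^sup>+y. h y \<partial>lborel)"
  unfolding nn_integral_lborel_affine[OF assms] K_def by (simp add: ennreal_times_divide mult.commute)

text \<open>Enlarging the domain of averaging to the whole space costs the factor
  \<open>K s\<close>. The error does not depend on \<open>x\<close>, so boundary points are
  controlled as well as interior ones.\<close>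

lemma dil_le_add_ediff:
  assumes [measurable]: "f \<in> borel_measurable borel" "h \<in> borel_measurable borel" and s: "s > 0"
  shows "dil s f x \<le> dil s h x + K s * (\<integral>\<^sup>+y. ediff (f y) (h y) \<partial>lborel)"
proof -
  let ?e = "\<lambda>y. ediff (f y) (h y)"
  have "dil s f x \<le> (\<integral>\<^sup>+z. h ((1 - s) *\<^sub>R x + s *\<^sub>R z) + ?e ((1 - s) *\<^sub>R x + s *\<^sub>R z) \<partial>\<U>)"
    unfolding dil_def by (intro nn_integral_mono le_add_ediff)
  also have "\<dots> = dil s h x + (\<integral>\<^sup>+z. ?e ((1 - s) *\<^sub>R x + s *\<^sub>R z) \<partial>\<U>)"
    unfolding dil_def by (rule nn_integral_add) measurable
  also have "(\<integral>\<^sup>+z. ?e ((1 - s) *\<^sub>R x + s *\<^sub>R z) \<partial>\<U>)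
      \<le> (\<integral>\<^sup>+z. ?e ((1 - s) *\<^sub>R x + s *\<^sub>R z) \<partial>lborel) / emeasure lborel P"
    by (subst nn_integral_U) (auto intro!: divide_right_mono_ennreal nn_integral_mono simp: indicator_def)
  also have "\<dots> = K s * (\<integral>\<^sup>+y. ?e y \<partial>lborel)" by (rule K_integral[OF _ s]) measurable
  finally show ?thesis by (simp add: add_left_mono)
qed

text \<open>A change of variables moves the dependence on \<open>x\<close> into the indicator of an
  open set, which is lower semicontinuous; Fatou's lemma does the rest.\<close>

lemma dil_lsc:
  assumes [measurable]: "f \<in> borel_measurable borel" and s: "s > 0" and X: "X \<longlonglongrightarrow> x"
  shows "dil s f x \<le> liminf (\<lambda>n. dil s f (X n))"
proof -
  let ?c = "\<lambda>x y. (1 / s) *\<^sub>R (y - (1 - s) *\<^sub>R x)"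
  let ?h = "\<lambda>x y. f y * indicator Q (?c x y)"
  have eq: "dil s f x = K s * (\<integral>\<^sup>+y. ?h x y \<partial>lborel)" for x
  proof -
    have "dil s f x = (\<integral>\<^sup>+z. ?h x ((1 - s) *\<^sub>R x + s *\<^sub>R z) \<partial>lborel) / emeasure lborel P"
      unfolding dil_def using s
      by (subst nn_integral_uniform_measure) (auto simp: emeasure_Q)
    then show ?thesis by (subst (asm) K_integral[OF _ s]) measurable
  qed
  have "?h x y \<le> liminf (\<lambda>n. ?h (X n) y)" for y
  proof (cases "?c x y \<in> Q")
    case True
    have "(\<lambda>n. ?c (X n) y) \<longlonglongrightarrow> ?c x y" by (intro tendsto_intros X)
    then have "\<forall>\<^sub>F n in sequentially. ?c (X n) y \<in> Q" using True by (intro topological_tendstoD) auto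
    then show ?thesis by (intro Liminf_bounded) (auto elim!: eventually_mono simp: True)
  qed simp
  then have "dil s f x \<le> K s * (\<integral>\<^sup>+y. liminf (\<lambda>n. ?h (X n) y) \<partial>lborel)"
    unfolding eq by (intro mult_left_mono nn_integral_mono) auto
  also have "\<dots> \<le> K s * liminf (\<lambda>n. \<integral>\<^sup>+y. ?h (X n) y \<partial>lborel)"
    by (intro mult_left_mono nn_integral_liminf) auto
  also have "\<dots> \<le> liminf (\<lambda>n. dil s f (X n))"
    unfolding eq by (rule liminf_cmult_ennreal_le)
  finally show ?thesis .
qed

lemma segment_in_P: "x \<in> P \<Longrightarrow> z \<in> Q \<Longrightarrow> 0 \<le> s \<Longrightarrow> s \<le> 1 \<Longrightarrow> (1 - s) *\<^sub>R x + s *\<^sub>R z \<in> P"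
  using convex_P interior_subset by (auto intro!: convexD)

lemma densities_measurable [measurable]: "u \<in> densities P \<Longrightarrow> cut u \<in> borel_measurable borel"
  using lsc_on_measurable compact_P compact_imp_closed by (auto simp: densities_def)

lemma densities_average:
  assumes "u \<in> densities P"
  shows "(\<integral>\<^sup>+z. cut u z \<partial>\<U>) = 1"
  using assms emeasure_P_pos emeasure_P_finite
  by (subst nn_integral_U)
    (auto simp: densities_def ennreal_divide_self less_top mult.assoc indicator_times_eq_if split_indicator
      simp flip: indicator_inter_arith)

text \<open>For fixed \<open>z\<close> the averaged point is affine in \<open>x\<close>, and
  inequalities linear in \<open>u\<close> survive integration over \<open>z\<close>.\<close>

lemma dil_lin_log_convex:
  assumes u: "u \<in> densities P" and s: "0 < s" "s < 1"
    and x: "x \<in> P" and y: "y \<in> P" and t: "0 < t" "t < 1" "0 < \<alpha>"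
  shows "dil s (cut u) ((1 - t) *\<^sub>R x + t *\<^sub>R y)
    \<le> ennreal ((1 - t) * \<alpha> powr t) * dil s (cut u) x + ennreal (t * \<alpha> powr (t - 1)) * dil s (cut u) y"
proof -
  note [measurable] = densities_measurable[OF u]
  let ?L = "\<lambda>x z. (1 - s) *\<^sub>R x + s *\<^sub>R z"
  have L: "lin_log_convex_on P u" using u by (simp add: densities_def)
  have "AE z in \<U>. cut u (?L ((1 - t) *\<^sub>R x + t *\<^sub>R y) z)
    \<le> ennreal ((1 - t) * \<alpha> powr t) * cut u (?L x z) + ennreal (t * \<alpha> powr (t - 1)) * cut u (?L y z)"
    using AE_U
  proof eventually_elim
    case (elim z)
    have P: "?L x z \<in> P" "?L y z \<in> P" using segment_in_P[OF _ elim] x y s by auto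
    have eq: "?L ((1 - t) *\<^sub>R x + t *\<^sub>R y) z = (1 - t) *\<^sub>R ?L x z + t *\<^sub>R ?L y z"
      by (simp add: algebra_simps)
    have "(1 - t) *\<^sub>R ?L x z + t *\<^sub>R ?L y z \<in> P"
      using convex_P P t by (auto intro!: convexD)
    then show ?case unfolding eq using lin_log_convex_onD[OF L P t] P by simp
  qed
  then have "dil s (cut u) ((1 - t) *\<^sub>R x + t *\<^sub>R y) \<le> (\<integral>\<^sup>+z. ennreal ((1 - t) * \<alpha> powr t) * cut u (?L x z)
      + ennreal (t * \<alpha> powr (t - 1)) * cut u (?L y z) \<partial>\<U>)"
    unfolding dil_def by (rule nn_integral_mono_AE)
  also have "\<dots> = ennreal ((1 - t) * \<alpha> powr t) * dil s (cut u) x + ennreal (t * \<alpha> powr (t - 1)) * dil s (cut u) y"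
    unfolding dil_def by (subst nn_integral_add) (simp_all add: nn_integral_cmult)
  finally show ?thesis .
qed

text \<open>The point with parameter \<open>s\<close> lies between the one with parameter
  \<open>r\<close> and \<open>z\<close>; convexity is integrated over \<open>z\<close>, where
  \<open>u\<close> has mean 1. This is the monotonicity of \<open>(dil s u - s) / (1 - s)\<close>
  written without subtraction.\<close>

lemma dil_le_convex_combination:
  assumes u: "u \<in> densities P" and s: "0 < r" "r < s" "s < 1" and x: "x \<in> P"
  shows "dil s (cut u) x \<le> ennreal ((1 - s) / (1 - r)) * dil r (cut u) x + ennreal ((s - r) / (1 - r))"
proof -
  note [measurable] = densities_measurable[OF u]
  define \<tau> where "\<tau> = (s - r) / (1 - r)"
  have \<tau>: "0 < \<tau>" "\<tau> < 1" "1 - \<tau> = (1 - s) / (1 - r)" using s by (auto simp: \<tau>_def field_simps)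
  have C: "convex_ennreal_on P u"
    using u by (auto simp: densities_def lin_log_convex_on_imp_convex)
  have "AE z in \<U>. cut u ((1 - s) *\<^sub>R x + s *\<^sub>R z)
     \<le> ennreal (1 - \<tau>) * cut u ((1 - r) *\<^sub>R x + r *\<^sub>R z) + ennreal \<tau> * cut u z"
    using AE_U
  proof eventually_elim
    case (elim z)
    have z: "z \<in> P" using elim interior_subset by blast
    have P: "(1 - s) *\<^sub>R x + s *\<^sub>R z \<in> P" "(1 - r) *\<^sub>R x + r *\<^sub>R z \<in> P"
      using segment_in_P[OF x elim] s by auto
    have e: "(1 - \<tau>) * (1 - r) = 1 - s"
      unfolding \<tau>(3) using s by simp
    have "(1 - \<tau>) *\<^sub>R ((1 - r) *\<^sub>R x + r *\<^sub>R z) + \<tau> *\<^sub>R z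
        = ((1 - \<tau>) * (1 - r)) *\<^sub>R x + (1 - (1 - \<tau>) * (1 - r)) *\<^sub>R z"
      by (simp add: algebra_simps)
    then have "(1 - s) *\<^sub>R x + s *\<^sub>R z = (1 - \<tau>) *\<^sub>R ((1 - r) *\<^sub>R x + r *\<^sub>R z) + \<tau> *\<^sub>R z"
      unfolding e by simp
    then show ?case
      using C[unfolded convex_ennreal_on_def, rule_format, OF P(2) z, of \<tau>] \<tau> P z by simp
  qed
  then have "dil s (cut u) x
     \<le> (\<integral>\<^sup>+z. ennreal (1 - \<tau>) * cut u ((1 - r) *\<^sub>R x + r *\<^sub>R z) + ennreal \<tau> * cut u z \<partial>\<U>)"
    unfolding dil_def by (rule nn_integral_mono_AE)
  also have "\<dots> = ennreal (1 - \<tau>) * dil r (cut u) x + ennreal \<tau>"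
    unfolding dil_def using densities_average[OF u]
    by (subst nn_integral_add) (simp_all add: nn_integral_cmult)
  finally show ?thesis by (simp only: \<tau>(3)) (simp only: \<tau>_def)
qed

text \<open>The analogue of the preceding estimate at \<open>r = 0\<close>, with \<open>u x\<close>
  in place of an average. It holds at every point of \<open>P\<close> and can therefore be
  integrated over the boundary.\<close>

lemma dil_le:
  assumes u: "u \<in> densities P" and s: "0 < s" "s < 1" and x: "x \<in> P"
  shows "dil s (cut u) x \<le> ennreal (1 - s) * u x + ennreal s"
proof -
  note [measurable] = densities_measurable[OF u]
  have C: "convex_ennreal_on P u"
    using u by (auto simp: densities_def lin_log_convex_on_imp_convex)
  have "AE z in \<U>. cut u ((1 - s) *\<^sub>R x + s *\<^sub>R z) \<le> ennreal (1 - s) * u x + ennreal s * cut u z"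
    using AE_U
  proof eventually_elim
    case (elim z)
    have "z \<in> P" using elim interior_subset by blast
    then show ?case
      using C[unfolded convex_ennreal_on_def, rule_format, OF x, of z s] s segment_in_P[OF x elim, of s] by simp
  qed
  then have "dil s (cut u) x \<le> (\<integral>\<^sup>+z. ennreal (1 - s) * u x + ennreal s * cut u z \<partial>\<U>)"
    unfolding dil_def by (rule nn_integral_mono_AE)
  also have "\<dots> = ennreal (1 - s) * u x + ennreal s"
    using densities_average[OF u] prob_space_U
    by (subst nn_integral_add) (simp_all add: nn_integral_cmult)
  finally show ?thesis .
qed

text \<open>Lower semicontinuity is applied for each \<open>z\<close> and integrated by Fatou's
  lemma. The estimate is pointwise, so boundary values of \<open>u\<close> are recovered from
  averages.\<close>

lemma le_liminf_dil:
  assumes u: "u \<in> densities P" and x: "x \<in> P"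
    and s: "\<And>j. 0 < s j" "\<And>j. s j < 1" "s \<longlonglongrightarrow> (0::real)"
  shows "u x \<le> liminf (\<lambda>j. dil (s j) (cut u) x)"
proof -
  note [measurable] = densities_measurable[OF u]
  have "u x = (\<integral>\<^sup>+z. u x \<partial>\<U>)" using prob_space_U by simp
  also have "\<dots> \<le> (\<integral>\<^sup>+z. liminf (\<lambda>j. cut u ((1 - s j) *\<^sub>R x + s j *\<^sub>R z)) \<partial>\<U>)"
  proof (rule nn_integral_mono_AE, use AE_U in eventually_elim)
    case (elim z)
    have P: "(1 - s j) *\<^sub>R x + s j *\<^sub>R z \<in> P" for j
      using segment_in_P[OF x elim, of "s j"] s(1,2)[of j] by simp
    have "(\<lambda>j. (1 - s j) *\<^sub>R x + s j *\<^sub>R z) \<longlonglongrightarrow> (1 - 0) *\<^sub>R x + 0 *\<^sub>R z"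
      by (intro tendsto_intros s)
    then have "u x \<le> liminf (\<lambda>j. u ((1 - s j) *\<^sub>R x + s j *\<^sub>R z))"
      using u x P by (intro lsc_on_seqD[of P]) (auto simp: densities_def)
    then show ?case by (simp add: P)
  qed
  also have "\<dots> \<le> liminf (\<lambda>j. dil (s j) (cut u) x)"
    unfolding dil_def by (rule nn_integral_liminf) measurable
  finally show ?thesis .
qed

text \<open>No mass is lost when averages shrink: after exchanging the integrals and substituting,
  the integrand becomes \<open>f y\<close> times an indicator that is eventually 1 for interior
  \<open>y\<close>, and Fatou's lemma applies.\<close>

lemma nn_integral_dil_ge:
  assumes [measurable]: "f \<in> borel_measurable borel"
    and s: "\<And>j. 0 < s j" "\<And>j. s j < 1" "s \<longlonglongrightarrow> (0::real)"
  shows "(\<integral>\<^sup>+y\<in>P. f y \<partial>lborel) \<le> liminf (\<lambda>j. \<integral>\<^sup>+x. dil (s j) f x * indicator P x \<partial>lborel)"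
proof -
  interpret U: finite_measure \<U> using prob_space_U by (intro finite_measureI) simp
  interpret pair_sigma_finite lborel \<U> ..
  \<comment> \<open>\<open>?c s z y\<close> is the solution \<open>x\<close> of
    \<open>(1 - s) x + s z = y\<close>; it tends to \<open>y\<close> as \<open>s\<close> tends to
    0.\<close>
  let ?c = "\<lambda>s z y. (1 / (1 - s)) *\<^sub>R (y - s *\<^sub>R z)"
  let ?F = "\<lambda>j y. \<integral>\<^sup>+z. f y * indicator P (?c (s j) z y) \<partial>\<U>"
  have "(\<integral>\<^sup>+y\<in>P. f y \<partial>lborel) = (\<integral>\<^sup>+y. f y * indicator Q y \<partial>lborel)" by (rule nn_integral_Q[symmetric])
  also have "\<dots> \<le> (\<integral>\<^sup>+y. liminf (\<lambda>j. ?F j y) \<partial>lborel)"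
  proof (rule nn_integral_mono)
    fix y
    have "f y * indicator Q y = (\<integral>\<^sup>+z. f y * indicator Q y \<partial>\<U>)" using prob_space_U by simp
    also have "\<dots> \<le> (\<integral>\<^sup>+z. liminf (\<lambda>j. f y * indicator P (?c (s j) z y)) \<partial>\<U>)"
    proof (rule nn_integral_mono)
      fix z
      show "f y * indicator Q y \<le> liminf (\<lambda>j. f y * indicator P (?c (s j) z y))"
      proof (cases "y \<in> Q")
        case True
        have "(\<lambda>j. ?c (s j) z y) \<longlonglongrightarrow> (1 / (1 - 0)) *\<^sub>R (y - 0 *\<^sub>R z)" by (intro tendsto_intros s) simp
        then have "(\<lambda>j. ?c (s j) z y) \<longlonglongrightarrow> y" by simp
        from topological_tendstoD[OF this open_interior True]
        have "\<forall>\<^sub>F j in sequentially. ?c (s j) z y \<in> P"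
          by eventually_elim (use interior_subset in blast)
        then show ?thesis by (intro Liminf_bounded) (auto elim!: eventually_mono simp: True)
      qed simp
    qed
    also have "\<dots> \<le> liminf (\<lambda>j. ?F j y)" by (rule nn_integral_liminf) measurable
    finally show "f y * indicator Q y \<le> liminf (\<lambda>j. ?F j y)" .
  qed
  also have "\<dots> \<le> liminf (\<lambda>j. \<integral>\<^sup>+y. ?F j y \<partial>lborel)"
    by (rule nn_integral_liminf) measurable
  also have "\<dots> \<le> liminf (\<lambda>j. \<integral>\<^sup>+x. dil (s j) f x * indicator P x \<partial>lborel)"
  proof (intro Liminf_mono always_eventually allI)
    fix j
    have "(\<integral>\<^sup>+y. ?F j y \<partial>lborel) = (\<integral>\<^sup>+z. \<integral>\<^sup>+y. f y * indicator P (?c (s j) z y) \<partial>lborel \<partial>\<U>)"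
      by (rule Fubini'[symmetric]) measurable
    also have "\<dots> \<le> (\<integral>\<^sup>+z. \<integral>\<^sup>+x. f ((1 - s j) *\<^sub>R x + s j *\<^sub>R z) * indicator P x \<partial>lborel \<partial>\<U>)"
    proof (rule nn_integral_mono)
      fix z
      let ?h = "\<lambda>y. f y * indicator P (?c (s j) z y)"
      have s1: "1 - s j > 0" "1 - s j \<le> 1" using s(1,2)[of j] by auto
      have "(\<integral>\<^sup>+x\<in>P. f ((1 - s j) *\<^sub>R x + s j *\<^sub>R z) \<partial>lborel)
          = (\<integral>\<^sup>+x. ?h (s j *\<^sub>R z + (1 - s j) *\<^sub>R x) \<partial>lborel)"
        using s1 by (simp add: add.commute)
      also have "\<dots> = ennreal (1 / (1 - s j) ^ DIM('a)) * (\<integral>\<^sup>+y. ?h y \<partial>lborel)"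
        by (rule nn_integral_lborel_affine[OF _ s1(1)]) measurable
      also have "\<dots> \<ge> 1 * (\<integral>\<^sup>+y. ?h y \<partial>lborel)"
      proof (rule mult_right_mono)
        have "(1 - s j) ^ DIM('a) \<le> 1" using s1 by (simp add: power_le_one)
        then show "1 \<le> ennreal (1 / (1 - s j) ^ DIM('a))" using s1 by simp
      qed simp
      finally show "(\<integral>\<^sup>+y. ?h y \<partial>lborel) \<le> (\<integral>\<^sup>+x\<in>P. f ((1 - s j) *\<^sub>R x + s j *\<^sub>R z) \<partial>lborel)" by simp
    qed
    also have "\<dots> = (\<integral>\<^sup>+x. \<integral>\<^sup>+z. f ((1 - s j) *\<^sub>R x + s j *\<^sub>R z) * indicator P x \<partial>\<U> \<partial>lborel)"
      by (rule Fubini') measurable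
    also have "\<dots> = (\<integral>\<^sup>+x\<in>P. dil (s j) f x \<partial>lborel)"
      unfolding dil_def by (intro nn_integral_cong nn_integral_multc) measurable
    finally show "(\<integral>\<^sup>+y. ?F j y \<partial>lborel) \<le> (\<integral>\<^sup>+x\<in>P. dil (s j) f x \<partial>lborel)" .
  qed
  finally show ?thesis .
qed

end

section \<open>Closedness of the densities in the mean\<close>

definition L1d :: "'a::euclidean_space set \<Rightarrow> ('a \<Rightarrow> ennreal) \<Rightarrow> ('a \<Rightarrow> ennreal) \<Rightarrow> ennreal" where
  "L1d P u v = (\<integral>\<^sup>+x\<in>P. ediff (u x) (v x) \<partial>lborel)"

lemma lsc_on_minus_const:
  assumes "lsc_on P d" "c < \<infinity>"
  shows "lsc_on P (\<lambda>x. d x - c)"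
  unfolding lsc_on_def
proof (intro ballI allI impI)
  fix x a assume x: "x \<in> P" "a < d x - c"
  have eq: "a < y - c \<longleftrightarrow> c + a < y" for y
    using assms(2) by (auto simp: not_le[symmetric] ennreal_minus_le_iff)
  show "\<forall>\<^sub>F y in at x within P. a < d y - c"
    using assms(1) x unfolding lsc_on_def eq by blast
qed

context convex_body
begin

lemma L1d_eq: "L1d P u v = (\<integral>\<^sup>+x. ediff (cut u x) (cut v x) \<partial>lborel)"
  unfolding L1d_def by (intro nn_integral_cong) (auto simp: ediff_def split: split_indicator)

lemma dil_measurable [measurable]:
  assumes [measurable]: "f \<in> borel_measurable borel"
  shows "dil s f \<in> borel_measurable borel"
proof -
  interpret U: finite_measure \<U> using prob_space_U by (intro finite_measureI) simp
  show ?thesis unfolding dil_def[abs_def] by measurable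
qed

lemma dil_tendsto:
  assumes [measurable]: "\<And>k. f k \<in> borel_measurable borel" "h \<in> borel_measurable borel" and s: "s > 0"
    and lim: "(\<lambda>k. \<integral>\<^sup>+y. ediff (f k y) (h y) \<partial>lborel) \<longlonglongrightarrow> 0"
  shows "(\<lambda>k. dil s (f k) x) \<longlonglongrightarrow> dil s h x"
proof (rule tendsto_ennreal_sandwich)
  show "(\<lambda>k. K s * (\<integral>\<^sup>+y. ediff (f k y) (h y) \<partial>lborel)) \<longlonglongrightarrow> 0"
    using ennreal_tendsto_cmult[OF K_finite[unfolded infinity_ennreal_def] lim, of s] by simp
  show "dil s (f k) x \<le> dil s h x + K s * (\<integral>\<^sup>+y. ediff (f k y) (h y) \<partial>lborel)" for k
    by (rule dil_le_add_ediff[OF _ _ s]) measurable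
  show "dil s h x \<le> dil s (f k) x + K s * (\<integral>\<^sup>+y. ediff (f k y) (h y) \<partial>lborel)" for k
    using dil_le_add_ediff[of h "f k" s x] s by (simp add: ediff_commute)
qed

lemma AE_densities_finite:
  assumes u: "u \<in> densities P"
  shows "AE x in lborel. cut u x < \<infinity>"
proof -
  note [measurable] = densities_measurable[OF u]
  have "(\<integral>\<^sup>+x. cut u x \<partial>lborel) \<noteq> \<infinity>"
    using u emeasure_P_finite by (auto simp: densities_def)
  then have "AE x in lborel. cut u x \<noteq> \<infinity>" by (intro nn_integral_PInf_AE) simp_all
  then show ?thesis by (simp add: less_top)
qed

text \<open>Completeness of the space of integrable functions, with an almost everywhere convergent
  subsequence. The limit \<open>w\<close> is a mere measurable representative, with no
  semicontinuity and no meaningful boundary values yet.\<close>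

lemma densities_L1_limit:
  fixes u :: "nat \<Rightarrow> 'a \<Rightarrow> ennreal"
  assumes u: "\<And>k. u k \<in> densities P"
    and Cauchy: "\<And>e. e > 0 \<Longrightarrow> \<exists>N. \<forall>i\<ge>N. \<forall>j\<ge>N. L1d P (u i) (u j) \<le> ennreal e"
  obtains w r where "w \<in> borel_measurable borel" "strict_mono r"
    "AE x in lborel. (\<lambda>i. cut (u (r i)) x) \<longlonglongrightarrow> w x" "AE x in lborel. w x < \<infinity>"
    "(\<lambda>k. \<integral>\<^sup>+x. ediff (cut (u k) x) (w x) \<partial>lborel) \<longlonglongrightarrow> 0"
proof -
  note [measurable] = densities_measurable[OF u]
  define f where "f k x = enn2real (cut (u k) x)" for k x
  have [measurable]: "f k \<in> borel_measurable borel" for k unfolding f_def[abs_def] by measurable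
  have fin: "AE x in lborel. \<forall>k. cut (u k) x < \<infinity>"
    using AE_densities_finite[OF u] by (simp add: AE_all_countable)
  have int: "integrable lborel (f k)" for k
  proof (rule integrableI_bounded)
    have "(\<integral>\<^sup>+x. ennreal (norm (f k x)) \<partial>lborel) \<le> (\<integral>\<^sup>+x. cut (u k) x \<partial>lborel)"
      by (intro nn_integral_mono) (auto simp: f_def ennreal_enn2real_if)
    also have "\<dots> < \<infinity>" using u[of k] emeasure_P_finite by (auto simp: densities_def)
    finally show "(\<integral>\<^sup>+x. ennreal (norm (f k x)) \<partial>lborel) < \<infinity>" .
  qed simp
  have L: "L1d P (u i) (u j) = ennreal (LINT x|lborel. norm (f i x - f j x))" for i j
  proof -
    have "L1d P (u i) (u j) = (\<integral>\<^sup>+x. ennreal (norm (f i x - f j x)) \<partial>lborel)"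
      unfolding L1d_eq using fin
      by (intro nn_integral_cong_AE) (auto elim!: eventually_mono simp: f_def ediff_def less_top)
    also have "\<dots> = ennreal (LINT x|lborel. norm (f i x - f j x))"
      by (rule nn_integral_eq_integral) (auto intro!: integrable_norm Bochner_Integration.integrable_diff int)
    finally show ?thesis .
  qed
  have C: "\<exists>N. \<forall>i\<ge>N. \<forall>j\<ge>N. LINT x|lborel. norm (f i x - f j x) < e" if e: "e > 0" for e
  proof -
    obtain N where N: "\<forall>i\<ge>N. \<forall>j\<ge>N. L1d P (u i) (u j) \<le> ennreal (e / 2)" using Cauchy[of "e/2"] e by auto
    have "LINT x|lborel. norm (f i x - f j x) < e" if "i \<ge> N" "j \<ge> N" for i j
    proof -
      have "LINT x|lborel. norm (f i x - f j x) \<le> e / 2"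
        using N that e by (simp add: L)
      then show ?thesis using e by simp
    qed
    then show ?thesis by blast
  qed
  obtain r where r: "strict_mono r" "AE x in lborel. Cauchy (\<lambda>i. f (r i) x)"
    using cauchy_L1_AE_cauchy_subseq[OF int C] by blast
  define w where "w x = ennreal (lim (\<lambda>i. f (r i) x))" for x
  have wm[measurable]: "w \<in> borel_measurable borel" unfolding w_def[abs_def] by measurable
  have lim: "AE x in lborel. (\<lambda>i. f (r i) x) \<longlonglongrightarrow> lim (\<lambda>i. f (r i) x)"
    using r(2) by eventually_elim (simp add: Cauchy_convergent_iff convergent_LIMSEQ_iff)
  have conv: "AE x in lborel. (\<lambda>i. cut (u (r i)) x) \<longlonglongrightarrow> w x"
    using lim fin
  proof eventually_elim
    case (elim x)
    have "(\<lambda>i. ennreal (f (r i) x)) \<longlonglongrightarrow> w x" unfolding w_def using elim(1) by (rule tendsto_ennrealI)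
    moreover have "ennreal (f (r i) x) = cut (u (r i)) x" for i
      using elim(2) unfolding f_def by (simp add: less_top)
    ultimately show ?case by simp
  qed
  \<comment> \<open>Fatou's lemma along the subsequence carries the Cauchy estimate to the limit, so
    the full sequence converges.\<close>
  have ed: "(\<integral>\<^sup>+x. ediff (cut (u k) x) (w x) \<partial>lborel) \<le> ennreal e"
    if e: "\<forall>i\<ge>N. \<forall>j\<ge>N. L1d P (u i) (u j) \<le> ennreal e" and k: "k \<ge> N" for e k N
  proof -
    have "AE x in lborel. ediff (cut (u k) x) (w x) \<le> liminf (\<lambda>i. ediff (cut (u k) x) (cut (u (r i)) x))"
      using lim fin
    proof eventually_elim
      case (elim x)
      have nn: "lim (\<lambda>i. f (r i) x) \<ge> 0" using elim(1) by (rule LIMSEQ_le_const) (auto simp: f_def)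
      have "(\<lambda>i. ennreal \<bar>f k x - f (r i) x\<bar>) \<longlonglongrightarrow> ennreal \<bar>f k x - lim (\<lambda>i. f (r i) x)\<bar>"
        by (intro tendsto_ennrealI tendsto_intros elim(1))
      moreover have "ennreal \<bar>f k x - f (r i) x\<bar> = ediff (cut (u k) x) (cut (u (r i)) x)" for i
        using elim(2) by (simp add: ediff_def f_def less_top)
      moreover have "ennreal \<bar>f k x - lim (\<lambda>i. f (r i) x)\<bar> = ediff (cut (u k) x) (w x)"
        using elim(2) nn by (simp add: ediff_def f_def w_def less_top)
      ultimately have "(\<lambda>i. ediff (cut (u k) x) (cut (u (r i)) x)) \<longlonglongrightarrow> ediff (cut (u k) x) (w x)" by simp
      then show ?case by (simp add: lim_imp_Liminf)
    qed
    then have "(\<integral>\<^sup>+x. ediff (cut (u k) x) (w x) \<partial>lborel)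
        \<le> (\<integral>\<^sup>+x. liminf (\<lambda>i. ediff (cut (u k) x) (cut (u (r i)) x)) \<partial>lborel)"
      by (rule nn_integral_mono_AE)
    also have "\<dots> \<le> liminf (\<lambda>i. L1d P (u k) (u (r i)))"
      unfolding L1d_eq by (rule nn_integral_liminf) measurable
    also have "\<dots> \<le> ennreal e"
    proof (rule Liminf_le)
      show "\<forall>\<^sub>F i in sequentially. L1d P (u k) (u (r i)) \<le> ennreal e"
        using eventually_ge_at_top[of N]
        by eventually_elim (use e k r(1) seq_suble le_trans in blast)
    qed simp
    finally show ?thesis .
  qed
  have "(\<lambda>k. \<integral>\<^sup>+x. ediff (cut (u k) x) (w x) \<partial>lborel) \<longlonglongrightarrow> 0"
  proof (rule order_tendstoI)
    fix a :: ennreal assume "0 < a"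
    then obtain c where c: "0 < c" "c < a" using dense by blast
    then obtain e where e: "0 < e" "ennreal e < a" by (cases c) auto
    obtain N where "\<forall>i\<ge>N. \<forall>j\<ge>N. L1d P (u i) (u j) \<le> ennreal e" using Cauchy e by blast
    from ed[OF this] show "\<forall>\<^sub>F k in sequentially. (\<integral>\<^sup>+x. ediff (cut (u k) x) (w x) \<partial>lborel) < a"
      unfolding eventually_sequentially using e(2) by (meson le_less_trans)
  qed simp
  then show ?thesis
    using that[OF wm r(1) conv] by (simp add: w_def)
qed

text \<open>The correct representative of the limit is the supremum \<open>W\<close> of the
  normalized averages of \<open>w\<close>. As a supremum it is lower semicontinuous; it inherits the
  linear inequalities because averages of \<open>u k\<close> converge everywhere. The bound
  \<open>dil_le\<close> gives \<open>W \<le> w\<close> almost everywhere,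
  \<open>nn_integral_dil_ge\<close> gives the reverse inequality of integrals, and so the two agree
  almost everywhere.\<close>

lemma densities_complete:
  fixes u :: "nat \<Rightarrow> 'a \<Rightarrow> ennreal"
  assumes u: "\<And>k. u k \<in> densities P"
    and Cauchy: "\<And>e. e > 0 \<Longrightarrow> \<exists>N. \<forall>i\<ge>N. \<forall>j\<ge>N. L1d P (u i) (u j) \<le> ennreal e"
  obtains W where "W \<in> densities P" "(\<lambda>k. L1d P (u k) W) \<longlonglongrightarrow> 0"
proof -
  note [measurable] = densities_measurable[OF u]
  obtain w r where wm[measurable]: "w \<in> borel_measurable borel" and r: "strict_mono r"
    and conv: "AE x in lborel. (\<lambda>i. cut (u (r i)) x) \<longlonglongrightarrow> w x" and wfin: "AE x in lborel. w x < \<infinity>"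
    and D: "(\<lambda>k. \<integral>\<^sup>+x. ediff (cut (u k) x) (w x) \<partial>lborel) \<longlonglongrightarrow> 0"
    using densities_L1_limit[OF u Cauchy] by blast
  have dl: "(\<lambda>k. dil s (cut (u k)) x) \<longlonglongrightarrow> dil s w x" if "s > 0" for s x
    by (rule dil_tendsto[OF _ _ that D]) measurable
  have int_w: "(\<integral>\<^sup>+x\<in>P. w x \<partial>lborel) = emeasure lborel P"
  proof -
    let ?D = "\<lambda>k. \<integral>\<^sup>+x. ediff (cut (u k) x) (w x) \<partial>lborel"
    have wP: "AE x in lborel. w x * indicator P x = w x"
      using conv
    proof eventually_elim
      case (elim x)
      show ?case
      proof (cases "x \<in> P")
        case False
        then have "(\<lambda>i::nat. 0) \<longlonglongrightarrow> w x" using elim by simp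
        then have "w x = 0" by (simp add: LIMSEQ_const_iff)
        then show ?thesis by simp
      qed simp
    qed
    have I: "(\<integral>\<^sup>+x. cut (u k) x \<partial>lborel) = emeasure lborel P" for k
      using u[of k] by (simp add: densities_def)
    have "(\<lambda>k::nat. emeasure lborel P) \<longlonglongrightarrow> (\<integral>\<^sup>+x. w x \<partial>lborel)"
    proof (rule tendsto_ennreal_sandwich[OF D])
      fix k
      have "(\<integral>\<^sup>+x. cut (u k) x \<partial>lborel) \<le> (\<integral>\<^sup>+x. w x + ediff (cut (u k) x) (w x) \<partial>lborel)"
        by (intro nn_integral_mono le_add_ediff)
      then show "emeasure lborel P \<le> (\<integral>\<^sup>+x. w x \<partial>lborel) + ?D k"
        unfolding I by (subst (asm) nn_integral_add) auto
      have "(\<integral>\<^sup>+x. w x \<partial>lborel) \<le> (\<integral>\<^sup>+x. cut (u k) x + ediff (w x) (cut (u k) x) \<partial>lborel)"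
        by (intro nn_integral_mono le_add_ediff)
      then show "(\<integral>\<^sup>+x. w x \<partial>lborel) \<le> emeasure lborel P + ?D k"
        by (subst (asm) nn_integral_add) (auto simp: I ediff_commute)
    qed
    moreover have "(\<integral>\<^sup>+x\<in>P. w x \<partial>lborel) = (\<integral>\<^sup>+x. w x \<partial>lborel)"
      using wP by (intro nn_integral_cong_AE) simp
    ultimately show ?thesis by (simp add: LIMSEQ_const_iff)
  qed
  \<comment> \<open>The shift by 2 keeps every ratio strictly between 0 and 1, as the averaging
    lemmas demand.\<close>
  define s :: "nat \<Rightarrow> real" where "s j = 1 / (real j + 2)" for j
  have s: "0 < s j" "s j < 1" for j by (auto simp: s_def field_simps)
  have s0: "s \<longlonglongrightarrow> 0" unfolding s_def by real_asymp
  have smono: "s j < s i" if "i < j" for i j using that by (simp add: s_def frac_less2)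
  \<comment> \<open>The subtraction is truncated; \<open>b1\<close> and \<open>b2\<close> express
    everything needed about it by additive inequalities.\<close>
  define b where "b j x = ennreal (1 / (1 - s j)) * (dil (s j) w x - ennreal (s j))" for j x
  have mult1: "ennreal (1 - s j) * (ennreal (1 / (1 - s j)) * y) = y" for j y
    using s[of j] by (simp add: mult.assoc[symmetric] ennreal_mult[symmetric])
  have mult2: "ennreal (1 / (1 - s j)) * (ennreal (1 - s j) * y) = y" for j y
    using s[of j] by (simp add: mult.assoc[symmetric] ennreal_mult[symmetric])
  have b1: "dil (s j) w x \<le> ennreal (1 - s j) * b j x + ennreal (s j)" for j x
  proof -
    have "ennreal (1 - s j) * b j x = dil (s j) w x - ennreal (s j)" unfolding b_def mult1 ..
    moreover have "dil (s j) w x \<le> (dil (s j) w x - ennreal (s j)) + ennreal (s j)"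
      by (metis add.commute ennreal_minus_le_iff order_refl)
    ultimately show ?thesis by simp
  qed
  have b2: "b j x \<le> y" if "dil (s j) w x \<le> ennreal (1 - s j) * y + ennreal (s j)" for j x y
  proof -
    have "dil (s j) w x - ennreal (s j) \<le> ennreal (1 - s j) * y"
      using that by (simp add: ennreal_minus_le_iff add.commute)
    then have "b j x \<le> ennreal (1 / (1 - s j)) * (ennreal (1 - s j) * y)"
      unfolding b_def by (rule mult_left_mono) simp
    then show ?thesis unfolding mult2 .
  qed
  have b3: "ennreal (1 - s j) * b j x \<le> dil (s j) w x" for j x
    unfolding b_def mult1 by (simp add: diff_le_self_ennreal)
  \<comment> \<open>Monotonicity is known for averages of the densities \<open>u k\<close> and
    passes to those of \<open>w\<close>, which is not yet known to be convex.\<close>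
  have bmono: "b i x \<le> b j x" if "i \<le> j" "x \<in> P" for i j x
  proof (cases "i = j")
    case False
    then have ij: "s j < s i" using smono that by simp
    have "dil (s i) w x \<le> ennreal ((1 - s i) / (1 - s j)) * dil (s j) w x + ennreal ((s i - s j) / (1 - s j))"
    proof (rule LIMSEQ_le[OF dl[OF s(1)]])
      show "(\<lambda>k. ennreal ((1 - s i) / (1 - s j)) * dil (s j) (cut (u k)) x + ennreal ((s i - s j) / (1 - s j)))
        \<longlonglongrightarrow> ennreal ((1 - s i) / (1 - s j)) * dil (s j) w x + ennreal ((s i - s j) / (1 - s j))"
        by (intro tendsto_add ennreal_tendsto_cmult dl s tendsto_const) simp
      show "\<exists>N. \<forall>k\<ge>N. dil (s i) (cut (u k)) x
         \<le> ennreal ((1 - s i) / (1 - s j)) * dil (s j) (cut (u k)) x + ennreal ((s i - s j) / (1 - s j))"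
        using dil_le_convex_combination[OF u s(1) ij s(2) that(2)] by blast
    qed
    also have "\<dots> \<le> ennreal ((1 - s i) / (1 - s j)) * (ennreal (1 - s j) * b j x + ennreal (s j)) + ennreal ((s i - s j) / (1 - s j))"
      by (intro add_mono mult_left_mono b1) auto
    also have "\<dots> = ennreal (1 - s i) * b j x + ennreal (s i)"
    proof -
      have "ennreal ((1 - s i) / (1 - s j)) * (ennreal (1 - s j) * b j x) = ennreal (1 - s i) * b j x"
        using s[of i] s[of j] by (simp add: mult.assoc[symmetric] ennreal_mult[symmetric])
      moreover have "ennreal ((1 - s i) / (1 - s j)) * ennreal (s j) + ennreal ((s i - s j) / (1 - s j)) = ennreal (s i)"
      proof -
        have "(1 - s i) / (1 - s j) * s j + (s i - s j) / (1 - s j) = ((1 - s i) * s j + (s i - s j)) / (1 - s j)"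
          by (simp add: add_divide_distrib)
        also have "(1 - s i) * s j + (s i - s j) = s i * (1 - s j)" by (simp add: algebra_simps)
        also have "\<dots> / (1 - s j) = s i" using s[of j] by simp
        finally show ?thesis using s[of i] s[of j] ij
          by (simp add: ennreal_mult[symmetric] ennreal_plus[symmetric] del: ennreal_plus)
      qed
      ultimately show ?thesis by (simp add: distrib_left add.assoc)
    qed
    finally show ?thesis by (rule b2)
  qed simp
  define W where "W x = (SUP j. b j x)" for x
  have bW: "b j x \<le> W x" for j x unfolding W_def by (rule SUP_upper) simp
  have dW: "dil (s j) w x \<le> W x + ennreal (s j)" for j x
  proof -
    have "ennreal (1 - s j) * b j x \<le> 1 * W x" by (intro mult_mono bW) (use s[of j] in auto)
    then show ?thesis using b1[of j x] by (simp add: add_right_mono order_trans)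
  qed
  have lscW: "lsc_on P W"
    unfolding W_def b_def[abs_def]
    by (intro lsc_on_SUP lsc_on_cmult lsc_on_minus_const lsc_on_seqI dil_lsc s) auto
  note Wm[measurable] = lsc_on_measurable[OF lscW compact_imp_closed[OF compact_P]]
  have linW: "lin_log_convex_on P W"
    unfolding lin_log_convex_on_def
  proof (intro ballI allI impI)
    fix x y t \<alpha> assume xy: "x \<in> P" "y \<in> P" and t: "0 < t" "t < (1::real)" "0 < (\<alpha>::real)"
    let ?z = "(1 - t) *\<^sub>R x + t *\<^sub>R y" and ?p = "ennreal ((1 - t) * \<alpha> powr t)" and ?q = "ennreal (t * \<alpha> powr (t - 1))"
    have z: "?z \<in> P" using convex_P xy t by (auto intro!: convexD)
    have dz: "dil (s j) w ?z \<le> ?p * dil (s j) w x + ?q * dil (s j) w y" for j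
    proof (rule LIMSEQ_le[OF dl[OF s(1)]])
      show "(\<lambda>k. ?p * dil (s j) (cut (u k)) x + ?q * dil (s j) (cut (u k)) y) \<longlonglongrightarrow> ?p * dil (s j) w x + ?q * dil (s j) w y"
        by (intro tendsto_add ennreal_tendsto_cmult dl s) simp_all
    qed (use dil_lin_log_convex[OF u s xy t] in blast)
    \<comment> \<open>The index \<open>j\<close> of the averages is sent to infinity with
      \<open>i\<close> fixed, so that the factors \<open>1 - s j\<close> and the errors
      \<open>s j\<close> disappear.\<close>
    have "b i ?z \<le> ?p * W x + ?q * W y" for i
    proof (rule LIMSEQ_le)
      have "(\<lambda>j. ennreal (1 - s j)) \<longlonglongrightarrow> ennreal (1 - 0)" by (intro tendsto_intros s0)
      then show "(\<lambda>j. ennreal (1 - s j) * b i ?z) \<longlonglongrightarrow> b i ?z"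
        using tendsto_mult_ennreal[OF _ tendsto_const, of "\<lambda>j. ennreal (1 - s j)" 1 sequentially "b i ?z"] by simp
      have "(\<lambda>j. ennreal (s j)) \<longlonglongrightarrow> ennreal 0" by (intro tendsto_ennrealI s0)
      then have "(\<lambda>j. (?p + ?q) * ennreal (s j)) \<longlonglongrightarrow> (?p + ?q) * 0"
        by (intro ennreal_tendsto_cmult) simp_all
      from tendsto_add[OF tendsto_const this, of "?p * W x + ?q * W y"]
      show "(\<lambda>j. (?p * W x + ?q * W y) + (?p + ?q) * ennreal (s j)) \<longlonglongrightarrow> ?p * W x + ?q * W y" by simp
      show "\<exists>N. \<forall>j\<ge>N. ennreal (1 - s j) * b i ?z \<le> (?p * W x + ?q * W y) + (?p + ?q) * ennreal (s j)"
      proof (intro exI[of _ i] allI impI)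
        fix j assume "i \<le> j"
        then have "ennreal (1 - s j) * b i ?z \<le> ennreal (1 - s j) * b j ?z" using bmono[OF _ z] by (intro mult_left_mono) auto
        also have "\<dots> \<le> dil (s j) w ?z" by (rule b3)
        also have "\<dots> \<le> ?p * dil (s j) w x + ?q * dil (s j) w y" by (rule dz)
        also have "\<dots> \<le> ?p * (W x + ennreal (s j)) + ?q * (W y + ennreal (s j))"
          by (intro add_mono mult_left_mono dW) auto
        also have "\<dots> = (?p * W x + ?q * W y) + (?p + ?q) * ennreal (s j)" by (simp add: distrib_left distrib_right add_ac)
        finally show "ennreal (1 - s j) * b i ?z \<le> (?p * W x + ?q * W y) + (?p + ?q) * ennreal (s j)" .
      qed
    qed
    then show "W ?z \<le> ?p * W x + ?q * W y" unfolding W_def by (intro SUP_least) (simp add: W_def)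
  qed
  have Ww: "AE x in lborel. W x * indicator P x \<le> w x * indicator P x"
    using conv
  proof eventually_elim
    case (elim x)
    show ?case
    proof (cases "x \<in> P")
      case True
      have "b j x \<le> w x" for j
      proof (rule b2, rule LIMSEQ_le)
        show "(\<lambda>i. dil (s j) (cut (u (r i))) x) \<longlonglongrightarrow> dil (s j) w x"
          using LIMSEQ_subseq_LIMSEQ[OF dl[OF s(1)] r] by (simp add: o_def)
        show "(\<lambda>i. ennreal (1 - s j) * cut (u (r i)) x + ennreal (s j)) \<longlonglongrightarrow> ennreal (1 - s j) * w x + ennreal (s j)"
          by (intro tendsto_add ennreal_tendsto_cmult elim tendsto_const) simp
        show "\<exists>N. \<forall>i\<ge>N. dil (s j) (cut (u (r i))) x \<le> ennreal (1 - s j) * cut (u (r i)) x + ennreal (s j)"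
          using dil_le[OF u s True] True by simp
      qed
      then show ?thesis using True by (auto simp: W_def intro: SUP_least)
    qed simp
  qed
  have wW: "(\<integral>\<^sup>+x\<in>P. w x \<partial>lborel) \<le> (\<integral>\<^sup>+x\<in>P. W x \<partial>lborel)"
  proof -
    have "(\<integral>\<^sup>+x\<in>P. w x \<partial>lborel) \<le> liminf (\<lambda>j. \<integral>\<^sup>+x. dil (s j) w x * indicator P x \<partial>lborel)"
      by (rule nn_integral_dil_ge[OF wm s s0])
    also have "\<dots> \<le> liminf (\<lambda>j. (\<integral>\<^sup>+x\<in>P. W x \<partial>lborel) + emeasure lborel P * ennreal (s j))"
    proof (intro Liminf_mono always_eventually allI)
      fix j
      have "(\<integral>\<^sup>+x\<in>P. dil (s j) w x \<partial>lborel) \<le> (\<integral>\<^sup>+x. W x * indicator P x + ennreal (s j) * indicator P x \<partial>lborel)"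
        using dW by (intro nn_integral_mono) (auto split: split_indicator)
      also have "\<dots> = (\<integral>\<^sup>+x\<in>P. W x \<partial>lborel) + ennreal (s j) * emeasure lborel P"
        by (subst nn_integral_add) (auto simp: nn_integral_cmult_indicator)
      finally show "(\<integral>\<^sup>+x\<in>P. dil (s j) w x \<partial>lborel)
        \<le> (\<integral>\<^sup>+x\<in>P. W x \<partial>lborel) + emeasure lborel P * ennreal (s j)" by (simp add: mult.commute)
    qed
    also have "\<dots> = (\<integral>\<^sup>+x\<in>P. W x \<partial>lborel)"
    proof -
      have "(\<lambda>j. ennreal (s j)) \<longlonglongrightarrow> ennreal 0" by (intro tendsto_ennrealI s0)
      then have "(\<lambda>j. emeasure lborel P * ennreal (s j)) \<longlonglongrightarrow> emeasure lborel P * 0"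
        using emeasure_P_finite by (intro ennreal_tendsto_cmult) simp_all
      from tendsto_add[OF tendsto_const this, of "\<integral>\<^sup>+x\<in>P. W x \<partial>lborel"]
      show ?thesis by (simp add: lim_imp_Liminf)
    qed
    finally show ?thesis .
  qed
  have WP: "(\<integral>\<^sup>+x\<in>P. W x \<partial>lborel) = emeasure lborel P"
    using wW nn_integral_mono_AE[OF Ww] int_w by (intro antisym) auto
  \<comment> \<open>Together with the one-sided bound \<open>Ww\<close>, a failure on a set of
    positive measure would make the finite integrals differ.\<close>
  have Weq: "AE x in lborel. W x * indicator P x = w x * indicator P x"
  proof -
    have "AE x in lborel. w x * indicator P x \<le> W x * indicator P x"
    proof (rule ccontr)
      assume "\<not> ?thesis"
      then have "(\<integral>\<^sup>+x\<in>P. W x \<partial>lborel) < (\<integral>\<^sup>+x\<in>P. w x \<partial>lborel)"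
        using WP emeasure_P_finite by (intro nn_integral_less Ww) auto
      then show False using wW by simp
    qed
    with Ww show ?thesis by eventually_elim (rule antisym)
  qed
  \<comment> \<open>A zero of \<open>W\<close> spreads: letting \<open>\<alpha>\<close> tend to
    infinity leaves only a vanishing multiple of \<open>W y\<close>, so \<open>W\<close> vanishes on
    the open segment towards any \<open>y\<close> of finite value, and at \<open>y\<close> by lower
    semicontinuity. Then \<open>W\<close> would have no mass.\<close>
  have Wpos: "0 < W x" if x: "x \<in> P" for x
  proof (rule ccontr)
    assume "\<not> 0 < W x"
    then have Wx: "W x = 0" by simp
    have "W y = 0" if y: "y \<in> P" "W y < \<infinity>" for y
    proof -
      have *: "W ((1 - t) *\<^sub>R x + t *\<^sub>R y) = 0" if t: "0 < t" "t < 1" for t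
      proof -
        have "W ((1 - t) *\<^sub>R x + t *\<^sub>R y) \<le> ennreal (t * real (Suc n) powr (t - 1)) * W y" for n
          using lin_log_convex_onD[OF linW x y(1) t, of "real (Suc n)"] by (simp add: Wx)
        moreover have "(\<lambda>n. W y * ennreal (t * real (Suc n) powr (t - 1))) \<longlonglongrightarrow> W y * ennreal 0"
        proof (intro ennreal_tendsto_cmult tendsto_ennrealI)
          show "(\<lambda>n. t * real (Suc n) powr (t - 1)) \<longlonglongrightarrow> 0" using t by real_asymp
        qed (use y in simp)
        ultimately have "W ((1 - t) *\<^sub>R x + t *\<^sub>R y) \<le> W y * ennreal 0"
          by (intro LIMSEQ_le_const) (auto simp: mult.commute)
        then show ?thesis by simp
      qed
      define X where "X n = (1 - (1 - s n)) *\<^sub>R x + (1 - s n) *\<^sub>R y" for n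
      have "X \<longlonglongrightarrow> (1 - (1 - 0)) *\<^sub>R x + (1 - 0) *\<^sub>R y" unfolding X_def by (intro tendsto_intros s0)
      then have "X \<longlonglongrightarrow> y" by simp
      moreover have "X n \<in> P" for n unfolding X_def using convex_P x y s[of n] by (intro convexD) auto
      ultimately have "W y \<le> liminf (\<lambda>n. W (X n))" using lsc_on_seqD[OF lscW y(1)] by blast
      also have "(\<lambda>n. W (X n)) = (\<lambda>n. 0)" unfolding X_def using s *[of "1 - s _"] by (intro ext) simp
      finally show ?thesis by (simp add: Liminf_const)
    qed
    note W0 = this
    have "AE x in lborel. W x * indicator P x = 0"
      using Weq wfin
    proof eventually_elim
      case (elim x)
      then show ?case using W0[of x] by (cases "x \<in> P") auto
    qed
    then have "(\<integral>\<^sup>+x\<in>P. W x \<partial>lborel) = 0" by (simp add: nn_integral_0_iff_AE)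
    then show False using WP emeasure_P_pos by simp
  qed
  show ?thesis
  proof
    show "W \<in> densities P"
      using lscW linW WP Wpos by (simp add: densities_def)
    show "(\<lambda>k. L1d P (u k) W) \<longlonglongrightarrow> 0"
    proof -
      have "L1d P (u k) W \<le> (\<integral>\<^sup>+x. ediff (cut (u k) x) (w x) \<partial>lborel)" for k
        unfolding L1d_def using Weq
        by (intro nn_integral_mono_AE) (auto elim!: eventually_mono split: split_indicator_asm split_indicator)
      then show ?thesis by (intro tendsto_sandwich[OF _ _ tendsto_const D]) auto
    qed
  qed
qed

end

section \<open>The boundary energy\<close>

lemma liminf_sum_ennreal:
  fixes f :: "'i \<Rightarrow> nat \<Rightarrow> ennreal"
  shows "(\<Sum>i\<in>I. liminf (f i)) \<le> liminf (\<lambda>n. \<Sum>i\<in>I. f i n)"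
proof (induction I rule: infinite_finite_induct)
  case (insert i I)
  have "(\<Sum>i\<in>insert i I. liminf (f i)) \<le> liminf (f i) + liminf (\<lambda>n. \<Sum>i\<in>I. f i n)"
    using insert by (simp add: add_left_mono)
  also have "\<dots> \<le> liminf (\<lambda>n. f i n + (\<Sum>i\<in>I. f i n))" by (rule liminf_add_ennreal)
  finally show ?case using insert by simp
qed (simp_all add: Liminf_const)

locale polytope_system =
  fixes P :: "'a::euclidean_space set" and cmu :: real and csig :: "'a set \<Rightarrow> real"
    and g :: "'a set \<Rightarrow> 'b::euclidean_space \<Rightarrow> 'a"
  assumes sys: "is_system P cmu csig g" and dim2: "DIM('a) \<ge> 2"

sublocale polytope_system \<subseteq> convex_body P
  using sys by unfold_locales (auto simp: is_system_def simple_polytope_def polyhedron_imp_convex)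

context polytope_system
begin

lemma cmu_pos: "cmu > 0" and csig_pos: "F facet_of P \<Longrightarrow> csig F > 0"
  using sys by (auto simp: is_system_def)

lemma facet_in_P: "F facet_of P \<Longrightarrow> x \<in> F \<Longrightarrow> x \<in> P"
  using facet_of_imp_subset by blast

lemma facet_closed: "F facet_of P \<Longrightarrow> closed F"
  using convex_P compact_P by (meson compact_imp_closed face_of_imp_closed facet_of_imp_face_of)

lemma facet_borel [measurable]: "F facet_of P \<Longrightarrow> F \<in> sets borel"
  using facet_closed by simp

lemma facet_param:
  assumes "F facet_of P"
  obtains A b where "linear A" "inj A" "g F = (\<lambda>y. A y + b)"
  using sys assms unfolding is_system_def facet_params_def by blast

lemma facet_param_measurable [measurable]:
  assumes "F facet_of P"
  shows "g F \<in> borel_measurable borel"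
proof -
  obtain A b where A: "linear A" "g F = (\<lambda>y. A y + b)" using facet_param[OF assms] by blast
  show ?thesis unfolding A(2)
    by (intro borel_measurable_continuous_onI continuous_intros linear_continuous_on
        linear_conv_bounded_linear[THEN iffD1] A(1))
qed

lemma Mp_1_iff: "u \<in> Mp P cmu 1 \<longleftrightarrow> u \<in> densities P"
proof -
  have "mu_int P cmu u = mu_int P cmu (\<lambda>_. 1) \<longleftrightarrow> (\<integral>\<^sup>+x\<in>P. u x \<partial>lborel) = emeasure lborel P"
    using cmu_pos by (simp add: mu_int_def ennreal_mult_cancel_left)
  moreover have "epow x 1 = x" for x by (cases x) (auto simp: epow_def)
  then have "mu_int P cmu (\<lambda>x. epow (u x) 1) < \<infinity>"
    if "(\<integral>\<^sup>+x\<in>P. u x \<partial>lborel) = emeasure lborel P"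
    using that emeasure_P_finite by (simp add: mu_int_def ennreal_mult_less_top)
  moreover have "(\<forall>x\<in>P. u x > 0) \<Longrightarrow> log_convex_on P u \<longleftrightarrow> lin_log_convex_on P u"
    by (rule log_convex_on_iff_lin) auto
  ultimately show ?thesis unfolding Mp_def densities_def by auto
qed

abbreviation "\<sigma> f \<equiv> sigma_int P csig g f"

lemma sigma_mono:
  assumes le: "\<And>x. x \<in> P \<Longrightarrow> f x \<le> h x"
  shows "\<sigma> f \<le> \<sigma> h"
  unfolding sigma_int_def
proof (rule sum_mono, rule mult_left_mono, rule nn_integral_mono)
  fix F y assume "F \<in> {F. F facet_of P}"
  then show "indicator F (g F y) * f (g F y) \<le> indicator F (g F y) * h (g F y)"
    using facet_in_P[of F "g F y"] le by (cases "g F y \<in> F") auto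
qed simp

lemma facets_finite: "finite {F. F facet_of P}"
  using sys finite_polyhedron_facets by (auto simp: is_system_def simple_polytope_def)

lemma facet_integrand_measurable:
  assumes [measurable]: "cut f \<in> borel_measurable borel" and F: "F facet_of P"
  shows "(\<lambda>y. indicator F (g F y) * f (g F y)) \<in> borel_measurable borel"
proof -
  note [measurable] = facet_borel[OF F] facet_param_measurable[OF F]
  have "(\<lambda>y. indicator F (g F y) * f (g F y)) = (\<lambda>y. indicator F (g F y) * cut f (g F y))"
    using F by (auto simp: fun_eq_iff indicator_def facet_in_P)
  also have "\<dots> \<in> borel_measurable borel"
    using measurable_compose[OF facet_param_measurable[OF F] assms(1)] by measurable
  finally show ?thesis .
qed

lemma sigma_lincomb:
  assumes "cut f \<in> borel_measurable borel" "cut h \<in> borel_measurable borel"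
  shows "\<sigma> (\<lambda>x. a * f x + b * h x) = a * \<sigma> f + b * \<sigma> h"
proof -
  have "(\<integral>\<^sup>+y. indicator F (g F y) * (a * f (g F y) + b * h (g F y)) \<partial>lborel)
    = a * (\<integral>\<^sup>+y. indicator F (g F y) * f (g F y) \<partial>lborel) + b * (\<integral>\<^sup>+y. indicator F (g F y) * h (g F y) \<partial>lborel)"
    if F: "F facet_of P" for F
  proof -
    note [measurable] = facet_integrand_measurable[OF assms(1) F] facet_integrand_measurable[OF assms(2) F]
    have "(\<integral>\<^sup>+y. indicator F (g F y) * (a * f (g F y) + b * h (g F y)) \<partial>lborel)
      = (\<integral>\<^sup>+y. a * (indicator F (g F y) * f (g F y)) + b * (indicator F (g F y) * h (g F y)) \<partial>lborel)"
      by (intro nn_integral_cong) (simp add: distrib_left mult_ac)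
    then show ?thesis by (subst (asm) nn_integral_add) (simp_all add: nn_integral_cmult)
  qed
  then show ?thesis
    unfolding sigma_int_def by (simp add: distrib_left sum.distrib sum_distrib_left mult_ac)
qed

lemma sigma_liminf:
  assumes "\<And>j. cut (f j) \<in> borel_measurable borel"
  shows "\<sigma> (\<lambda>x. liminf (\<lambda>j. f j x)) \<le> liminf (\<lambda>j. \<sigma> (f j))"
proof -
  have "\<sigma> (\<lambda>x. liminf (\<lambda>j. f j x))
    \<le> (\<Sum>F\<in>{F. F facet_of P}. liminf (\<lambda>j. ennreal (csig F) * (\<integral>\<^sup>+y. indicator F (g F y) * f j (g F y) \<partial>lborel)))"
    unfolding sigma_int_def
  proof (rule sum_mono)
    fix F assume "F \<in> {F. F facet_of P}"
    then have F: "F facet_of P" by simp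
    have "(\<integral>\<^sup>+y. indicator F (g F y) * liminf (\<lambda>j. f j (g F y)) \<partial>lborel)
      \<le> (\<integral>\<^sup>+y. liminf (\<lambda>j. indicator F (g F y) * f j (g F y)) \<partial>lborel)"
      by (intro nn_integral_mono liminf_cmult_ennreal_le)
    also have "\<dots> \<le> liminf (\<lambda>j. \<integral>\<^sup>+y. indicator F (g F y) * f j (g F y) \<partial>lborel)"
      by (rule nn_integral_liminf) (use facet_integrand_measurable[OF assms F] in simp)
    finally have "ennreal (csig F) * (\<integral>\<^sup>+y. indicator F (g F y) * liminf (\<lambda>j. f j (g F y)) \<partial>lborel)
      \<le> ennreal (csig F) * liminf (\<lambda>j. \<integral>\<^sup>+y. indicator F (g F y) * f j (g F y) \<partial>lborel)"
      by (rule mult_left_mono) simp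
    also have "\<dots> \<le> liminf (\<lambda>j. ennreal (csig F) * (\<integral>\<^sup>+y. indicator F (g F y) * f j (g F y) \<partial>lborel))"
      by (rule liminf_cmult_ennreal_le)
    finally show "ennreal (csig F) * (\<integral>\<^sup>+y. indicator F (g F y) * liminf (\<lambda>j. f j (g F y)) \<partial>lborel)
      \<le> liminf (\<lambda>j. ennreal (csig F) * (\<integral>\<^sup>+y. indicator F (g F y) * f j (g F y) \<partial>lborel))" .
  qed
  also have "\<dots> \<le> liminf (\<lambda>j. \<sigma> (f j))"
    unfolding sigma_int_def by (rule liminf_sum_ennreal)
  finally show ?thesis .
qed

text \<open>A linear left inverse of the parametrization shows that the parameter set of a bounded
  facet is bounded.\<close>

lemma sigma_one_finite: "\<sigma> (\<lambda>_. 1) < \<infinity>"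
proof -
  have "(\<integral>\<^sup>+y. indicator F (g F y) * 1 \<partial>lborel) < \<infinity>" if F: "F facet_of P" for F
  proof -
    obtain A b where A: "linear A" "inj A" "g F = (\<lambda>y. A y + b)" using facet_param[OF F] .
    obtain G where G: "linear G" "G \<circ> A = id" using linear_injective_left_inverse[OF A(1,2)] by blast
    have GA: "G (A y) = y" for y using G(2) by (metis comp_apply id_apply)
    have "bounded F" using F compact_P by (meson bounded_subset compact_imp_bounded facet_of_imp_subset)
    then have "bounded ((\<lambda>x. x - b) ` F)" using bounded_translation[of F "-b"] by simp
    then have "bounded (G ` (\<lambda>x. x - b) ` F)"
      using G(1) by (rule bounded_linear_image[OF _ linear_conv_bounded_linear[THEN iffD1]])
    moreover have "g F -` F \<subseteq> G ` (\<lambda>x. x - b) ` F"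
    proof
      fix y assume "y \<in> g F -` F"
      then have "A y + b \<in> F" by (simp add: A(3))
      moreover have "y = G ((A y + b) - b)" by (simp add: GA)
      ultimately show "y \<in> G ` (\<lambda>x. x - b) ` F" by blast
    qed
    ultimately have bd: "bounded (g F -` F)" by (rule bounded_subset)
    have "g F -` F \<in> sets borel"
      using measurable_sets[OF facet_param_measurable[OF F] facet_borel[OF F]] by simp
    moreover have "(\<integral>\<^sup>+y. indicator F (g F y) * 1 \<partial>lborel) = (\<integral>\<^sup>+y. indicator (g F -` F) y \<partial>lborel)"
      by (intro nn_integral_cong) (simp add: indicator_def)
    ultimately show ?thesis using emeasure_bounded_finite[OF bd] by simp
  qed
  then show ?thesis
    unfolding sigma_int_def using facets_finite
    unfolding infinity_ennreal_def by (subst ennreal_sum_less_top) (auto simp: ennreal_mult_less_top)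
qed

text \<open>Averages connect convergence in the mean with boundary integrals: for fixed
  \<open>s\<close> the average of \<open>W\<close> is close to that of \<open>u k\<close>, which
  \<open>dil_le\<close> bounds by \<open>u k\<close> plus a small constant on the boundary too. Then
  \<open>s\<close> tends to 0 by \<open>le_liminf_dil\<close> and Fatou's lemma on the
  facets.\<close>

lemma sigma_closed_sublevel:
  assumes u: "\<And>k. u k \<in> densities P" and W: "W \<in> densities P"
    and lim: "(\<lambda>k. L1d P (u k) W) \<longlonglongrightarrow> 0" and le: "\<And>k. \<sigma> (u k) \<le> c"
  shows "\<sigma> W \<le> c"
proof -
  note [measurable] = densities_measurable[OF u] densities_measurable[OF W]
  have one: "cut (\<lambda>_. 1) \<in> borel_measurable borel" by measurable
  \<comment> \<open>Here \<open>k\<close> tends to infinity at fixed \<open>s\<close>, since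
    \<open>K s\<close> is unbounded for small \<open>s\<close>.\<close>
  have le_s: "\<sigma> (dil s (cut W)) \<le> c + \<sigma> (\<lambda>_. 1) * ennreal s" if s: "0 < s" "s < 1" for s
  proof (rule LIMSEQ_le_const)
    have "(\<lambda>k. K s * L1d P (u k) W) \<longlonglongrightarrow> K s * 0"
      using K_finite[of s] lim by (intro ennreal_tendsto_cmult) simp_all
    then have "(\<lambda>k. \<sigma> (\<lambda>_. 1) * (ennreal s + K s * L1d P (u k) W)) \<longlonglongrightarrow> \<sigma> (\<lambda>_. 1) * (ennreal s + K s * 0)"
      using sigma_one_finite by (intro ennreal_tendsto_cmult[OF _ tendsto_add[OF tendsto_const]]) simp_all
    from tendsto_add[OF tendsto_const this, of c]
    show "(\<lambda>k. c + \<sigma> (\<lambda>_. 1) * (ennreal s + K s * L1d P (u k) W)) \<longlonglongrightarrow> c + \<sigma> (\<lambda>_. 1) * ennreal s" by simp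
    have "\<sigma> (dil s (cut W)) \<le> c + \<sigma> (\<lambda>_. 1) * (ennreal s + K s * L1d P (u k) W)" for k
    proof -
      have "\<sigma> (dil s (cut W)) \<le> \<sigma> (\<lambda>x. 1 * u k x + (ennreal s + K s * L1d P (u k) W) * 1)"
      proof (rule sigma_mono)
        fix x assume x: "x \<in> P"
        have "dil s (cut W) x \<le> dil s (cut (u k)) x + K s * L1d P (u k) W"
          using dil_le_add_ediff[of "cut W" "cut (u k)" s x] s
          by (simp add: L1d_eq ediff_commute)
        also have "dil s (cut (u k)) x \<le> ennreal (1 - s) * u k x + ennreal s" by (rule dil_le[OF u s x])
        also have "ennreal (1 - s) * u k x \<le> 1 * u k x" using s by (intro mult_right_mono) auto
        finally show "dil s (cut W) x \<le> 1 * u k x + (ennreal s + K s * L1d P (u k) W) * 1"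
          by (simp add: add_ac add_right_mono)
      qed
      also have "\<dots> = 1 * \<sigma> (u k) + (ennreal s + K s * L1d P (u k) W) * \<sigma> (\<lambda>_. 1)"
        by (rule sigma_lincomb) measurable
      also have "\<dots> \<le> c + \<sigma> (\<lambda>_. 1) * (ennreal s + K s * L1d P (u k) W)"
        using le[of k] by (simp add: mult.commute add_right_mono)
      finally show ?thesis .
    qed
    then show "\<exists>N. \<forall>k\<ge>N. \<sigma> (dil s (cut W)) \<le> c + \<sigma> (\<lambda>_. 1) * (ennreal s + K s * L1d P (u k) W)" by blast
  qed
  define s :: "nat \<Rightarrow> real" where "s j = 1 / (real j + 2)" for j
  have s: "0 < s j" "s j < 1" for j by (auto simp: s_def field_simps)
  have s0: "s \<longlonglongrightarrow> 0" unfolding s_def by real_asymp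
  have "\<sigma> W \<le> \<sigma> (\<lambda>x. liminf (\<lambda>j. dil (s j) (cut W) x))"
    by (intro sigma_mono le_liminf_dil[OF W _ s s0])
  also have "\<dots> \<le> liminf (\<lambda>j. \<sigma> (dil (s j) (cut W)))"
    by (rule sigma_liminf) measurable
  also have "\<dots> \<le> liminf (\<lambda>j. c + \<sigma> (\<lambda>_. 1) * ennreal (s j))"
    by (intro Liminf_mono always_eventually allI le_s s)
  also have "\<dots> = c"
  proof -
    have "(\<lambda>j. ennreal (s j)) \<longlonglongrightarrow> ennreal 0" by (intro tendsto_ennrealI s0)
    then have "(\<lambda>j. \<sigma> (\<lambda>_. 1) * ennreal (s j)) \<longlonglongrightarrow> \<sigma> (\<lambda>_. 1) * 0"
      using sigma_one_finite by (intro ennreal_tendsto_cmult) simp_all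
    from tendsto_add[OF tendsto_const this, of c] show ?thesis by (simp add: lim_imp_Liminf)
  qed
  finally show ?thesis .
qed

lemma one_in_densities: "(\<lambda>_. 1) \<in> densities P"
proof -
  have "log_convex_on P (\<lambda>_. 1)" by (auto simp: log_convex_on_def)
  then have "lin_log_convex_on P (\<lambda>_. 1)" by (subst (asm) log_convex_on_iff_lin) auto
  moreover have "lsc_on P (\<lambda>_. 1)" by (auto simp: lsc_on_def)
  ultimately show ?thesis by (simp add: densities_def)
qed

lemma power_integral_bound:
  obtains B where "\<And>u. u \<in> densities P \<Longrightarrow> \<sigma> u \<le> ennreal c \<Longrightarrow>
    (\<integral>\<^sup>+x\<in>P. epow (u x) (DIM('a) / (real DIM('a) - 1)) \<partial>lborel) \<le> ennreal B"
proof -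
  obtain k where k: "DIM('a) = Suc k" "k > 0" using dim2 by (cases "DIM('a)") auto
  have q: "real DIM('a) / (real DIM('a) - 1) = real (Suc k) / real k" using k by simp
  obtain C where C: "C \<ge> 0" "\<And>u. convex_ennreal_on P u \<Longrightarrow> cut u \<in> borel_measurable borel \<Longrightarrow>
    (\<integral>\<^sup>+x\<in>P. epow (u x) (real (Suc k) / k) \<partial>lborel) ^ k \<le> ennreal C * \<sigma> u ^ Suc k"
    using boundary_integral_bound[OF sys k] by blast
  \<comment> \<open>\<open>ennreal c\<close> is 0 for negative \<open>c\<close>; the maximum makes
    the root and the power meaningful in that case too.\<close>
  define c' where "c' = max 0 c"
  show ?thesis
  proof
    fix u assume u: "u \<in> densities P" "\<sigma> u \<le> ennreal c"
    have "(\<integral>\<^sup>+x\<in>P. epow (u x) (DIM('a) / (real DIM('a) - 1)) \<partial>lborel) ^ k \<le> ennreal C * \<sigma> u ^ Suc k"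
      unfolding q using u by (intro C(2)) (auto simp: densities_def lin_log_convex_on_imp_convex densities_measurable)
    also have "\<dots> \<le> ennreal C * ennreal c' ^ Suc k"
      using u(2) by (intro mult_left_mono power_mono) (auto simp: c'_def ennreal_neg max_def split: if_splits)
    also have "\<dots> = ennreal (root k (C * c' ^ Suc k)) ^ k"
    proof -
      have "0 \<le> C * c' ^ Suc k" using C(1) by (simp add: c'_def)
      then show ?thesis using k C(1) by (simp add: ennreal_power ennreal_mult c'_def del: power_Suc)
    qed
    finally show "(\<integral>\<^sup>+x\<in>P. epow (u x) (DIM('a) / (real DIM('a) - 1)) \<partial>lborel) \<le> ennreal (root k (C * c' ^ Suc k))"
      using k(2) by (rule ennreal_power_le_cancel)
  qed
qed

end

section \<open>Entropy and its uniform concavity\<close>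

abbreviation phi :: "real \<Rightarrow> real" where "phi r \<equiv> r * ln r"

lemma phi_ge: "r \<ge> 0 \<Longrightarrow> phi r \<ge> r - 1"
proof (cases "r = 0")
  case False
  assume "r \<ge> 0"
  then have r: "r > 0" using False by simp
  then have "ln (1 / r) \<le> 1 / r - 1" by (intro ln_le_minus_one) simp
  then have "r * (- ln r) \<le> r * (1 / r - 1)" using r by (intro mult_left_mono) (simp_all add: ln_div)
  then show ?thesis using r by (simp add: algebra_simps)
qed simp

lemma abs_phi_le:
  assumes "r \<ge> 0" "p > 1"
  shows "\<bar>phi r\<bar> \<le> 1 + r powr p / (p - 1)"
proof (cases "r \<ge> 1")
  case True
  have "ln r \<le> r powr (p - 1) / (p - 1)" using True assms by (intro ln_powr_bound) auto
  then have "r * ln r \<le> r * (r powr (p - 1) / (p - 1))" using True by (intro mult_left_mono) auto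
  also have "\<dots> = r powr p / (p - 1)" using True by (simp add: powr_mult_base)
  finally have "phi r \<le> r powr p / (p - 1)" .
  moreover have "phi r \<ge> 0" using True by simp
  ultimately show ?thesis by simp
next
  case False
  then have "phi r \<le> 0" using assms by (cases "r = 0") (auto intro!: mult_nonneg_nonpos)
  moreover have "phi r \<ge> - 1" using phi_ge[OF assms(1)] assms(1) by simp
  moreover have "0 \<le> r powr p / (p - 1)" using assms by simp
  ultimately show ?thesis by simp
qed

text \<open>A quantitative form of the strict convexity of \<open>r ln r\<close>: by \<open>ln s \<le> s - 1\<close> at
  \<open>s = sqrt (m / x)\<close> the midpoint deficit dominates the squared Hellinger distances to the midpoint \<open>m\<close>.\<close>
lemma phi_midpoint_deficit:
  fixes x y \<epsilon> :: real
  assumes x: "x \<ge> 0" and y: "y \<ge> 0" and \<epsilon>: "\<epsilon> > 0"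
  shows "\<bar>x - y\<bar> \<le> 2 / \<epsilon> * ((phi x + phi y) / 2 - phi ((x + y) / 2)) + \<epsilon> * (x + y)"
proof (cases "x + y = 0")
  case False
  define m where "m = (x + y) / 2"
  have m: "m > 0" using False x y by (simp add: m_def)
  have H: "phi z - z * ln m \<ge> 2 * z - 2 * (sqrt z * sqrt m)" if z: "z \<ge> 0" for z
  proof (cases "z = 0")
    case False
    then have z: "z > 0" using that by simp
    have "ln (sqrt (m / z)) \<le> sqrt (m / z) - 1" using z m by (intro ln_le_minus_one) simp
    moreover have "ln (sqrt (m / z)) = (ln m - ln z) / 2" using z m by (simp add: ln_sqrt ln_div)
    ultimately have 1: "z * ((ln m - ln z) / 2) \<le> z * (sqrt (m / z) - 1)" using z by (intro mult_left_mono) auto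
    have "z * sqrt (m / z) = (sqrt z * sqrt z) * sqrt (m / z)" using z by simp
    also have "\<dots> = sqrt z * sqrt (z * (m / z))" by (simp only: mult.assoc real_sqrt_mult)
    also have "\<dots> = sqrt z * sqrt m" using z by simp
    finally have 2: "z * (sqrt (m / z) - 1) = sqrt z * sqrt m - z" by (simp add: right_diff_distrib)
    have 3: "z * ((ln m - ln z) / 2) = (z * ln m - phi z) / 2" by (simp add: algebra_simps)
    have "2 * c - 2 * p \<le> b - a" if "(a - b) / 2 \<le> p - c" for a b c p :: real
      using that by (simp add: field_simps)
    then show ?thesis using 1[unfolded 2 3] by blast
  qed simp
  define A B where "A = sqrt x - sqrt m" and "B = sqrt y - sqrt m"
  have sq: "A\<^sup>2 = x + m - 2 * (sqrt x * sqrt m)" "B\<^sup>2 = y + m - 2 * (sqrt y * sqrt m)"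
    using x y m by (simp_all add: A_def B_def power2_diff)
  have xy: "x + y = 2 * m" by (simp add: m_def)
  have "phi x + phi y - (x + y) * ln m \<ge> 2 * (x + y) - 2 * (sqrt x * sqrt m) - 2 * (sqrt y * sqrt m)"
    using H[OF x] H[OF y] by (simp add: algebra_simps)
  then have d: "A\<^sup>2 + B\<^sup>2 \<le> 2 * ((phi x + phi y) / 2 - phi m)"
    unfolding sq using xy by (simp add: algebra_simps)
  \<comment> \<open>A difference of squares is factored and the product split by weighted AM-GM. The
    weight \<open>\<epsilon>\<close> keeps the final estimate linear in the deficit, so that it can
    be integrated directly.\<close>
  have L: "\<bar>z - m\<bar> \<le> (sqrt z - sqrt m)\<^sup>2 / \<epsilon> + \<epsilon> / 2 * (z + m)" if z: "z \<ge> 0" for z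
  proof -
    define a b where "a = \<bar>sqrt z - sqrt m\<bar>" and "b = sqrt z + sqrt m"
    have "z - m = (sqrt z - sqrt m) * b" using z m by (simp add: b_def algebra_simps)
    then have "\<bar>z - m\<bar> = a * b" using z m by (simp add: a_def b_def abs_mult)
    also have "\<dots> \<le> a\<^sup>2 / \<epsilon> + \<epsilon> / 4 * b\<^sup>2"
    proof -
      have "0 \<le> (a - \<epsilon> / 2 * b)\<^sup>2 / \<epsilon>" using \<epsilon> by simp
      also have "\<dots> = a\<^sup>2 / \<epsilon> + \<epsilon> / 4 * b\<^sup>2 - a * b" using \<epsilon> by (simp add: power2_eq_square field_simps)
      finally show ?thesis by simp
    qed
    also have "b\<^sup>2 \<le> 2 * (z + m)"
    proof -
      have "0 \<le> (sqrt z - sqrt m)\<^sup>2" by simp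
      then show ?thesis using z m by (simp add: b_def power2_sum power2_diff)
    qed
    then have "\<epsilon> / 4 * b\<^sup>2 \<le> \<epsilon> / 4 * (2 * (z + m))" using \<epsilon> by (intro mult_left_mono) auto
    also have "\<epsilon> / 4 * (2 * (z + m)) = \<epsilon> / 2 * (z + m)" by simp
    finally show ?thesis by (simp add: a_def)
  qed
  have "\<bar>x - y\<bar> \<le> \<bar>x - m\<bar> + \<bar>y - m\<bar>" by simp
  also have "\<dots> \<le> (A\<^sup>2 + B\<^sup>2) / \<epsilon> + \<epsilon> / 2 * (x + y + 2 * m)"
    using L[OF x] L[OF y] by (simp add: A_def B_def add_divide_distrib algebra_simps)
  also have "\<dots> \<le> 2 * ((phi x + phi y) / 2 - phi m) / \<epsilon> + \<epsilon> * (x + y)"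
    using divide_right_mono[OF d, of \<epsilon>] \<epsilon> xy by (simp add: algebra_simps)
  finally show ?thesis by (simp add: m_def)
next
  case True
  then have "x = 0" "y = 0" using x y by auto
  then show ?thesis by simp
qed

lemma e2ennreal_max_0: "e2ennreal (max 0 (ereal r)) = ennreal r"
proof (cases "r \<ge> 0")
  case True
  then have "max 0 (ereal r) = ereal r" by (simp add: max_def)
  then show ?thesis by (simp add: e2ennreal_ereal)
next
  case False
  then have "max 0 (ereal r) = ereal 0" by (simp add: max_def)
  then show ?thesis using False by (simp only: e2ennreal_ereal) (simp add: ennreal_neg)
qed

definition half :: ennreal where "half = ennreal (1 / 2)"

lemma half_simps: "0 < half" "half < top" "half \<noteq> 0" "half \<noteq> top"
proof -
  show "0 < half" unfolding half_def ennreal_less_zero_iff by simp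
  show "half < top" unfolding half_def by (rule ennreal_less_top)
  then show "half \<noteq> 0" "half \<noteq> top" using \<open>0 < half\<close> by auto
qed

lemma half_add: "a \<ge> 0 \<Longrightarrow> b \<ge> 0 \<Longrightarrow> half * ennreal a + half * ennreal b = ennreal ((a + b) / 2)"
proof -
  assume "a \<ge> 0" "b \<ge> 0"
  then have "half * ennreal a + half * ennreal b = ennreal (1 / 2 * a + 1 / 2 * b)"
    unfolding half_def by (simp only: ennreal_mult'[symmetric] ennreal_plus[symmetric] mult_nonneg_nonneg divide_nonneg_nonneg zero_le_one zero_le_numeral)
  then show ?thesis by (simp add: add_divide_distrib)
qed

section \<open>Entropy, energy and distance as real numbers on densities of finite energy\<close>

context polytope_system
begin

text \<open>Finite energy forces finite entropy through the bound with exponent n/(n-1). All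
  minimizers lie here, by comparison with the constant 1.\<close>

definition finite_energy :: "('a \<Rightarrow> ennreal) set" where
  "finite_energy = {u \<in> densities P. \<sigma> u < \<infinity>}"

text \<open>The default value 0 is taken outside \<open>P\<close> and on the null set where
  \<open>u\<close> is infinite; \<open>phi\<close> vanishes at 0, so integrals may run over the
  whole space.\<close>

definition re :: "('a \<Rightarrow> ennreal) \<Rightarrow> 'a \<Rightarrow> real" where
  "re u x = enn2real (cut u x)"

definition volume :: real where "volume = measure lborel P"

definition Sr :: "('a \<Rightarrow> ennreal) \<Rightarrow> real" where
  "Sr u = - (LINT x|lborel. phi (re u x)) / volume"

definition Ur :: "('a \<Rightarrow> ennreal) \<Rightarrow> real" where
  "Ur u = enn2real (\<sigma> u) / vol P cmu"

definition dR :: "('a \<Rightarrow> ennreal) \<Rightarrow> ('a \<Rightarrow> ennreal) \<Rightarrow> real" where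
  "dR u v = (LINT x|lborel. \<bar>re u x - re v x\<bar>) / volume"

lemma volume_eq: "emeasure lborel P = ennreal volume"
  unfolding volume_def using emeasure_P_finite by (intro emeasure_eq_ennreal_measure) auto

lemma volume_pos: "volume > 0"
  using emeasure_P_pos by (simp add: volume_eq)

lemma vol_pos: "vol P cmu > 0"
  using volume_pos cmu_pos by (simp add: vol_def volume_def)

lemma re_nonneg [simp]: "re u x \<ge> 0"
  by (simp add: re_def)

lemma re_outside: "x \<notin> P \<Longrightarrow> re u x = 0"
  by (simp add: re_def)

lemma densities_re:
  assumes u: "u \<in> densities P"
  shows re_measurable: "re u \<in> borel_measurable borel"
    and AE_cut_re: "AE x in lborel. cut u x = ennreal (re u x)"
    and re_integrable: "integrable lborel (re u)"
    and integral_re: "(LINT x|lborel. re u x) = volume"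
proof -
  note [measurable] = densities_measurable[OF u]
  show m[measurable]: "re u \<in> borel_measurable borel" unfolding re_def[abs_def] by measurable
  show ae: "AE x in lborel. cut u x = ennreal (re u x)"
    using AE_densities_finite[OF u] by eventually_elim (simp add: re_def)
  have "(\<integral>\<^sup>+x. ennreal (re u x) \<partial>lborel) = (\<integral>\<^sup>+x. cut u x \<partial>lborel)"
    using ae by (intro nn_integral_cong_AE) auto
  also have "\<dots> = ennreal volume" using u by (simp add: densities_def volume_eq)
  finally have "has_bochner_integral lborel (re u) volume"
    using volume_pos by (intro has_bochner_integral_nn_integral) auto
  then show "integrable lborel (re u)" "(LINT x|lborel. re u x) = volume"
    by (auto simp: has_bochner_integral_iff)
qed

lemma indicator_P_integral:
  "integrable lborel (indicator P :: 'a \<Rightarrow> real)" "(LINT x|lborel. indicator P x) = volume"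
  using emeasure_P_finite by (auto simp: volume_def)

lemma finite_energyD:
  assumes "u \<in> finite_energy"
  shows "u \<in> densities P" "\<sigma> u < \<infinity>"
  using assms by (auto simp: finite_energy_def)

lemma q_gt_1: "1 < real DIM('a) / (real DIM('a) - 1)"
  using dim2 by simp

lemma integrable_re_powr:
  assumes u: "u \<in> densities P" and B: "(\<integral>\<^sup>+x\<in>P. epow (u x) p \<partial>lborel) \<le> ennreal B"
  shows "(\<integral>\<^sup>+x. ennreal (re u x powr p) \<partial>lborel) \<le> ennreal B"
proof -
  have "(\<integral>\<^sup>+x. ennreal (re u x powr p) \<partial>lborel) \<le> (\<integral>\<^sup>+x. epow (u x) p * indicator P x \<partial>lborel)"
    by (intro nn_integral_mono) (auto simp: epow_def re_def split: split_indicator)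
  then show ?thesis using B by simp
qed

text \<open>\<open>power_integral_bound\<close> supplies an exponent above 1, and
  \<open>abs_phi_le\<close> then dominates the entropy integrand.\<close>

lemma phi_integrable:
  assumes u: "u \<in> finite_energy"
  shows "integrable lborel (\<lambda>x. phi (re u x))"
proof -
  let ?q = "real DIM('a) / (real DIM('a) - 1)"
  note u' = finite_energyD[OF u]
  note [measurable] = re_measurable[OF u'(1)]
  obtain c where c: "\<sigma> u \<le> ennreal c" using u'(2) by (cases "\<sigma> u") auto
  obtain B where B: "(\<integral>\<^sup>+x\<in>P. epow (u x) ?q \<partial>lborel) \<le> ennreal B"
    by (rule power_integral_bound[of c]) (rule that, use u'(1) c in blast)
  have "(\<integral>\<^sup>+x. ennreal (re u x powr ?q) \<partial>lborel) < \<infinity>"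
    using integrable_re_powr[OF u'(1) B] by (auto intro: le_less_trans)
  then have "integrable lborel (\<lambda>x. re u x powr ?q)" by (intro integrableI_bounded) auto
  then have "integrable lborel (\<lambda>x. indicator P x + re u x powr ?q / (?q - 1))"
    using indicator_P_integral by (intro Bochner_Integration.integrable_add) auto
  then show ?thesis
  proof (rule Bochner_Integration.integrable_bound)
    show "AE x in lborel. norm (phi (re u x)) \<le> norm (indicator P x + re u x powr ?q / (?q - 1))"
    proof (rule AE_I2)
      fix x
      have "0 \<le> re u x powr ?q / (?q - 1)" using q_gt_1 by simp
      then show "norm (phi (re u x)) \<le> norm (indicator P x + re u x powr ?q / (?q - 1))"
        using abs_phi_le[OF re_nonneg[of u x] q_gt_1] by (cases "x \<in> P") (auto simp: re_outside)
    qed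
  qed measurable
qed

lemma entropy_S_eq:
  assumes u: "u \<in> finite_energy"
  shows "entropy_S P cmu u = ereal (Sr u)"
proof -
  note u' = finite_energyD[OF u]
  note [measurable] = re_measurable[OF u'(1)]
  have int: "integrable lborel (\<lambda>x. phi (re u x))" by (rule phi_integrable[OF u])
  have ae: "AE x in lborel. x \<in> P \<longrightarrow> xlogx (u x) = ereal (phi (re u x))"
    using AE_cut_re[OF u'(1)]
  proof eventually_elim
    case (elim x)
    show ?case
    proof
      assume "x \<in> P"
      then have ux: "u x = ennreal (re u x)" using elim by simp
      show "xlogx (u x) = ereal (phi (re u x))"
        unfolding xlogx_def ux by simp
    qed
  qed
  have pos: "mu_int P cmu (\<lambda>x. e2ennreal (max 0 (xlogx (u x)))) = ennreal cmu * (\<integral>\<^sup>+x. ennreal (phi (re u x)) \<partial>lborel)"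
    unfolding mu_int_def
  proof (rule arg_cong[where f="\<lambda>t. ennreal cmu * t"], rule nn_integral_cong_AE, use ae in eventually_elim)
    case (elim x)
    then show ?case by (cases "x \<in> P") (simp_all add: e2ennreal_max_0 re_outside)
  qed
  have neg: "mu_int P cmu (\<lambda>x. e2ennreal (max 0 (- xlogx (u x)))) = ennreal cmu * (\<integral>\<^sup>+x. ennreal (- phi (re u x)) \<partial>lborel)"
    unfolding mu_int_def
  proof (rule arg_cong[where f="\<lambda>t. ennreal cmu * t"], rule nn_integral_cong_AE, use ae in eventually_elim)
    case (elim x)
    then show ?case by (cases "x \<in> P") (simp_all add: e2ennreal_max_0 re_outside)
  qed
  have fin: "(\<integral>\<^sup>+x. ennreal (phi (re u x)) \<partial>lborel) \<noteq> \<infinity>" "(\<integral>\<^sup>+x. ennreal (- phi (re u x)) \<partial>lborel) \<noteq> \<infinity>"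
    using int by (auto simp: real_integrable_def)
  then obtain a b where a: "(\<integral>\<^sup>+x. ennreal (phi (re u x)) \<partial>lborel) = ennreal a" "a \<ge> 0"
    and b: "(\<integral>\<^sup>+x. ennreal (- phi (re u x)) \<partial>lborel) = ennreal b" "b \<ge> 0"
    by (cases "\<integral>\<^sup>+x. ennreal (phi (re u x)) \<partial>lborel"; cases "\<integral>\<^sup>+x. ennreal (- phi (re u x)) \<partial>lborel") auto
  have "(LINT x|lborel. phi (re u x)) = a - b"
    using a b by (simp add: real_lebesgue_integral_def[OF int])
  moreover have "entropy_S P cmu u = ereal (- (1 / vol P cmu * (cmu * a - cmu * b)))"
    unfolding entropy_S_def pos neg a b using a(2) b(2) cmu_pos
    by (simp add: ennreal_mult[symmetric])
  moreover have "1 / vol P cmu * (cmu * a - cmu * b) = (a - b) / volume"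
    using cmu_pos volume_pos by (simp add: vol_def volume_def field_simps)
  ultimately show ?thesis by (simp add: Sr_def diff_divide_distrib)
qed

lemma energy_U_eq:
  assumes u: "u \<in> finite_energy"
  shows "energy_U P cmu csig g u = ereal (Ur u)"
  using finite_energyD(2)[OF u] unfolding energy_U_def Ur_def
  by (cases "\<sigma> u") auto

lemma free_F_eq:
  assumes u: "u \<in> finite_energy"
  shows "free_F P cmu csig g T u = ereal (Ur u - T * Sr u)"
  by (simp add: free_F_def entropy_S_eq[OF u] energy_U_eq[OF u])

text \<open>Jensen's inequality by the tangent line at 1: the linear bound integrates to 0 because
  the density has mean 1.\<close>

lemma Sr_nonpos:
  assumes u: "u \<in> finite_energy"
  shows "Sr u \<le> 0"
proof -
  note u' = finite_energyD[OF u]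
  have "(LINT x|lborel. re u x - indicator P x) \<le> (LINT x|lborel. phi (re u x))"
  proof (rule integral_mono)
    show "re u x - indicator P x \<le> phi (re u x)" for x
      using phi_ge[OF re_nonneg[of u x]] by (cases "x \<in> P") (auto simp: re_outside)
  qed (use re_integrable[OF u'(1)] phi_integrable[OF u] indicator_P_integral in auto)
  also have "(LINT x|lborel. re u x - indicator P x) = 0"
    using re_integrable[OF u'(1)] integral_re[OF u'(1)] indicator_P_integral by simp
  finally show ?thesis using volume_pos by (simp add: Sr_def divide_nonpos_pos)
qed

lemma one_finite_energy: "(\<lambda>_. 1) \<in> finite_energy"
  using one_in_densities sigma_one_finite by (simp add: finite_energy_def)

lemma Sr_one: "Sr (\<lambda>_. 1) = 0"
proof -
  have "(\<lambda>x. phi (re (\<lambda>_. 1) x)) = (\<lambda>_. 0)" by (auto simp: fun_eq_iff re_def split: split_indicator)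
  then show ?thesis unfolding Sr_def by simp
qed

definition mid :: "('a \<Rightarrow> ennreal) \<Rightarrow> ('a \<Rightarrow> ennreal) \<Rightarrow> 'a \<Rightarrow> ennreal" where
  "mid u v = (\<lambda>x. half * u x + half * v x)"

lemma mid_finite_energy:
  assumes "u \<in> finite_energy" "v \<in> finite_energy"
  shows "mid u v \<in> finite_energy" "Ur (mid u v) = (Ur u + Ur v) / 2"
proof -
  note u = finite_energyD[OF assms(1)] and v = finite_energyD[OF assms(2)]
  note [measurable] = densities_measurable[OF u(1)] densities_measurable[OF v(1)]
  have s: "\<sigma> (mid u v) = half * \<sigma> u + half * \<sigma> v"
    unfolding mid_def by (rule sigma_lincomb) measurable
  have "lsc_on P (mid u v)"
    unfolding mid_def using u v by (intro lsc_on_add lsc_on_cmult) (auto simp: densities_def)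
  moreover have "lin_log_convex_on P (mid u v)"
    unfolding lin_log_convex_on_def
  proof (intro ballI allI impI)
    fix x y t \<alpha> assume *: "x \<in> P" "y \<in> P" "0 < t" "t < (1::real)" "0 < (\<alpha>::real)"
    let ?p = "ennreal ((1 - t) * \<alpha> powr t)" and ?q = "ennreal (t * \<alpha> powr (t - 1))"
    have "mid u v ((1 - t) *\<^sub>R x + t *\<^sub>R y) \<le> half * (?p * u x + ?q * u y) + half * (?p * v x + ?q * v y)"
      unfolding mid_def using u v *
      by (intro add_mono mult_left_mono lin_log_convex_onD[of P]) (auto simp: densities_def)
    also have "\<dots> = ?p * mid u v x + ?q * mid u v y"
      by (simp add: mid_def distrib_left mult_ac add_ac)
    finally show "mid u v ((1 - t) *\<^sub>R x + t *\<^sub>R y) \<le> ?p * mid u v x + ?q * mid u v y" .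
  qed
  moreover have "0 < mid u v x" if "x \<in> P" for x
  proof -
    have "0 < half * u x" using u that by (auto simp: densities_def ennreal_zero_less_mult_iff half_simps)
    then show ?thesis by (simp add: mid_def add_pos_nonneg)
  qed
  moreover have "(\<integral>\<^sup>+x\<in>P. mid u v x \<partial>lborel) = emeasure lborel P"
  proof -
    have "(\<integral>\<^sup>+x\<in>P. mid u v x \<partial>lborel) = (\<integral>\<^sup>+x. half * cut u x + half * cut v x \<partial>lborel)"
      by (intro nn_integral_cong) (simp add: mid_def distrib_right distrib_left mult_ac)
    also have "\<dots> = half * ennreal volume + half * ennreal volume"
      using u v by (subst nn_integral_add) (auto simp: nn_integral_cmult densities_def volume_eq)
    also have "\<dots> = ennreal volume"
      using volume_pos by (simp add: half_add)
    finally show ?thesis by (simp add: volume_eq)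
  qed
  ultimately show "mid u v \<in> finite_energy"
    using u v by (simp add: finite_energy_def densities_def s ennreal_mult_less_top half_simps)
  obtain a b where "\<sigma> u = ennreal a" "\<sigma> v = ennreal b" "a \<ge> 0" "b \<ge> 0"
    using u(2) v(2) by (cases "\<sigma> u"; cases "\<sigma> v") auto
  then show "Ur (mid u v) = (Ur u + Ur v) / 2"
    using vol_pos by (simp add: Ur_def s half_add) (simp add: field_simps)
qed

text \<open>The pointwise estimate \<open>phi_midpoint_deficit\<close> is integrated; the error
  \<open>\<epsilon> * (x + y)\<close> becomes \<open>2 * \<epsilon>\<close> because both densities
  have mean 1.\<close>

lemma dR_le_deficit:
  assumes u: "u \<in> finite_energy" and v: "v \<in> finite_energy" and \<epsilon>: "\<epsilon> > 0"
  shows "dR u v \<le> 2 / \<epsilon> * (Sr (mid u v) - (Sr u + Sr v) / 2) + 2 * \<epsilon>"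
proof -
  note u' = finite_energyD(1)[OF u] and v' = finite_energyD(1)[OF v]
  note w = mid_finite_energy(1)[OF u v]
  note int = phi_integrable[OF u] phi_integrable[OF v] phi_integrable[OF w]
    re_integrable[OF u'] re_integrable[OF v']
  have ae: "AE x in lborel. re (mid u v) x = (re u x + re v x) / 2"
    using AE_cut_re[OF u'] AE_cut_re[OF v']
  proof eventually_elim
    case (elim x)
    have "cut (mid u v) x = half * cut u x + half * cut v x"
      by (simp only: mid_def distrib_right mult.assoc)
    also have "\<dots> = ennreal ((re u x + re v x) / 2)"
      unfolding elim by (simp add: half_add)
    finally have "re (mid u v) x = enn2real (ennreal ((re u x + re v x) / 2))"
      unfolding re_def[of "mid u v"] by (rule arg_cong)
    then show ?case by (subst (asm) enn2real_ennreal) auto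
  qed
  have "(LINT x|lborel. \<bar>re u x - re v x\<bar>) \<le> (LINT x|lborel. 2 / \<epsilon> * ((phi (re u x) + phi (re v x)) / 2 - phi (re (mid u v) x)) + \<epsilon> * (re u x + re v x))"
  proof (rule integral_mono_AE)
    show "AE x in lborel. \<bar>re u x - re v x\<bar> \<le> 2 / \<epsilon> * ((phi (re u x) + phi (re v x)) / 2 - phi (re (mid u v) x)) + \<epsilon> * (re u x + re v x)"
      using ae
    proof eventually_elim
      case (elim x)
      show ?case unfolding elim by (rule phi_midpoint_deficit[OF re_nonneg re_nonneg \<epsilon>])
    qed
  qed (use int in auto)
  also have "\<dots> = 2 / \<epsilon> * (((LINT x|lborel. phi (re u x)) + (LINT x|lborel. phi (re v x))) / 2 - (LINT x|lborel. phi (re (mid u v) x))) + \<epsilon> * (volume + volume)"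
    using int by (simp add: integral_re[OF u'] integral_re[OF v'])
  finally have "dR u v \<le> (2 / \<epsilon> * (((LINT x|lborel. phi (re u x)) + (LINT x|lborel. phi (re v x))) / 2 - (LINT x|lborel. phi (re (mid u v) x))) + \<epsilon> * (volume + volume)) / volume"
    unfolding dR_def using volume_pos by (intro divide_right_mono) auto
  also have "\<dots> = 2 / \<epsilon> * (Sr (mid u v) - (Sr u + Sr v) / 2) + 2 * \<epsilon>"
    unfolding Sr_def using volume_pos \<epsilon> by (simp add: field_simps)
  finally show ?thesis .
qed

lemma L1d_eq_dR:
  assumes u: "u \<in> densities P" and v: "v \<in> densities P"
  shows "L1d P u v = ennreal (volume * dR u v)"
proof -
  have "L1d P u v = (\<integral>\<^sup>+x. ennreal \<bar>re u x - re v x\<bar> \<partial>lborel)"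
    unfolding L1d_eq
  proof (rule nn_integral_cong_AE, use AE_densities_finite[OF u] AE_densities_finite[OF v] in eventually_elim)
    case (elim x)
    then show ?case by (simp add: ediff_def re_def less_top)
  qed
  also have "\<dots> = ennreal (LINT x|lborel. \<bar>re u x - re v x\<bar>)"
    using re_integrable[OF u] re_integrable[OF v]
    by (intro nn_integral_eq_integral) (auto intro!: integrable_abs)
  also have "(LINT x|lborel. \<bar>re u x - re v x\<bar>) = volume * dR u v"
    using volume_pos by (simp add: dR_def)
  finally show ?thesis .
qed

lemma dR_nonneg: "dR u v \<ge> 0"
  unfolding dR_def using volume_pos by (intro divide_nonneg_nonneg) auto

lemma dR_commute: "dR u v = dR v u"
  by (simp add: dR_def abs_minus_commute)

lemma L1d_tendsto:
  assumes u: "\<And>k. u k \<in> finite_energy" and w: "w \<in> finite_energy"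
  shows "(\<lambda>k. L1d P (u k) w) \<longlonglongrightarrow> 0 \<longleftrightarrow> (\<lambda>k. dR (u k) w) \<longlonglongrightarrow> 0"
proof -
  have "(\<lambda>k. L1d P (u k) w) \<longlonglongrightarrow> 0 \<longleftrightarrow> (\<lambda>k. ennreal (volume * dR (u k) w)) \<longlonglongrightarrow> ennreal 0"
    using L1d_eq_dR u w by (simp add: finite_energyD)
  also have "\<dots> \<longleftrightarrow> (\<lambda>k. volume * dR (u k) w) \<longlonglongrightarrow> volume * 0"
    using volume_pos dR_nonneg by (subst tendsto_ennreal_iff) auto
  also have "\<dots> \<longleftrightarrow> (\<lambda>k. dR (u k) w) \<longlonglongrightarrow> 0"
    using volume_pos by (subst tendsto_mult_left_iff) auto
  finally show ?thesis .
qed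

lemma sigma_le_of_Ur_le:
  assumes "v \<in> finite_energy" "Ur v \<le> c"
  shows "\<sigma> v \<le> ennreal (vol P cmu * c)"
proof -
  have "enn2real (\<sigma> v) \<le> vol P cmu * c" using assms(2) vol_pos by (simp add: Ur_def field_simps)
  then show ?thesis using finite_energyD(2)[OF assms(1)] by (cases "\<sigma> v") (auto intro: ennreal_leI)
qed

lemma Ur_closed_sublevel:
  assumes u: "\<And>k. u k \<in> finite_energy" and w: "w \<in> finite_energy"
    and lim: "(\<lambda>k. dR (u k) w) \<longlonglongrightarrow> 0" and le: "\<And>k. Ur (u k) \<le> c"
  shows "Ur w \<le> c"
proof -
  have "0 \<le> Ur (u 0)" using vol_pos by (simp add: Ur_def)
  then have c: "c \<ge> 0" using le[of 0] by simp
  have "\<sigma> w \<le> ennreal (vol P cmu * c)"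
    by (rule sigma_closed_sublevel[of u]) (use u w lim sigma_le_of_Ur_le le L1d_tendsto in \<open>auto simp: finite_energyD\<close>)
  then have "enn2real (\<sigma> w) \<le> vol P cmu * c" using c vol_pos by (intro enn2real_leI) auto
  then show ?thesis using vol_pos by (simp add: Ur_def field_simps)
qed

text \<open>The common energy bound is what keeps the limit density inside
  \<open>finite_energy\<close>.\<close>

lemma finite_energy_complete:
  assumes u: "\<And>k. u k \<in> finite_energy" and le: "\<And>k. Ur (u k) \<le> c"
    and Cauchy: "\<And>e. e > 0 \<Longrightarrow> \<exists>N. \<forall>i\<ge>N. \<forall>j\<ge>N. dR (u i) (u j) \<le> e"
  obtains w where "w \<in> finite_energy" "(\<lambda>k. dR (u k) w) \<longlonglongrightarrow> 0"
proof -
  note u' = finite_energyD(1)[OF u]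
  obtain w where w: "w \<in> densities P" "(\<lambda>k. L1d P (u k) w) \<longlonglongrightarrow> 0"
  proof (rule densities_complete[OF u'])
    fix e :: real assume e: "e > 0"
    then obtain N where N: "\<forall>i\<ge>N. \<forall>j\<ge>N. dR (u i) (u j) \<le> e / volume"
      using Cauchy[of "e / volume"] volume_pos by auto
    show "\<exists>N. \<forall>i\<ge>N. \<forall>j\<ge>N. L1d P (u i) (u j) \<le> ennreal e"
    proof (intro exI[of _ N] allI impI)
      fix i j assume "i \<ge> N" "j \<ge> N"
      then have "dR (u i) (u j) \<le> e / volume" using N by blast
      then have "volume * dR (u i) (u j) \<le> e" using volume_pos by (simp add: field_simps)
      then show "L1d P (u i) (u j) \<le> ennreal e" by (simp add: L1d_eq_dR[OF u' u'] ennreal_leI)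
    qed
  qed blast
  have "\<sigma> w \<le> ennreal (vol P cmu * c)" by (rule sigma_closed_sublevel[OF u' w sigma_le_of_Ur_le[OF u le]])
  then have w': "w \<in> finite_energy" using w(1) by (auto simp: finite_energy_def intro: le_less_trans)
  show ?thesis using that[OF w'] w(2) L1d_tendsto[OF u w'] by simp
qed

text \<open>Entropy is upper semicontinuous in the mean: Fatou's lemma is applied to the entropy
  integrand along an almost everywhere convergent subsequence.\<close>

lemma Sr_closed_superlevel:
  assumes u: "\<And>k. u k \<in> finite_energy" and w: "w \<in> finite_energy"
    and lim: "(\<lambda>k. dR (u k) w) \<longlonglongrightarrow> 0" and ge: "\<And>k. c \<le> Sr (u k)"
  shows "c \<le> Sr w"
proof -
  note u' = finite_energyD(1)[OF u] and w' = finite_energyD(1)[OF w]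
  note [measurable] = re_measurable[OF u'] re_measurable[OF w']
  have "(\<lambda>k. volume * dR (u k) w) \<longlonglongrightarrow> volume * 0" by (intro tendsto_mult tendsto_const lim)
  then have "(\<lambda>k. LINT x|lborel. norm (re (u k) x - re w x)) \<longlonglongrightarrow> 0"
    using volume_pos by (simp add: dR_def)
  then obtain r where r: "AE x in lborel. (\<lambda>k. re (u (r k)) x - re w x) \<longlonglongrightarrow> 0"
    using tendsto_L1_AE_subseq[of lborel "\<lambda>k x. re (u k) x - re w x"] re_integrable[OF u'] re_integrable[OF w'] by auto
  \<comment> \<open>Since \<open>phi\<close> is at least -1, adding the indicator gives a
    nonnegative integrand and shifts every integral by the same amount
    \<open>volume\<close>.\<close>
  let ?h = "\<lambda>v x. phi (re v x) + indicator P x"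
  have h0: "?h v x \<ge> 0" for v x
    using phi_ge[OF re_nonneg[of v x]] re_nonneg[of v x] by (cases "x \<in> P") (auto simp: re_outside simp del: re_nonneg)
  have hi: "(\<integral>\<^sup>+x. ennreal (?h v x) \<partial>lborel) = ennreal (volume - volume * Sr v)" if v: "v \<in> finite_energy" for v
  proof -
    have "(\<integral>\<^sup>+x. ennreal (?h v x) \<partial>lborel) = ennreal (LINT x|lborel. ?h v x)"
      using phi_integrable[OF v] indicator_P_integral h0 by (intro nn_integral_eq_integral) auto
    also have "(LINT x|lborel. ?h v x) = volume - volume * Sr v"
      using phi_integrable[OF v] indicator_P_integral volume_pos by (simp add: Sr_def)
    finally show ?thesis .
  qed
  have "AE x in lborel. ennreal (?h w x) \<le> liminf (\<lambda>k. ennreal (?h (u (r k)) x))"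
    using r AE_cut_re[OF w']
  proof eventually_elim
    case (elim x)
    show ?case
    proof (cases "x \<in> P")
      case True
      \<comment> \<open>Positivity of densities keeps the limit away from 0, where the continuity
        rule for \<open>ln\<close> fails.\<close>
      then have "re w x \<noteq> 0" using elim(2) w' by (auto simp: densities_def)
      moreover have l: "(\<lambda>k. re (u (r k)) x) \<longlonglongrightarrow> re w x" using elim(1) by (rule LIM_zero_cancel)
      ultimately have "(\<lambda>k. ennreal (?h (u (r k)) x)) \<longlonglongrightarrow> ennreal (?h w x)"
        by (intro tendsto_ennrealI tendsto_intros)
      then show ?thesis by (simp add: lim_imp_Liminf)
    qed (simp add: re_outside)
  qed
  then have "ennreal (volume - volume * Sr w) \<le> (\<integral>\<^sup>+x. liminf (\<lambda>k. ennreal (?h (u (r k)) x)) \<partial>lborel)"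
    unfolding hi[OF w, symmetric] by (rule nn_integral_mono_AE)
  also have "\<dots> \<le> liminf (\<lambda>k. \<integral>\<^sup>+x. ennreal (?h (u (r k)) x) \<partial>lborel)"
    by (rule nn_integral_liminf) measurable
  also have "\<dots> \<le> ennreal (volume - volume * c)"
    unfolding hi[OF u] by (intro Liminf_le always_eventually allI ennreal_leI) (use ge volume_pos in auto)
  finally have "volume - volume * Sr w \<le> volume - volume * c"
  proof (subst (asm) ennreal_le_iff)
    have "c \<le> 0" using ge[of 0] Sr_nonpos[OF u[of 0]] by simp
    then show "0 \<le> volume - volume * c" using volume_pos mult_nonneg_nonpos[of volume c] by simp
  qed
  then show ?thesis using volume_pos by simp
qed

end

section \<open>Canonical distributions\<close>

text \<open>The difference is split at the threshold \<open>M\<close>: below it the surplus power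
  \<open>p - 1\<close> is bounded by \<open>M\<close>, above it the missing power
  \<open>r - p\<close> is gained, and the difference is at most the larger of \<open>a\<close> and
  \<open>b\<close>.\<close>

lemma abs_diff_powr_le:
  fixes a b M p r :: real
  assumes "a \<ge> 0" "b \<ge> 0" "M > 0" "1 \<le> p" "p < r"
  shows "\<bar>a - b\<bar> powr p \<le> M powr (p - 1) * \<bar>a - b\<bar> + M powr (p - r) * (a powr r + b powr r)"
proof (cases "\<bar>a - b\<bar> \<le> M")
  case True
  have "\<bar>a - b\<bar> powr p = \<bar>a - b\<bar> powr (p - 1) * \<bar>a - b\<bar>"
    by (cases "a = b") (auto simp: powr_mult_base mult.commute)
  also have "\<dots> \<le> M powr (p - 1) * \<bar>a - b\<bar>"
    using True assms by (intro mult_right_mono powr_mono2) auto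
  finally show ?thesis by (smt (verit) mult_nonneg_nonneg powr_ge_zero)
next
  case False
  have "\<bar>a - b\<bar> powr p = \<bar>a - b\<bar> powr (p - r) * \<bar>a - b\<bar> powr r"
    by (simp add: powr_add[symmetric])
  also have "\<dots> \<le> M powr (p - r) * (a powr r + b powr r)"
  proof (rule mult_mono)
    show "\<bar>a - b\<bar> powr (p - r) \<le> M powr (p - r)"
      using False assms by (intro powr_mono2') auto
    have "\<bar>a - b\<bar> powr r \<le> (max a b) powr r" using assms by (intro powr_mono2) auto
    also have "\<dots> \<le> a powr r + b powr r" by (simp add: max_def)
    finally show "\<bar>a - b\<bar> powr r \<le> a powr r + b powr r" .
  qed auto
  finally have "\<bar>a - b\<bar> powr p \<le> M powr (p - r) * (a powr r + b powr r)" .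
  then show ?thesis by (rule add_increasing[rotated]) simp
qed

text \<open>For a monotone function one sequence from each side decides continuity. The left
  sequence starts at \<open>t / 2\<close>, so it never leaves the domain.\<close>

lemma mono_on_tendsto_within:
  fixes f :: "real \<Rightarrow> real"
  assumes mono: "\<And>s t. 0 \<le> s \<Longrightarrow> s \<le> t \<Longrightarrow> f s \<le> f t" and t: "0 \<le> t"
    and right: "(\<lambda>k. f (t + 1 / real (Suc k))) \<longlonglongrightarrow> f t"
    and left: "t > 0 \<Longrightarrow> (\<lambda>k. f (t - t / real (Suc (Suc k)))) \<longlonglongrightarrow> f t"
  shows "(f \<longlongrightarrow> f t) (at t within {0..})"
proof (rule tendstoI)
  fix e :: real assume e: "e > 0"
  obtain k where "dist (f (t + 1 / real (Suc k))) (f t) < e"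
    using tendstoD[OF right e] eventually_happens by fastforce
  then have k: "f (t + 1 / real (Suc k)) < f t + e" by (simp add: dist_real_def)
  obtain a where a: "a < t" "\<And>s. 0 \<le> s \<Longrightarrow> a < s \<Longrightarrow> f t - e < f s"
  proof (cases "t = 0")
    case True
    have "f t - e < f s" if "0 \<le> s" for s using mono[of t s] that True e by simp
    then show ?thesis using that[of "t - 1"] by simp
  next
    case False
    then have t0: "t > 0" using t by simp
    obtain j where j: "dist (f (t - t / real (Suc (Suc j)))) (f t) < e"
      using tendstoD[OF left[OF t0] e] eventually_happens by fastforce
    define a where "a = t - t / real (Suc (Suc j))"
    have "0 \<le> a" "a < t" using t0 by (auto simp: a_def field_simps)
    moreover have "f t - e < f a" using j by (simp add: dist_real_def a_def)
    ultimately show ?thesis using that[of a] mono[of a] by (meson le_less_trans less_imp_le less_le_trans)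
  qed
  define b where "b = t + 1 / real (Suc k)"
  have b: "t < b" by (simp add: b_def)
  have "\<forall>\<^sub>F s in at t within {0..}. s \<in> {0..}" by (simp add: eventually_at_filter)
  moreover have "\<forall>\<^sub>F s in at t within {0..}. a < s" by (rule order_tendstoD(1)[OF tendsto_ident_at a(1)])
  moreover have "\<forall>\<^sub>F s in at t within {0..}. s < b" by (rule order_tendstoD(2)[OF tendsto_ident_at b])
  ultimately show "\<forall>\<^sub>F s in at t within {0..}. dist (f s) (f t) < e"
  proof eventually_elim
    case (elim s)
    then have "f t - e < f s" "f s \<le> f b" using a(2) mono[of s b] by auto
    then show ?case using k by (simp add: dist_real_def b_def abs_less_iff)
  qed
qed

section \<open>Interpolation between convergence in the mean and the exponent n/(n-1)\<close>

context polytope_system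
begin

lemma Lp_dist_le:
  assumes u: "u \<in> densities P" and v: "v \<in> densities P"
    and B: "(\<integral>\<^sup>+x\<in>P. epow (u x) r \<partial>lborel) \<le> ennreal B"
      "(\<integral>\<^sup>+x\<in>P. epow (v x) r \<partial>lborel) \<le> ennreal B"
    and M: "M > 0" "1 \<le> p" "p < r" "B \<ge> 0"
  shows "Lp_dist P cmu p u v \<le> ennreal (cmu * (M powr (p - 1) * (volume * dR u v) + M powr (p - r) * (B + B)))"
proof -
  note [measurable] = re_measurable[OF u] re_measurable[OF v]
  have dv: "volume * dR u v \<ge> 0" using volume_pos dR_nonneg by simp
  have "(\<integral>\<^sup>+x\<in>P. (if u x = \<infinity> \<or> v x = \<infinity> then \<infinity> else ennreal (\<bar>enn2real (u x) - enn2real (v x)\<bar> powr p)) \<partial>lborel)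
    \<le> (\<integral>\<^sup>+x. ennreal (M powr (p - 1)) * ennreal \<bar>re u x - re v x\<bar>
        + ennreal (M powr (p - r)) * (ennreal (re u x powr r) + ennreal (re v x powr r)) \<partial>lborel)"
  proof (rule nn_integral_mono_AE, use AE_densities_finite[OF u] AE_densities_finite[OF v] in eventually_elim)
    case (elim x)
    have "ennreal (\<bar>re u x - re v x\<bar> powr p)
        \<le> ennreal (M powr (p - 1) * \<bar>re u x - re v x\<bar> + M powr (p - r) * (re u x powr r + re v x powr r))"
      by (intro ennreal_leI abs_diff_powr_le M) auto
    also have "\<dots> = ennreal (M powr (p - 1)) * ennreal \<bar>re u x - re v x\<bar>
        + ennreal (M powr (p - r)) * (ennreal (re u x powr r) + ennreal (re v x powr r))"
      by (simp add: ennreal_mult)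
    finally have le: "ennreal (\<bar>re u x - re v x\<bar> powr p) \<le> ennreal (M powr (p - 1)) * ennreal \<bar>re u x - re v x\<bar>
        + ennreal (M powr (p - r)) * (ennreal (re u x powr r) + ennreal (re v x powr r))" .
    show ?case
    proof (cases "x \<in> P")
      case True
      then have "u x \<noteq> \<infinity>" "v x \<noteq> \<infinity>" using elim by auto
      then show ?thesis using le True by (simp add: re_def)
    qed simp
  qed
  also have "\<dots> = ennreal (M powr (p - 1)) * (\<integral>\<^sup>+x. ennreal \<bar>re u x - re v x\<bar> \<partial>lborel)
        + ennreal (M powr (p - r)) * ((\<integral>\<^sup>+x. ennreal (re u x powr r) \<partial>lborel) + (\<integral>\<^sup>+x. ennreal (re v x powr r) \<partial>lborel))"
    by (simp add: nn_integral_add nn_integral_cmult)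
  also have "(\<integral>\<^sup>+x. ennreal \<bar>re u x - re v x\<bar> \<partial>lborel) = ennreal (volume * dR u v)"
  proof -
    have "(\<integral>\<^sup>+x. ennreal \<bar>re u x - re v x\<bar> \<partial>lborel) = ennreal (LINT x|lborel. \<bar>re u x - re v x\<bar>)"
      using re_integrable[OF u] re_integrable[OF v] by (intro nn_integral_eq_integral) auto
    then show ?thesis using volume_pos by (simp add: dR_def)
  qed
  also have "ennreal (M powr (p - 1)) * ennreal (volume * dR u v)
        + ennreal (M powr (p - r)) * ((\<integral>\<^sup>+x. ennreal (re u x powr r) \<partial>lborel) + (\<integral>\<^sup>+x. ennreal (re v x powr r) \<partial>lborel))
     \<le> ennreal (M powr (p - 1)) * ennreal (volume * dR u v) + ennreal (M powr (p - r)) * (ennreal B + ennreal B)"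
    by (intro add_mono mult_left_mono integrable_re_powr[OF u B(1)] integrable_re_powr[OF v B(2)]) auto
  also have "\<dots> = ennreal (M powr (p - 1) * (volume * dR u v) + M powr (p - r) * (B + B))"
  proof -
    have "ennreal B + ennreal B = ennreal (B + B)" using M by (intro ennreal_plus[symmetric])
    then show ?thesis using dv M by (simp only: ennreal_mult[symmetric] ennreal_plus[symmetric] mult_nonneg_nonneg add_nonneg_nonneg powr_ge_zero)
  qed
  finally have "Lp_dist P cmu p u v \<le> ennreal cmu * ennreal (M powr (p - 1) * (volume * dR u v) + M powr (p - r) * (B + B))"
    unfolding Lp_dist_def mu_int_def by (rule mult_left_mono) simp
  also have "\<dots> = ennreal (cmu * (M powr (p - 1) * (volume * dR u v) + M powr (p - r) * (B + B)))"
    using cmu_pos dv M by (intro ennreal_mult[symmetric]) auto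
  finally show ?thesis .
qed

lemma Lp_dist_tendsto:
  fixes u :: "real \<Rightarrow> 'a \<Rightarrow> ennreal"
  assumes u: "\<forall>\<^sub>F t in F. u t \<in> finite_energy \<and> Ur (u t) \<le> c" and w: "w \<in> finite_energy" "Ur w \<le> c"
    and lim: "((\<lambda>t. dR (u t) w) \<longlongrightarrow> 0) F"
    and p: "1 \<le> p" "p < real DIM('a) / (real DIM('a) - 1)"
  shows "((\<lambda>t. Lp_dist P cmu p (u t) w) \<longlongrightarrow> 0) F"
proof -
  let ?q = "real DIM('a) / (real DIM('a) - 1)"
  obtain B where B: "\<And>u. u \<in> densities P \<Longrightarrow> \<sigma> u \<le> ennreal (vol P cmu * c) \<Longrightarrow>
    (\<integral>\<^sup>+x\<in>P. epow (u x) ?q \<partial>lborel) \<le> ennreal B"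
    by (rule power_integral_bound[of "vol P cmu * c"]) (rule that, blast)
  define B' where "B' = max 0 B"
  have B': "(\<integral>\<^sup>+x\<in>P. epow (v x) ?q \<partial>lborel) \<le> ennreal B'" if v: "v \<in> finite_energy" "Ur v \<le> c" for v
    using B[OF finite_energyD(1)[OF v(1)] sigma_le_of_Ur_le[OF v]]
    by (rule order_trans) (simp add: B'_def ennreal_leI)
  show ?thesis
  proof (rule order_tendstoI)
    fix a :: ennreal assume "0 < a"
    then obtain b where b: "0 < b" "b < a" using dense by blast
    then obtain e where e: "0 < e" "ennreal e < a" by (cases b) auto
    \<comment> \<open>\<open>M\<close> is fixed first so that the uniform bound makes the tail
      small; the main term, whose factor depends on \<open>M\<close>, is made small afterwards
      through \<open>dR\<close>.\<close>
    have "((\<lambda>M. cmu * (M powr (p - ?q) * (B' + B'))) \<longlongrightarrow> cmu * (0 * (B' + B'))) at_top"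
      using p(2) by (intro tendsto_mult tendsto_const tendsto_neg_powr filterlim_ident) auto
    then have "\<forall>\<^sub>F M in at_top. cmu * (M powr (p - ?q) * (B' + B')) < e / 2"
      using e by (intro order_tendstoD) auto
    then have "\<forall>\<^sub>F M in at_top. cmu * (M powr (p - ?q) * (B' + B')) < e / 2 \<and> M > 0"
      using eventually_gt_at_top[of 0] by eventually_elim simp
    then obtain M where M: "cmu * (M powr (p - ?q) * (B' + B')) < e / 2" "M > 0"
      using eventually_happens trivial_limit_at_top_linorder by blast
    have "((\<lambda>t. cmu * (M powr (p - 1) * (volume * dR (u t) w))) \<longlongrightarrow> cmu * (M powr (p - 1) * (volume * 0))) F"
      by (intro tendsto_mult tendsto_const lim)
    then have "\<forall>\<^sub>F t in F. cmu * (M powr (p - 1) * (volume * dR (u t) w)) < e / 2"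
      using e by (intro order_tendstoD) auto
    then show "\<forall>\<^sub>F t in F. Lp_dist P cmu p (u t) w < a"
      using u
    proof eventually_elim
      case (elim t)
      have "Lp_dist P cmu p (u t) w \<le> ennreal (cmu * (M powr (p - 1) * (volume * dR (u t) w) + M powr (p - ?q) * (B' + B')))"
        by (rule Lp_dist_le) (use elim w B' M p in \<open>auto simp: finite_energyD B'_def\<close>)
      also have "\<dots> \<le> ennreal e" using elim(1) M(1) by (intro ennreal_leI) (simp add: distrib_left)
      finally show ?case using e(2) by simp
    qed
  qed simp
qed

end

section \<open>Comparison of minimizers at different temperatures\<close>

locale canonical_family = polytope_system P cmu csig g
  for P :: "'a::euclidean_space set" and cmu csig and g :: "'a set \<Rightarrow> 'b::euclidean_space \<Rightarrow> 'a" +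
  fixes ucan :: "real \<Rightarrow> 'a \<Rightarrow> ennreal"
  assumes can: "\<And>T. T \<ge> 0 \<Longrightarrow> is_canonical P cmu csig g T (ucan T)"
begin

abbreviation "U T \<equiv> Ur (ucan T)"
abbreviation "S T \<equiv> Sr (ucan T)"

lemma ucan_finite_energy:
  assumes "T \<ge> 0"
  shows "ucan T \<in> finite_energy"
proof -
  have d: "ucan T \<in> densities P" using can[OF assms] Mp_1_iff by (auto simp: is_canonical_def)
  have o: "(\<lambda>_. 1) \<in> Mp P cmu 1" using one_in_densities Mp_1_iff by blast
  have "energy_U P cmu csig g (ucan T) < \<infinity>"
  proof (cases "T > 0")
    case True
    then have "free_F P cmu csig g T (ucan T) \<le> free_F P cmu csig g T (\<lambda>_. 1)"
      using can[OF assms] o by (simp add: is_canonical_def)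
    also have "\<dots> < \<infinity>" by (simp add: free_F_eq[OF one_finite_energy])
    finally show ?thesis by (auto simp: free_F_def split: if_splits)
  next
    case False
    then have "energy_U P cmu csig g (ucan T) \<le> energy_U P cmu csig g (\<lambda>_. 1)"
      using can[OF assms] o by (simp add: is_canonical_def)
    then show ?thesis by (auto simp: energy_U_eq[OF one_finite_energy])
  qed
  then have "\<sigma> (ucan T) < \<infinity>"
    unfolding energy_U_def using vol_pos by (cases "\<sigma> (ucan T)") (auto simp: less_top)
  then show ?thesis using d by (simp add: finite_energy_def)
qed

lemma free_energy_minimal:
  assumes T: "T \<ge> 0" and v: "v \<in> finite_energy"
  shows "U T - T * S T \<le> Ur v - T * Sr v"
proof (cases "T > 0")
  case True
  then have "free_F P cmu csig g T (ucan T) \<le> free_F P cmu csig g T v"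
    using can[OF T] finite_energyD(1)[OF v] Mp_1_iff by (simp add: is_canonical_def)
  then show ?thesis by (simp add: free_F_eq ucan_finite_energy T v)
next
  case False
  then have "energy_U P cmu csig g (ucan T) \<le> energy_U P cmu csig g v"
    using can[OF T] finite_energyD(1)[OF v] Mp_1_iff by (simp add: is_canonical_def)
  then show ?thesis using False T by (simp add: energy_U_eq ucan_finite_energy v)
qed

text \<open>A density with energy at most \<open>U 0\<close> is itself an energy minimizer, so the
  tie-breaking clause at temperature 0 applies to it. This serves to identify the limit in
  \<open>S_right\<close>.\<close>

lemma entropy_maximal_0:
  assumes v: "v \<in> finite_energy" and le: "Ur v \<le> U 0"
  shows "Sr v \<le> S 0"
proof -
  have c: "is_canonical P cmu csig g 0 (ucan 0)" by (rule can) simp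
  have "energy_U P cmu csig g v \<le> energy_U P cmu csig g w" if w: "w \<in> Mp P cmu 1" for w
  proof -
    have "energy_U P cmu csig g v \<le> energy_U P cmu csig g (ucan 0)"
      using le by (simp add: energy_U_eq ucan_finite_energy v)
    also have "\<dots> \<le> energy_U P cmu csig g w" using c w by (simp add: is_canonical_def)
    finally show ?thesis .
  qed
  then have "entropy_S P cmu v \<le> entropy_S P cmu (ucan 0)"
    using c finite_energyD(1)[OF v] Mp_1_iff by (simp add: is_canonical_def)
  then show ?thesis by (simp add: entropy_S_eq ucan_finite_energy v)
qed

text \<open>Each minimality inequality is tested with the other minimizer; in the sum the energies
  cancel.\<close>

lemma S_mono:
  assumes "0 \<le> T" "T \<le> T'"
  shows "S T \<le> S T'"
proof (cases "T = T'")
  case False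
  have "U T - T * S T \<le> U T' - T * S T'" "U T' - T' * S T' \<le> U T - T' * S T"
    using assms by (auto intro!: free_energy_minimal ucan_finite_energy)
  then have "0 \<le> (T' - T) * (S T' - S T)" by (simp add: algebra_simps)
  then show ?thesis using False assms by (simp add: zero_le_mult_iff)
qed simp

lemma U_mono:
  assumes "0 \<le> T" "T \<le> T'"
  shows "U T \<le> U T'"
proof -
  have "U T - T * S T \<le> U T' - T * S T'"
    using assms by (auto intro!: free_energy_minimal ucan_finite_energy)
  moreover have "T * S T \<le> T * S T'" using S_mono[OF assms] assms by (intro mult_left_mono) auto
  ultimately show ?thesis by simp
qed

lemma U_diff_le:
  assumes "0 \<le> T" "0 \<le> T'"
  shows "U T \<le> U T' + T * (S T - S T')"
  using free_energy_minimal[OF assms(1) ucan_finite_energy[OF assms(2)]] by (simp add: algebra_simps)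

lemma U_le_U_one: "0 \<le> T \<Longrightarrow> U T - T * S T \<le> Ur (\<lambda>_. 1)"
  using free_energy_minimal[OF _ one_finite_energy, of T] by (simp add: Sr_one)

lemma S_nonpos: "0 \<le> T \<Longrightarrow> S T \<le> 0"
  by (intro Sr_nonpos ucan_finite_energy)

lemma U_bounded: "0 \<le> T \<Longrightarrow> U T \<le> Ur (\<lambda>_. 1)"
  using U_le_U_one[of T] S_nonpos[of T] mult_nonneg_nonpos[of T "S T"] by simp

lemma dR_le_of_deficit:
  assumes u: "u \<in> finite_energy" and v: "v \<in> finite_energy" and \<epsilon>: "\<epsilon> > 0"
    and le: "Sr (mid u v) - (Sr u + Sr v) / 2 \<le> D / 2"
  shows "dR u v \<le> D / \<epsilon> + 2 * \<epsilon>"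
proof -
  have "2 / \<epsilon> * (Sr (mid u v) - (Sr u + Sr v) / 2) \<le> 2 / \<epsilon> * (D / 2)"
    using \<epsilon> by (intro mult_left_mono le) auto
  then have "dR u v \<le> 2 / \<epsilon> * (D / 2) + 2 * \<epsilon>"
    using dR_le_deficit[OF u v \<epsilon>] by (meson add_right_mono order_trans)
  then show ?thesis by simp
qed

text \<open>Minimality at the higher temperature is tested with the midpoint. Its energy is at most
  \<open>U T'\<close>, energy being affine and monotone in the temperature, so its entropy cannot
  exceed \<open>S T'\<close>, and half the entropy difference bounds the deficit.\<close>

lemma dR_ucan_less:
  assumes T: "0 \<le> T" "T < T'" and \<epsilon>: "\<epsilon> > 0"
  shows "dR (ucan T) (ucan T') \<le> (S T' - S T) / \<epsilon> + 2 * \<epsilon>"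
proof -
  have T': "0 \<le> T'" "0 < T'" using T by auto
  note u = ucan_finite_energy[OF T(1)] and u' = ucan_finite_energy[OF T'(1)]
  let ?m = "mid (ucan T) (ucan T')"
  have "U T' - T' * S T' \<le> (U T + U T') / 2 - T' * Sr ?m"
    using free_energy_minimal[OF T'(1) mid_finite_energy(1)[OF u u']] by (simp add: mid_finite_energy(2)[OF u u'])
  note min = this
  have "x \<le> y" if "b - y \<le> (a + b) / 2 - x" "a \<le> b" for a b x y :: real
    using that by (simp add: field_simps)
  from this[OF min U_mono[OF T(1) less_imp_le[OF T(2)]]] have "T' * Sr ?m \<le> T' * S T'" .
  then have "Sr ?m \<le> S T'" using T' by simp
  then have "Sr ?m - (S T + S T') / 2 \<le> (S T' - S T) / 2" by (simp add: field_simps)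
  then show ?thesis by (rule dR_le_of_deficit[OF u u' \<epsilon>])
qed

lemma dR_ucan:
  assumes T: "0 \<le> T" "0 \<le> T'" and \<epsilon>: "\<epsilon> > 0"
  shows "dR (ucan T) (ucan T') \<le> \<bar>S T' - S T\<bar> / \<epsilon> + 2 * \<epsilon>"
proof (cases T T' rule: linorder_cases)
  case less
  then have "(S T' - S T) / \<epsilon> \<le> \<bar>S T' - S T\<bar> / \<epsilon>" using \<epsilon> by (intro divide_right_mono) auto
  then show ?thesis using dR_ucan_less[OF T(1) less \<epsilon>] by simp
next
  case equal
  then show ?thesis using \<epsilon> by (simp add: dR_def)
next
  case greater
  then have "(S T - S T') / \<epsilon> \<le> \<bar>S T' - S T\<bar> / \<epsilon>" using \<epsilon> by (intro divide_right_mono) auto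
  then show ?thesis using dR_ucan_less[OF T(2) greater \<epsilon>] by (simp add: dR_commute)
qed

text \<open>Minimality at \<open>T\<close> is tested with the midpoint, minimality at
  \<open>T'\<close> with \<open>ucan T\<close>. The energies cancel, and the deficit is controlled
  by the product of temperature and entropy differences. As entropies lie in
  \<open>[S 0, 0]\<close>, no continuity of the entropy is presupposed.\<close>

lemma dR_ucan_pos:
  assumes T: "0 < T" "0 \<le> T'" and \<epsilon>: "\<epsilon> > 0"
  shows "dR (ucan T') (ucan T) \<le> \<bar>T' - T\<bar> * (- S 0) / (T * \<epsilon>) + 2 * \<epsilon>"
proof -
  note u = ucan_finite_energy[OF less_imp_le[OF T(1)]] and u' = ucan_finite_energy[OF T(2)]
  let ?m = "mid (ucan T') (ucan T)"
  have "U T - T * S T \<le> (U T' + U T) / 2 - T * Sr ?m"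
    using free_energy_minimal[OF less_imp_le[OF T(1)] mid_finite_energy(1)[OF u' u]] by (simp add: mid_finite_energy(2)[OF u' u])
  moreover have "U T' \<le> U T + T' * (S T' - S T)" using T by (intro U_diff_le) auto
  ultimately have "T * (Sr ?m - (S T' + S T) / 2) \<le> (T' - T) * (S T' - S T) / 2"
    by (simp add: field_simps)
  also have "(T' - T) * (S T' - S T) \<le> \<bar>T' - T\<bar> * (- S 0)"
  proof -
    have "\<bar>S T' - S T\<bar> \<le> - S 0"
      using S_mono[of 0 T] S_mono[of 0 T'] S_nonpos[of T] S_nonpos[of T'] T by simp
    then have "\<bar>T' - T\<bar> * \<bar>S T' - S T\<bar> \<le> \<bar>T' - T\<bar> * (- S 0)" by (intro mult_left_mono) auto
    then show ?thesis by (metis abs_ge_self abs_mult order_trans)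
  qed
  finally have "Sr ?m - (S T' + S T) / 2 \<le> \<bar>T' - T\<bar> * (- S 0) / T / 2"
    using T by (simp add: field_simps)
  from dR_le_of_deficit[OF u' u \<epsilon> this] show ?thesis by (simp add: divide_divide_eq_left)
qed

text \<open>Comparison with the constant 1 and nonnegativity of the energy give
  \<open>- S T \<le> Ur 1 / T\<close>, while the midpoint has entropy at most 0.\<close>

lemma dR_ucan_one:
  assumes T: "0 < T" and \<epsilon>: "\<epsilon> > 0"
  shows "dR (ucan T) (\<lambda>_. 1) \<le> Ur (\<lambda>_. 1) / (T * \<epsilon>) + 2 * \<epsilon>"
proof -
  note u = ucan_finite_energy[OF less_imp_le[OF T]] and o = one_finite_energy
  let ?m = "mid (ucan T) (\<lambda>_. 1)"
  have "Sr ?m \<le> 0" by (rule Sr_nonpos[OF mid_finite_energy(1)[OF u o]])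
  moreover have "- S T \<le> Ur (\<lambda>_. 1) / T"
  proof -
    have "0 \<le> U T" using vol_pos by (simp add: Ur_def)
    then have "T * (- S T) \<le> Ur (\<lambda>_. 1)" using U_le_U_one[of T] T by simp
    then show ?thesis using T by (simp add: field_simps)
  qed
  ultimately have "Sr ?m - (S T + Sr (\<lambda>_. 1)) / 2 \<le> (Ur (\<lambda>_. 1) / T) / 2" by (simp add: Sr_one)
  from dR_le_of_deficit[OF u o \<epsilon> this] show ?thesis by (simp add: divide_divide_eq_left)
qed

lemma tendsto_0_by_eps:
  fixes f :: "'c \<Rightarrow> real"
  assumes nn: "\<And>x. f x \<ge> 0" and le: "\<And>\<epsilon>. \<epsilon> > 0 \<Longrightarrow> \<forall>\<^sub>F x in F. f x \<le> h x / \<epsilon> + 2 * \<epsilon>" and h: "(h \<longlongrightarrow> 0) F"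
  shows "(f \<longlongrightarrow> 0) F"
proof (rule tendstoI)
  fix e :: real assume e: "e > 0"
  have "((\<lambda>x. h x / (e / 4)) \<longlongrightarrow> 0 / (e / 4)) F" by (rule tendsto_divide[OF h tendsto_const]) (use e in simp)
  then have "\<forall>\<^sub>F x in F. h x / (e / 4) < e / 2" using e by (intro order_tendstoD) auto
  then show "\<forall>\<^sub>F x in F. dist (f x) 0 < e"
    using le[of "e / 4", OF divide_pos_pos[OF e zero_less_numeral]]
  proof eventually_elim
    case (elim x)
    have "f x < e / 2 + 2 * (e / 4)" using elim by (meson add_strict_right_mono le_less_trans)
    then show ?case using nn[of x] by (simp add: dist_real_def)
  qed
qed

section \<open>Continuity in the temperature\<close>

lemma dR_tendsto_pos:
  assumes T: "0 < T" and X: "\<And>k. 0 \<le> X k" "X \<longlonglongrightarrow> T"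
  shows "(\<lambda>k. dR (ucan (X k)) (ucan T)) \<longlonglongrightarrow> 0"
proof (rule tendsto_0_by_eps[OF dR_nonneg])
  fix \<epsilon> :: real assume "\<epsilon> > 0"
  then show "\<forall>\<^sub>F k in sequentially. dR (ucan (X k)) (ucan T) \<le> (\<bar>X k - T\<bar> * (- S 0) / T) / \<epsilon> + 2 * \<epsilon>"
    using dR_ucan_pos[OF T X(1)] by simp
next
  have "(\<lambda>k. \<bar>X k - T\<bar> * (- S 0) / T) \<longlonglongrightarrow> \<bar>T - T\<bar> * (- S 0) / T"
    using T by (intro tendsto_intros X) auto
  then show "(\<lambda>k. \<bar>X k - T\<bar> * (- S 0) / T) \<longlonglongrightarrow> 0" by simp
qed

text \<open>Monotonicity gives a limit \<open>L\<close> that is at least \<open>S T\<close>; upper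
  semicontinuity of the entropy gives the converse once the minimizers have a limit in the mean. For
  \<open>T > 0\<close> it is \<open>ucan T\<close>; for \<open>T = 0\<close> it must be constructed
  and compared with \<open>ucan 0\<close>.\<close>

lemma S_right:
  assumes T: "0 \<le> T"
  shows "(\<lambda>k. S (T + 1 / real (Suc k))) \<longlonglongrightarrow> S T"
proof -
  define X where "X k = T + 1 / real (Suc k)" for k
  have X: "T < X k" "0 \<le> X k" for k using T by (auto simp: X_def add_nonneg_nonneg)
  have X0: "X \<longlonglongrightarrow> T" unfolding X_def by real_asymp
  have anti: "X j \<le> X i" if "i \<le> j" for i j using that by (simp add: X_def frac_le)
  have dec: "decseq (\<lambda>k. S (X k))" using anti X by (auto simp: decseq_def intro!: S_mono)
  have "\<forall>i. S T \<le> S (X i)" using X T by (auto intro!: S_mono simp: less_imp_le)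
  from decseq_convergent[OF dec this] obtain L where L: "(\<lambda>k. S (X k)) \<longlonglongrightarrow> L" "\<And>k. L \<le> S (X k)"
    by blast
  have ge: "S T \<le> L" using L(1) by (rule LIMSEQ_le_const) (use X T in \<open>auto intro!: S_mono simp: less_imp_le\<close>)
  have "L \<le> S T"
  proof (cases "T = 0")
    case False
    then have "T > 0" using T by simp
    then show ?thesis
      using Sr_closed_superlevel[OF ucan_finite_energy[OF X(2)] ucan_finite_energy[OF T] dR_tendsto_pos[OF _ X(2) X0] L(2)] by simp
  next
    case True
    have Cauchy: "\<exists>N. \<forall>i\<ge>N. \<forall>j\<ge>N. dR (ucan (X i)) (ucan (X j)) \<le> e" if e: "e > 0" for e
    proof -
      \<comment> \<open>With \<open>\<epsilon> = e / 4\<close> in \<open>dR_ucan\<close>, the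
        tolerance \<open>e\<^sup>2 / 8\<close> makes both summands of the bound at most
        \<open>e / 2\<close>.\<close>
      obtain N where N: "\<And>i j. i \<ge> N \<Longrightarrow> j \<ge> N \<Longrightarrow> dist (S (X i)) (S (X j)) < e\<^sup>2 / 8"
        using LIMSEQ_imp_Cauchy[OF L(1)] e unfolding Cauchy_def by (metis divide_pos_pos zero_less_numeral zero_less_power)
      have "dR (ucan (X i)) (ucan (X j)) \<le> e" if "i \<ge> N" "j \<ge> N" for i j
      proof -
        have "dR (ucan (X i)) (ucan (X j)) \<le> \<bar>S (X j) - S (X i)\<bar> / (e / 4) + 2 * (e / 4)"
          using e by (intro dR_ucan X) auto
        also have "\<bar>S (X j) - S (X i)\<bar> / (e / 4) \<le> (e\<^sup>2 / 8) / (e / 4)"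
          using N[OF that(2,1)] e by (intro divide_right_mono) (auto simp: dist_real_def)
        also have "(e\<^sup>2 / 8) / (e / 4) = e / 2" using e by (simp add: power2_eq_square)
        finally show ?thesis by simp
      qed
      then show ?thesis by blast
    qed
    obtain W where W: "W \<in> finite_energy" "(\<lambda>k. dR (ucan (X k)) W) \<longlonglongrightarrow> 0"
      using finite_energy_complete[OF ucan_finite_energy[OF X(2)] U_bounded[OF X(2)] Cauchy] by blast
    have "L \<le> Sr W" by (rule Sr_closed_superlevel[OF ucan_finite_energy[OF X(2)] W L(2)])
    \<comment> \<open>Each tail of the sequence has energy at most
      \<open>U 0 + X j * (- S 0)\<close>. Semicontinuity passes this to \<open>W\<close> for fixed
      \<open>j\<close>, and then \<open>j\<close> tends to infinity.\<close>
    moreover have "Ur W \<le> U 0"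
    proof (rule LIMSEQ_le_const)
      have "(\<lambda>j. U 0 + X j * (- S 0)) \<longlonglongrightarrow> U 0 + T * (- S 0)" by (intro tendsto_intros X0)
      then show "(\<lambda>j. U 0 + X j * (- S 0)) \<longlonglongrightarrow> U 0" using True by simp
      have "Ur W \<le> U 0 + X j * (- S 0)" for j
      proof (rule Ur_closed_sublevel[of "\<lambda>k. ucan (X (k + j))"])
        show "(\<lambda>k. dR (ucan (X (k + j))) W) \<longlonglongrightarrow> 0" using LIMSEQ_ignore_initial_segment[OF W(2)] .
        fix k
        have "U (X (k + j)) \<le> U (X j)" using X anti by (intro U_mono) auto
        also have "\<dots> \<le> U 0 + X j * (S (X j) - S 0)" using X by (intro U_diff_le) auto
        also have "\<dots> \<le> U 0 + X j * (- S 0)" using X S_nonpos by (intro add_left_mono mult_left_mono) auto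
        finally show "U (X (k + j)) \<le> U 0 + X j * (- S 0)" .
      qed (use W ucan_finite_energy[OF X(2)] in auto)
      then show "\<exists>N. \<forall>j\<ge>N. Ur W \<le> U 0 + X j * (- S 0)" by blast
    qed
    then have "Sr W \<le> S 0" by (rule entropy_maximal_0[OF W(1)])
    ultimately show ?thesis using True by simp
  qed
  then show ?thesis using L(1) ge unfolding X_def by simp
qed

text \<open>From the left, upper semicontinuity of the entropy only repeats what monotonicity
  already gives. The missing inequality comes from the energy: its semicontinuity yields
  \<open>U T \<le> V\<close>, and minimality along the sequence turns this into
  \<open>S T \<le> L\<close>.\<close>

lemma S_left:
  assumes T: "0 < T"
  shows "(\<lambda>k. S (T - T / real (Suc (Suc k)))) \<longlonglongrightarrow> S T"
proof -
  define X where "X k = T - T / real (Suc (Suc k))" for k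
  have X: "X k < T" "0 \<le> X k" for k using T by (auto simp: X_def field_simps)
  have X0: "X \<longlonglongrightarrow> T" unfolding X_def by real_asymp
  have mono: "X i \<le> X j" if "i \<le> j" for i j using that T by (auto simp: X_def intro!: divide_left_mono)
  have T0: "0 \<le> T" using T by simp
  have incS: "incseq (\<lambda>k. S (X k))" using mono X by (auto simp: incseq_def intro!: S_mono)
  have "\<forall>i. S (X i) \<le> S T" using X by (auto intro!: S_mono simp: less_imp_le)
  from incseq_convergent[OF incS this] obtain L where L: "(\<lambda>k. S (X k)) \<longlonglongrightarrow> L" "\<And>k. S (X k) \<le> L"
    by blast
  have incU: "incseq (\<lambda>k. U (X k))" using mono X by (auto simp: incseq_def intro!: U_mono)
  have "\<forall>i. U (X i) \<le> U T" using X by (auto intro!: U_mono simp: less_imp_le)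
  from incseq_convergent[OF incU this] obtain V where V: "(\<lambda>k. U (X k)) \<longlonglongrightarrow> V" "\<And>k. U (X k) \<le> V"
    by blast
  have "U T \<le> V"
    by (rule Ur_closed_sublevel[OF ucan_finite_energy[OF X(2)] ucan_finite_energy[OF T0] dR_tendsto_pos[OF T X(2) X0] V(2)])
  moreover have "V \<le> U T + T * (L - S T)"
  proof (rule LIMSEQ_le[OF V(1)])
    show "(\<lambda>k. U T + X k * (S (X k) - S T)) \<longlonglongrightarrow> U T + T * (L - S T)" by (intro tendsto_intros X0 L)
    show "\<exists>N. \<forall>k\<ge>N. U (X k) \<le> U T + X k * (S (X k) - S T)" using U_diff_le[OF X(2) T0] by blast
  qed
  ultimately have "0 \<le> T * (L - S T)" by simp
  then have "S T \<le> L" using T by (simp add: zero_le_mult_iff)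
  moreover have "L \<le> S T" using L(1) by (rule LIMSEQ_le_const2) (use X in \<open>auto intro!: S_mono simp: less_imp_le\<close>)
  ultimately show ?thesis using L(1) unfolding X_def by simp
qed

lemma S_tendsto:
  assumes "0 \<le> T"
  shows "(S \<longlongrightarrow> S T) (at T within {0..})"
  by (rule mono_on_tendsto_within) (use assms S_mono S_right S_left in auto)

text \<open>The minimality inequalities at \<open>T\<close> and at \<open>t\<close> enclose the
  energy difference between multiples of the entropy difference.\<close>

lemma U_tendsto:
  assumes T: "0 \<le> T"
  shows "(U \<longlongrightarrow> U T) (at T within {0..})"
proof (rule tendsto_sandwich)
  have nn: "\<forall>\<^sub>F t in at T within {0..}. 0 \<le> t" by (simp add: eventually_at_filter)
  show "\<forall>\<^sub>F t in at T within {0..}. U T + T * (S t - S T) \<le> U t"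
    using nn by eventually_elim (use U_diff_le[OF T] in \<open>force simp: algebra_simps\<close>)
  show "\<forall>\<^sub>F t in at T within {0..}. U t \<le> U T + t * (S t - S T)"
    using nn by eventually_elim (use U_diff_le[OF _ T] in blast)
  have "((\<lambda>t. U T + T * (S t - S T)) \<longlongrightarrow> U T + T * (S T - S T)) (at T within {0..})"
    by (intro tendsto_intros S_tendsto T)
  then show "((\<lambda>t. U T + T * (S t - S T)) \<longlongrightarrow> U T) (at T within {0..})" by simp
  have "((\<lambda>t. U T + t * (S t - S T)) \<longlongrightarrow> U T + T * (S T - S T)) (at T within {0..})"
    by (intro tendsto_intros S_tendsto T)
  then show "((\<lambda>t. U T + t * (S t - S T)) \<longlongrightarrow> U T) (at T within {0..})" by simp
qed

lemma dR_tendsto: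
  assumes T: "0 \<le> T"
  shows "((\<lambda>t. dR (ucan t) (ucan T)) \<longlongrightarrow> 0) (at T within {0..})"
proof (rule tendsto_0_by_eps[OF dR_nonneg])
  fix \<epsilon> :: real assume \<epsilon>: "\<epsilon> > 0"
  have nn: "\<forall>\<^sub>F t in at T within {0..}. 0 \<le> t" by (simp add: eventually_at_filter)
  then show "\<forall>\<^sub>F t in at T within {0..}. dR (ucan t) (ucan T) \<le> \<bar>S T - S t\<bar> / \<epsilon> + 2 * \<epsilon>"
    by eventually_elim (use dR_ucan[OF _ T \<epsilon>] in blast)
next
  have "((\<lambda>t. \<bar>S T - S t\<bar>) \<longlongrightarrow> \<bar>S T - S T\<bar>) (at T within {0..})" by (intro tendsto_intros S_tendsto T)
  then show "((\<lambda>t. \<bar>S T - S t\<bar>) \<longlongrightarrow> 0) (at T within {0..})" by simp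
qed

section \<open>The limit of infinite temperature\<close>

lemma dR_tendsto_at_top: "((\<lambda>t. dR (ucan t) (\<lambda>_. 1)) \<longlongrightarrow> 0) at_top"
proof (rule tendsto_0_by_eps[OF dR_nonneg])
  fix \<epsilon> :: real assume \<epsilon>: "\<epsilon> > 0"
  show "\<forall>\<^sub>F t in at_top. dR (ucan t) (\<lambda>_. 1) \<le> (Ur (\<lambda>_. 1) / t) / \<epsilon> + 2 * \<epsilon>"
    using eventually_gt_at_top[of 0] by eventually_elim (use dR_ucan_one[OF _ \<epsilon>] in simp)
next
  show "((\<lambda>t. Ur (\<lambda>_. 1) / t) \<longlongrightarrow> 0) at_top"
    by (rule tendsto_divide_0[OF tendsto_const filterlim_at_top_imp_at_infinity[OF filterlim_ident]])
qed

text \<open>The energies increase and never exceed that of the constant 1; a smaller bound for all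
  of them would pass to the limit by semicontinuity.\<close>

lemma U_tendsto_at_top: "(U \<longlongrightarrow> Ur (\<lambda>_. 1)) at_top"
proof (rule order_tendstoI)
  fix a assume a: "a < Ur (\<lambda>_. 1)"
  have "\<exists>k::nat. a < U (real k)"
  proof (rule ccontr)
    assume "\<not> ?thesis"
    then have le: "U (real k) \<le> a" for k by (simp add: not_less)
    have "(\<lambda>k. dR (ucan (real k)) (\<lambda>_. 1)) \<longlonglongrightarrow> 0"
      using filterlim_compose[OF dR_tendsto_at_top filterlim_real_sequentially] .
    moreover have "ucan (real k) \<in> finite_energy" for k by (rule ucan_finite_energy) simp
    ultimately have "Ur (\<lambda>_. 1) \<le> a"
      by (intro Ur_closed_sublevel[where u="\<lambda>k. ucan (real k)", OF _ one_finite_energy _ le])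
    then show False using a by simp
  qed
  then obtain k :: nat where k: "a < U (real k)" by blast
  show "\<forall>\<^sub>F t in at_top. a < U t"
    using eventually_ge_at_top[of "real k"]
    by eventually_elim (use k U_mono[of "real k"] less_le_trans in auto)
next
  fix a assume a: "Ur (\<lambda>_. 1) < a"
  show "\<forall>\<^sub>F t in at_top. U t < a"
    using eventually_ge_at_top[of 0] by eventually_elim (rule le_less_trans[OF U_bounded a])
qed

text \<open>The free energy lies between \<open>U t\<close> and the energy of the constant 1,
  because entropies are nonpositive and the constant has entropy 0.\<close>

lemma F_tendsto_at_top: "((\<lambda>t. U t - t * S t) \<longlongrightarrow> Ur (\<lambda>_. 1)) at_top"
proof (rule tendsto_sandwich[OF _ _ U_tendsto_at_top tendsto_const])
  show "\<forall>\<^sub>F t in at_top. U t \<le> U t - t * S t"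
    using eventually_ge_at_top[of 0]
    by eventually_elim (use S_nonpos mult_nonneg_nonpos in auto)
  show "\<forall>\<^sub>F t in at_top. U t - t * S t \<le> Ur (\<lambda>_. 1)"
    using eventually_ge_at_top[of 0] by eventually_elim (rule U_le_U_one)
qed

lemma TS_tendsto_at_top: "((\<lambda>t. t * S t) \<longlongrightarrow> 0) at_top"
  using tendsto_diff[OF U_tendsto_at_top F_tendsto_at_top] by simp

lemma ucan_in_Mp:
  assumes T: "0 \<le> T"
  shows "ucan T \<in> Mp P cmu (DIM('a) / (real DIM('a) - 1))"
proof -
  note u = finite_energyD[OF ucan_finite_energy[OF T]]
  obtain c where c: "\<sigma> (ucan T) \<le> ennreal c" using u(2) by (cases "\<sigma> (ucan T)") auto
  obtain B where B: "\<And>u. u \<in> densities P \<Longrightarrow> \<sigma> u \<le> ennreal c \<Longrightarrow>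
    (\<integral>\<^sup>+x\<in>P. epow (u x) (DIM('a) / (real DIM('a) - 1)) \<partial>lborel) \<le> ennreal B"
    by (rule power_integral_bound[of c]) (rule that, blast)
  from B[OF u(1) c] have "mu_int P cmu (\<lambda>x. epow (ucan T x) (DIM('a) / (real DIM('a) - 1))) < \<infinity>"
    unfolding mu_int_def by (auto simp: ennreal_mult_less_top intro: le_less_trans)
  moreover have "ucan T \<in> Mp P cmu 1" using u(1) Mp_1_iff by blast
  ultimately show ?thesis by (simp add: Mp_def)
qed

end

theorem mainTheorem14:
  fixes P :: "'a::euclidean_space set" and cmu :: real and csig :: "'a set \<Rightarrow> real"
    and g :: "'a set \<Rightarrow> 'b::euclidean_space \<Rightarrow> 'a"
    and ucan :: "real \<Rightarrow> 'a \<Rightarrow> ennreal"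
  assumes sys: "is_system P cmu csig g"
    and n2: "DIM('a) \<ge> 2"
    and can: "\<And>T. T \<ge> 0 \<Longrightarrow> is_canonical P cmu csig g T (ucan T)"
  shows "(\<forall>T\<ge>0. ucan T \<in> Mp P cmu (DIM('a) / (DIM('a) - 1)))
    \<and> (\<forall>p. 1 \<le> p \<and> p < DIM('a) / (DIM('a) - 1) \<longrightarrow>
          (\<forall>T0\<ge>0. ((\<lambda>T. Lp_dist P cmu p (ucan T) (ucan T0)) \<longlongrightarrow> 0) (at T0 within {0..}))
        \<and> ((\<lambda>T. Lp_dist P cmu p (ucan T) (\<lambda>_. 1)) \<longlongrightarrow> 0) at_top)
    \<and> continuous_on {0..} (\<lambda>T. free_F P cmu csig g T (ucan T))
    \<and> continuous_on {0..} (\<lambda>T. energy_U P cmu csig g (ucan T))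
    \<and> continuous_on {0..} (\<lambda>T. entropy_S P cmu (ucan T))
    \<and> ((\<lambda>T. free_F P cmu csig g T (ucan T)) \<longlongrightarrow> energy_U P cmu csig g (\<lambda>_. 1)) at_top
    \<and> ((\<lambda>T. energy_U P cmu csig g (ucan T)) \<longlongrightarrow> energy_U P cmu csig g (\<lambda>_. 1)) at_top
    \<and> ((\<lambda>T. ereal T * entropy_S P cmu (ucan T)) \<longlongrightarrow> 0) at_top"
proof -
  have "polytope_system P cmu csig g" using sys n2 by (rule polytope_system.intro)
  moreover have "canonical_family_axioms P cmu csig g ucan" using can by (rule canonical_family_axioms.intro)
  ultimately have "canonical_family P cmu csig g ucan" by (rule canonical_family.intro)
  then interpret canonical_family P cmu csig g ucan .
  \<comment> \<open>The statement subtracts 1 among the natural numbers, the lemmas among the reals;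
    both agree since the dimension is at least 2.\<close>
  have q: "real DIM('a) / real (DIM('a) - 1) = real DIM('a) / (real DIM('a) - 1)"
    using dim2 by (simp add: of_nat_diff)
  note [simp] = free_F_eq[OF ucan_finite_energy] energy_U_eq[OF ucan_finite_energy]
    entropy_S_eq[OF ucan_finite_energy] energy_U_eq[OF one_finite_energy]
  have nn: "\<forall>\<^sub>F T in at_top. (0::real) \<le> T" by (rule eventually_ge_at_top)
  have ev: "\<forall>\<^sub>F T in F. ucan T \<in> finite_energy \<and> U T \<le> Ur (\<lambda>_. 1)" if "\<forall>\<^sub>F T in F. 0 \<le> T" for F
    using that by eventually_elim (intro conjI ucan_finite_energy U_bounded)
  have Lp: "((\<lambda>T. Lp_dist P cmu p (ucan T) (ucan T0)) \<longlongrightarrow> 0) (at T0 within {0..})"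
    if p: "1 \<le> p" "p < real DIM('a) / (real DIM('a) - 1)" and T0: "0 \<le> T0" for p T0
  proof -
    have "\<forall>\<^sub>F T in at T0 within {0..}. 0 \<le> T" by (simp add: eventually_at_filter)
    from Lp_dist_tendsto[OF ev[OF this] ucan_finite_energy[OF T0] U_bounded[OF T0] dR_tendsto[OF T0] p]
    show ?thesis .
  qed
  have Lp1: "((\<lambda>T. Lp_dist P cmu p (ucan T) (\<lambda>_. 1)) \<longlongrightarrow> 0) at_top"
    if p: "1 \<le> p" "p < real DIM('a) / (real DIM('a) - 1)" for p
    by (rule Lp_dist_tendsto[OF ev[OF nn] one_finite_energy order_refl dR_tendsto_at_top p])
  have cont: "continuous_on {0..} f"
    if "\<And>t. 0 \<le> t \<Longrightarrow> f t = ereal (h t)" "\<And>t. 0 \<le> t \<Longrightarrow> (h \<longlongrightarrow> h t) (at t within {0..})"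
    for f :: "real \<Rightarrow> ereal" and h
  proof (rule continuous_on_eq)
    show "continuous_on {0..} (\<lambda>t. ereal (h t))"
      unfolding continuous_on_def using that(2) by simp
  qed (use that(1) in simp)
  have F: "continuous_on {0..} (\<lambda>T. free_F P cmu csig g T (ucan T))"
  proof (rule cont)
    show "((\<lambda>T. U T - T * S T) \<longlongrightarrow> U t - t * S t) (at t within {0..})" if "0 \<le> t" for t
      by (intro tendsto_diff tendsto_mult tendsto_ident_at U_tendsto S_tendsto that)
  qed simp
  have E: "continuous_on {0..} (\<lambda>T. energy_U P cmu csig g (ucan T))"
    by (rule cont[where h=U]) (simp_all add: U_tendsto)
  have S: "continuous_on {0..} (\<lambda>T. entropy_S P cmu (ucan T))"
    by (rule cont[where h=S]) (simp_all add: S_tendsto)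
  \<comment> \<open>The canonical quantities are known to equal their real counterparts for
    \<open>T \<ge> 0\<close> only, so the limit is transferred through eventual equality.\<close>
  have F1: "((\<lambda>T. free_F P cmu csig g T (ucan T)) \<longlongrightarrow> energy_U P cmu csig g (\<lambda>_. 1)) at_top"
    using tendsto_ereal[OF F_tendsto_at_top]
    by (rule Lim_transform_eventually[THEN tendsto_eq_rhs]) (rule eventually_mono[OF nn], simp, simp)
  have E1: "((\<lambda>T. energy_U P cmu csig g (ucan T)) \<longlongrightarrow> energy_U P cmu csig g (\<lambda>_. 1)) at_top"
    using tendsto_ereal[OF U_tendsto_at_top]
    by (rule Lim_transform_eventually[THEN tendsto_eq_rhs]) (rule eventually_mono[OF nn], simp, simp)
  have S1: "((\<lambda>T. ereal T * entropy_S P cmu (ucan T)) \<longlongrightarrow> 0) at_top"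
    using tendsto_ereal[OF TS_tendsto_at_top]
    by (rule Lim_transform_eventually[THEN tendsto_eq_rhs]) (rule eventually_mono[OF nn], simp, simp add: zero_ereal_def)
  show ?thesis
    using ucan_in_Mp Lp Lp1 F E S F1 E1 S1 unfolding q by blast
qed

end
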